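(* Fix an integer $d\geq 2$, $\gamma>0$ and $0\leq\lambda\leq 1$. Let $\eta_{\gamma,\lambda}$ be a Poisson process of $\lambda$-geodesic hyperplanes in $\mathbb{H}^d$ with intensity measure $\gamma\nu_\lambda^o$, and let $$Z_{\gamma,\lambda,d}=\{x\in\mathbb{H}^d: [o,x]\cap H=\varnothing\text{ for all }H\in\eta_{\gamma,\lambda}\}$$ be the visibility region of $o$. Put $$\gamma_{\mathrm{crit}}:=\sqrt{\pi}\,(d-1)^2\,\frac{\Gamma(\frac{d-1}{2})}{\Gamma(\frac d2)}.$$ (a) If $\gamma<\gamma_{\mathrm{crit}}$, then $Z_{\gamma,\lambda,d}$ is unbounded with strictly positive probability, whereas if $\gamma>\gamma_{\mathrm{crit}}$, then $Z_{\gamma,\lambda,d}$ is almost surely bounded. Moreover, if $d=2$, then $Z_{\gamma_{\mathrm{crit}},\lambda,2}$ is almost surely bounded. (b) If $\gamma>\gamma_{\mathrm{crit}}$, then $$\mathbb{E}\,\mathrm{vol}_d(Z_{\gamma,\lambda,d})=\mathbb{E}\,\mathrm{vol}_d(Z_{\gamma,0,d})=\pi^{\frac{d-1}{2}}\,\Gamma\Big(\frac{d+1}{2}\Big)\frac{\Gamma\big(\frac{\gamma_d^\ast-d+1}{2}\big)}{\Gamma\big(\frac{\gamma_d^\ast+d+1}{2}\big)},\qquad \gamma_d^\ast:=\gamma\,\frac{\Gamma(\frac d2)}{2\sqrt{\pi}\,\Gamma(\frac{d+1}{2})}.$$ On the other hand, $\mathbb{E}\,\mathrm{vol}_d(Z_{\gamma,\lambda,d})=+\infty$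 for all $\gamma\leq\gamma_{\mathrm{crit}}$.
   Context: $\mathbb{H}^d$ is $d$-dimensional hyperbolic space of constant curvature $-1$, realised as the Poincaré ball: the open Euclidean unit ball $\mathbb{B}^d$ with Riemannian metric $\frac{4}{(1-\|y\|^2)^2}\,dy^2$. The origin $o$ is the centre $0$ of $\mathbb{B}^d$; the hyperbolic distance from $o$ to $y$ is $2\,\mathrm{artanh}\|y\|$. $[o,x]$ is the geodesic segment from $o$ to $x$ (a Euclidean radial segment in this model). $\mathrm{vol}_d$ is hyperbolic volume; boundedness is with respect to the hyperbolic metric. For $\lambda\in[0,1]$, a $\lambda$-geodesic hyperplane is a complete totally umbilical hypersurface of $\mathbb{H}^d$ with normal curvature $\lambda$ ($\lambda=0$: totally geodesic hyperplanes; $\lambda=1$: horospheres; $0<\lambda<1$: equidistant hypersurfaces). $\mathrm{Hyp}_\lambda^o$ is the space of $\lambda$-geodesic hyperplanes for which $o$ does not lie on the convex side. Its elements are parametrised by $(s,u)\in(0,\infty)\times\mathbb{S}^{d-1}$, with $s$ the hyperbolic distance from $o$ to the hyperplane: with $r=\tanh(s/2)\in(0,1)$ and $R=\frac{1-r^2}{2(\lambda+r)}$, the hyperplane is $$H_h(s,u)=\{x\in\mathbb{B}^d:\|x-(r+R)u\|=R\}.$$ The measure $\nu_\lambda^o$ on $\mathrm{Hyp}_\lambda^o$ (the restriction of a suitably normalised isometry-invariant measure on the space of all $\lambda$-geodesic hyperplanes) is $$\nu_\lambda^o(\,\cdot\,)=\int_0^\infty\int_{\mathbb{S}^{d-1}}\mathbf{1}\{H_h(s,u)\in\cdot\,\}\,(\cosh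 s+\lambda\sinh s)^{d-1}\,\sigma_{d-1}(du)\,ds,$$ where $\sigma_{d-1}$ is the normalised (probability) surface measure on $\mathbb{S}^{d-1}$. *)

theory Defs
  imports "HOL-Probability.Probability"
begin

section \<open>Hyperbolic space in the Poincare ball model\<close>

text \<open>
  The ambient space is a Euclidean space \<^typ>\<open>'a\<close> of dimension \<open>d = DIM('a)\<close>; hyperbolic space is
  the open unit ball \<^term>\<open>ball 0 1\<close> with Riemannian metric \<open>4 / (1 - \<parallel>y\<parallel>\<^sup>2)\<^sup>2 dy\<^sup>2\<close>.
\<close>

definition hyp_dist_origin :: "'a::euclidean_space \<Rightarrow> real" where
  "hyp_dist_origin y = 2 * artanh (norm y)"

definition hyp_bounded :: "'a::euclidean_space set \<Rightarrow> bool" where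
  "hyp_bounded S \<longleftrightarrow> S \<subseteq> ball 0 1 \<and> (\<exists>C. \<forall>y\<in>S. hyp_dist_origin y \<le> C)"

text \<open>The density is the square root of the determinant of the metric tensor.\<close>

definition hyp_vol :: "'a::euclidean_space measure" where
  "hyp_vol = density (restrict_space lborel (ball 0 1))
     (\<lambda>y. ennreal ((2 / (1 - (norm y)\<^sup>2)) ^ DIM('a)))"


section \<open>The space of \<open>\<lambda>\<close>-geodesic hyperplanes and its measure\<close>

text \<open>
  The \<open>\<lambda>\<close>-geodesic hyperplane at hyperbolic distance \<open>s\<close> from the origin in direction \<open>u\<close>, with the
  origin not on its convex side.
\<close>

definition lambda_hyperplane :: "real \<Rightarrow> real \<Rightarrow> 'a::euclidean_space \<Rightarrow> 'a set" where
  "lambda_hyperplane lam s u =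
     (let r = tanh (s / 2); R = (1 - r\<^sup>2) / (2 * (lam + r))
      in {x \<in> ball 0 1. norm (x - (r + R) *\<^sub>R u) = R})"

text \<open>
  Normalised surface measure on the unit sphere: the law of \<open>x / \<parallel>x\<parallel>\<close> (in HOL, \<^term>\<open>sgn x\<close>) for
  \<open>x\<close> uniform in the unit ball. The point \<open>0\<close>, where \<^term>\<open>sgn\<close> is not on the sphere, is null.
\<close>

definition sphere_measure :: "'a::euclidean_space measure" where
  "sphere_measure = restrict_space (distr (uniform_measure lborel (ball 0 1)) borel sgn) (sphere 0 1)"

text \<open>
  \<^const>\<open>embed_measure\<close> transports both the Borel \<open>\<sigma>\<close>-algebra of the parameter space
  \<open>(0,\<infinity>) \<times> S\<^sup>d\<^sup>-\<^sup>1\<close> and the measure along the parametrisation, which is injective for \<open>d \<ge> 2\<close>.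
  So \<^term>\<open>space (hyperplane_measure lam)\<close> is exactly the set of the \<open>\<lambda>\<close>-geodesic hyperplanes for which
  the origin is not on the convex side.
\<close>

definition hyperplane_measure :: "real \<Rightarrow> 'a::euclidean_space set measure" where
  "hyperplane_measure lam =
     embed_measure
       (density (restrict_space lborel {0<..} \<Otimes>\<^sub>M (sphere_measure :: 'a measure))
          (\<lambda>(s, u). ennreal ((cosh s + lam * sinh s) ^ (DIM('a) - 1))))
       (\<lambda>(s, u). lambda_hyperplane lam s u)"


section \<open>Poisson processes\<close>

text \<open>
  A Poisson process with (diffuse) intensity measure \<open>\<Lambda>\<close>, viewed as a random countable set. Points are
  counted by the counting measure with values in \<^typ>\<open>ennreal\<close>. Independence is stated for disjoint
  sequences; finite disjoint families are covered by padding with empty sets. The Poisson weights are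
  written out because \<^const>\<open>poisson_pmf\<close> is only specified for a strictly positive rate.
\<close>

definition num_points :: "'h set \<Rightarrow> ennreal" where
  "num_points S = emeasure (count_space UNIV) S"

definition poisson_process :: "'w measure \<Rightarrow> 'h measure \<Rightarrow> ('w \<Rightarrow> 'h set) \<Rightarrow> bool" where
  "poisson_process M \<Lambda> \<eta> \<longleftrightarrow>
     prob_space M \<and>
     (\<forall>\<omega>\<in>space M. \<eta> \<omega> \<subseteq> space \<Lambda> \<and> countable (\<eta> \<omega>)) \<and>
     (\<forall>A\<in>sets \<Lambda>. (\<lambda>\<omega>. num_points (\<eta> \<omega> \<inter> A)) \<in> borel_measurable M) \<and>
     (\<forall>A\<in>sets \<Lambda>. emeasure \<Lambda> A < \<infinity> \<longrightarrow>
        (\<forall>k. \<P>(\<omega> in M. num_points (\<eta> \<omega> \<inter> A) = of_nat k) =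
           measure \<Lambda> A ^ k / fact k * exp (- measure \<Lambda> A))) \<and>
     (\<forall>A\<in>sets \<Lambda>. emeasure \<Lambda> A = \<infinity> \<longrightarrow> (AE \<omega> in M. num_points (\<eta> \<omega> \<inter> A) = \<infinity>)) \<and>
     (\<forall>A :: nat \<Rightarrow> 'h set. range A \<subseteq> sets \<Lambda> \<longrightarrow> disjoint_family A \<longrightarrow>
        prob_space.indep_vars M (\<lambda>_. borel) (\<lambda>i \<omega>. num_points (\<eta> \<omega> \<inter> A i)) UNIV)"

text \<open>
  As usual for processes of closed sets, realisations are locally finite: only finitely many
  hyperplanes meet a given compact subset of hyperbolic space. (The intensity measure is locally
  finite, so this already holds almost surely; requiring it everywhere makes the visibility region
  below a genuine random open set.)
\<close>

definition poisson_hyperplane_process ::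
    "'w measure \<Rightarrow> real \<Rightarrow> real \<Rightarrow> ('w \<Rightarrow> 'a::euclidean_space set set) \<Rightarrow> bool" where
  "poisson_hyperplane_process M \<gamma> lam \<eta> \<longleftrightarrow>
     poisson_process M (scale_measure (ennreal \<gamma>) (hyperplane_measure lam)) \<eta> \<and>
     (\<forall>\<omega>\<in>space M. \<forall>K. compact K \<longrightarrow> K \<subseteq> ball 0 1 \<longrightarrow> finite {H \<in> \<eta> \<omega>. H \<inter> K \<noteq> {}})"


section \<open>The visibility region\<close>

text \<open>Hyperbolic geodesic segments issuing from the origin are Euclidean segments.\<close>

definition visibility_region :: "'a::euclidean_space set set \<Rightarrow> 'a set" where
  "visibility_region E = {x \<in> ball 0 1. \<forall>H\<in>E. closed_segment 0 x \<inter> H = {}}"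

definition expected_visible_volume ::
    "'w measure \<Rightarrow> ('w \<Rightarrow> 'a::euclidean_space set set) \<Rightarrow> ennreal" where
  "expected_visible_volume M \<eta> = (\<integral>\<^sup>+ \<omega>. emeasure hyp_vol (visibility_region (\<eta> \<omega>)) \<partial>M)"

definition gamma_crit :: "nat \<Rightarrow> real" where
  "gamma_crit d = sqrt pi * (real d - 1)\<^sup>2 * Gamma ((real d - 1) / 2) / Gamma (real d / 2)"

definition gamma_star :: "nat \<Rightarrow> real \<Rightarrow> real" where
  "gamma_star d \<gamma> = \<gamma> * Gamma (real d / 2) / (2 * sqrt pi * Gamma ((real d + 1) / 2))"

end

theory Submission
  imports Defs
begin

text \<open>
  Write \<open>\<kappa> = \<Gamma>(d/2) / (2 \<surd>\<pi> \<Gamma>((d+1)/2))\<close>, so that the critical intensity is \<open>(d - 1) / \<kappa>\<close>. A ray from the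
  origin enters the convex side of a hyperplane at most once, and the density of the entry point is the
  constant \<open>\<kappa>\<close>, whatever \<open>\<lambda>\<close> is: a point at distance \<open>\<tau>\<close> is visible with probability
  \<open>exp (- \<gamma> \<kappa> \<tau>)\<close>. Fubini's theorem then turns the expected volume into a Beta integral.

  Below the critical intensity, the measure of the set of directions visible up to distance \<open>n\<close>
  has a second moment comparable with the square of its mean, because two rays at angle \<open>\<theta>\<close> share only
  about \<open>\<kappa> ln (1/\<theta>)\<close> hyperplanes. Above it, a cap of radius \<open>exp (- n)\<close> contains a visible direction
  with probability \<open>O(exp (- \<gamma> \<kappa> n))\<close>, while \<open>O(exp ((d - 1) n))\<close> such caps cover the sphere. In the
  plane at criticality that count stays bounded, but given the first visible point of a fine grid on
  the circle, the expected number of later visible ones is of order \<open>n\<close>; so a visible point exists with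
  probability \<open>O(1/n)\<close>.
\<close>

section \<open>Spherical caps\<close>

text \<open>In the hyperboloid model a \<open>lam\<close>-geodesic hyperplane is an affine section:
  the Minkowski product of the point (\<open>cosh t\<close>, \<open>sinh t *\<^sub>R v\<close>) with
  the normal (\<open>amp_deriv lam s\<close>, \<open>amp lam s *\<^sub>R u\<close>) equals
  \<open>lam\<close>. This is the origin of the two functions and of the equation on which all
  geometry rests. The directions shadowed by such a hyperplane form a cap of sine at most
  \<open>1 / amp lam s\<close>, a value approached or attained as the distance grows. Hence the
  density \<open>amp lam s ^ (d - 1)\<close> cancels the decay of the cap measure, and each layer of
  unit thickness in \<open>s\<close> contributes about \<kappa>, whatever \<open>lam\<close> is. For
  positive \<open>lam\<close> a shadow stops growing at a finite distance, because a ray can leave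
  the convex side again; this is the obstacle in the exact computation and the reason for working
  with entry points. For boundedness a whole cap of directions has to be blocked at once. The set
  \<open>margin_hits\<close> does this while losing only an additive constant of measure, uniformly
  in the distance, hence a constant factor in probability. The critical planar case cannot afford
  more than that.\<close>

lemma nn_integral_lborel_translate:
  fixes f :: "'a::euclidean_space \<Rightarrow> ennreal"
  assumes [measurable]: "f \<in> borel_measurable borel"
  shows "(\<integral>\<^sup>+x. f (x + c) \<partial>lborel) = (\<integral>\<^sup>+x. f x \<partial>lborel)"
proof -
  have "(\<integral>\<^sup>+x. f x \<partial>lborel) = (\<integral>\<^sup>+x. f x \<partial>distr lborel borel ((+) c))"
    by (simp add: lborel_distr_plus)
  also have "\<dots> = (\<integral>\<^sup>+x. f (x + c) \<partial>lborel)"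
    by (subst nn_integral_distr) (auto simp: add.commute)
  finally show ?thesis ..
qed

text \<open>Uniqueness of Haar measure: Fubini's theorem compares the image measure with Lebesgue
  measure by means of the rotation-invariant set \<open>ball 0 1\<close>.\<close>

lemma lborel_distr_orthogonal_transformation:
  fixes f :: "'a::euclidean_space \<Rightarrow> 'a"
  assumes f: "orthogonal_transformation f"
  shows "distr lborel borel f = lborel"
proof (rule measure_eqI)
  have lin: "linear f" using f by (rule orthogonal_transformation_linear)
  then have [measurable]: "f \<in> borel_measurable borel"
    by (intro borel_measurable_continuous_onI linear_continuous_on linear_conv_bounded_linear[THEN iffD1])
  fix A assume "A \<in> sets (distr lborel borel f)"
  then have [measurable]: "A \<in> sets borel" by simp
  let ?B = "ball 0 1 :: 'a set"
  have [measurable]: "?B \<in> sets borel" by simp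
  have ball: "emeasure lborel (ball c 1 :: 'a set) = emeasure lborel ?B" for c
    by (simp add: emeasure_ball)
  have "emeasure lborel ?B * emeasure (distr lborel borel f) A
      = (\<integral>\<^sup>+x. indicator ?B x \<partial>lborel) * (\<integral>\<^sup>+y. indicator A (f y) \<partial>lborel)"
    by (subst nn_integral_distr[symmetric, where T=f and M'=borel and f="indicator A"]) auto
  also have "\<dots> = (\<integral>\<^sup>+x. indicator ?B x * (\<integral>\<^sup>+y. indicator A (f y) \<partial>lborel) \<partial>lborel)"
    by (rule nn_integral_multc[symmetric]) measurable
  also have "\<dots> = (\<integral>\<^sup>+x. indicator ?B x * (\<integral>\<^sup>+y. indicator A (x + f y) \<partial>lborel) \<partial>lborel)"
  proof (intro nn_integral_cong)
    fix x
    obtain c where c: "f c = x"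
      using orthogonal_transformation_surj[OF f] by (metis surjD)
    have "(\<integral>\<^sup>+y. indicator A (x + f y) \<partial>lborel) = (\<integral>\<^sup>+y. indicator A (f (y + c)) \<partial>lborel)"
      by (simp add: linear_add[OF lin] c add.commute)
    also have "\<dots> = (\<integral>\<^sup>+y. indicator A (f y) \<partial>lborel)"
      by (rule nn_integral_lborel_translate[where f="\<lambda>y. indicator A (f y)"]) simp
    finally show "indicator ?B x * (\<integral>\<^sup>+y. indicator A (f y) \<partial>lborel) = indicator ?B x * (\<integral>\<^sup>+y. indicator A (x + f y) \<partial>lborel)"
      by simp
  qed
  also have "\<dots> = (\<integral>\<^sup>+x. (\<integral>\<^sup>+y. indicator ?B x * indicator A (x + f y) \<partial>lborel) \<partial>lborel)"
    by (intro nn_integral_cong nn_integral_cmult[symmetric]) simp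
  also have "\<dots> = (\<integral>\<^sup>+y. (\<integral>\<^sup>+x. indicator ?B x * indicator A (x + f y) \<partial>lborel) \<partial>lborel)"
    by (rule lborel_pair.Fubini') measurable
  also have "\<dots> = (\<integral>\<^sup>+y. (\<integral>\<^sup>+x. indicator ?B (x - f y) * indicator A x \<partial>lborel) \<partial>lborel)"
  proof (rule nn_integral_cong)
    fix y
    show "(\<integral>\<^sup>+x. indicator ?B x * indicator A (x + f y) \<partial>lborel) = (\<integral>\<^sup>+x. indicator ?B (x - f y) * indicator A x \<partial>lborel)"
      using nn_integral_lborel_translate[where f="\<lambda>x. indicator ?B (x - f y) * indicator A x" and c="f y"] by simp
  qed
  also have "\<dots> = (\<integral>\<^sup>+x. (\<integral>\<^sup>+y. indicator ?B (x - f y) * indicator A x \<partial>lborel) \<partial>lborel)"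
    by (rule lborel_pair.Fubini') measurable
  also have "\<dots> = (\<integral>\<^sup>+x. (\<integral>\<^sup>+y. indicator ?B (x - f y) \<partial>lborel) * indicator A x \<partial>lborel)"
    by (intro nn_integral_cong nn_integral_multc) measurable
  also have "\<dots> = (\<integral>\<^sup>+x. emeasure lborel ?B * indicator A x \<partial>lborel)"
  proof (intro nn_integral_cong arg_cong2[where f="(*)"] refl)
    fix x
    obtain c where c: "f c = x"
      using orthogonal_transformation_surj[OF f] by (metis surjD)
    have "norm (x - f y) = norm (c - y)" for y
      using orthogonal_transformation_norm[OF f, of "c - y"] by (simp add: linear_diff[OF lin] c)
    then have "(\<integral>\<^sup>+y. indicator ?B (x - f y) \<partial>lborel) = (\<integral>\<^sup>+y. indicator (ball c 1) y \<partial>lborel)"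
      by (intro nn_integral_cong) (auto simp: indicator_def dist_norm norm_minus_commute)
    then show "(\<integral>\<^sup>+y. indicator ?B (x - f y) \<partial>lborel) = emeasure lborel ?B"
      using ball by simp
  qed
  also have "\<dots> = emeasure lborel ?B * emeasure lborel A"
    by (simp add: nn_integral_cmult)
  finally have "emeasure lborel ?B * emeasure (distr lborel borel f) A = emeasure lborel ?B * emeasure lborel A" .
  moreover have "emeasure lborel ?B \<noteq> 0" "emeasure lborel ?B \<noteq> \<infinity>"
    by (simp_all add: emeasure_ball ennreal_eq_0_iff not_le)
  ultimately show "emeasure (distr lborel borel f) A = emeasure lborel A"
    by (simp add: ennreal_mult_cancel_left)
qed simp

text \<open>The reflection in the hyperplane orthogonal to \<open>v - b\<close> exchanges the two
  unit vectors.\<close>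

lemma orthogonal_transformation_to_basis:
  fixes v b :: "'a::euclidean_space"
  assumes "norm v = 1" "norm b = 1"
  obtains f where "orthogonal_transformation f" "f v = b"
proof (cases "v = b")
  case True
  then show ?thesis by (intro that[of "\<lambda>x. x"]) (simp_all add: orthogonal_transformation_def linear_iff)
next
  case False
  define w where "w = v - b"
  define f where "f x = x - (2 * (x \<bullet> w) / (w \<bullet> w)) *\<^sub>R w" for x
  have w: "w \<bullet> w \<noteq> 0" using False by (simp add: w_def)
  have vv: "v \<bullet> v = 1" "b \<bullet> b = 1" using assms by (simp_all add: norm_eq_1)
  have ww: "w \<bullet> w = 2 * (v \<bullet> w)"
    by (simp add: w_def inner_diff vv inner_commute algebra_simps)
  show ?thesis
  proof (rule that[of f])
    have "linear f"
      unfolding f_def by (auto simp: linear_iff inner_add_left algebra_simps add_divide_distrib)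
    moreover have "f x \<bullet> f y = x \<bullet> y" for x y
      using w unfolding f_def by (simp add: inner_diff inner_commute field_simps)
    ultimately show "orthogonal_transformation f" by (simp add: orthogonal_transformation_def)
    have "2 * (v \<bullet> w) / (w \<bullet> w) = 1" using ww w by simp
    then show "f v = b" unfolding f_def by (simp only: w_def) simp
  qed
qed

text \<open>This is \<kappa>: the volume of the unit ball of dimension d - 1 over the surface area
  of the unit sphere, that is, the leading coefficient in the measure of a small cap.\<close>

definition cap_const :: "nat \<Rightarrow> real" where
  "cap_const d = unit_ball_vol (real (d - 1)) / (real d * unit_ball_vol (real d))"

text \<open>The measure of the caps \<open>{u. c \<le> u \<bullet> v}\<close> for \<open>0 < c\<close>: slices of the solid cone over the cap are balls of
  dimension \<open>d - 1\<close>, whose radius is limited by the cone for heights below \<open>c\<close> and by the sphere above.\<close>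

definition cap_measure :: "nat \<Rightarrow> real \<Rightarrow> real" where
  "cap_measure d c = cap_const d *
     (c * sqrt (1 - c\<^sup>2) ^ (d - 1) + real d * integral {c..1} (\<lambda>t. sqrt (1 - t\<^sup>2) ^ (d - 1)))"

section \<open>The measure of a cap from the volume of a solid cone\<close>

lemma null_sphere: "sphere a r \<in> null_sets (lborel :: 'a::euclidean_space measure)"
  using negligible_sphere[of a r] by (simp add: negligible_iff_null_sets null_sets_completion_iff)

text \<open>The two bounds on the radius of a slice agree at height \<open>c\<close>. Below it the
  integral is elementary; above it the integral is kept as it stands, to be differentiated in
  \<open>c\<close> later.\<close>

lemma nn_integral_cone_slices:
  fixes c :: real
  assumes c: "0 < c" "c < 1"
  shows "(\<integral>\<^sup>+y. indicator {0<..<1} y * ennreal (min (y * (sqrt (1 - c\<^sup>2) / c)) (sqrt (1 - y\<^sup>2)) ^ n) \<partial>lborel)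
    = ennreal (c * sqrt (1 - c\<^sup>2) ^ n / (real n + 1) + integral {c..1} (\<lambda>t. sqrt (1 - t\<^sup>2) ^ n))"
proof -
  define k where "k = sqrt (1 - c\<^sup>2) / c"
  have c2: "c\<^sup>2 < 1" using c by (simp add: power_less_one_iff abs_square_less_1)
  then have k: "k \<ge> 0" "k\<^sup>2 = (1 - c\<^sup>2) / c\<^sup>2" using c by (auto simp: k_def power_divide)
  have min1: "min (y * k) (sqrt (1 - y\<^sup>2)) = y * k" if "0 \<le> y" "y \<le> c" for y
  proof -
    have "y\<^sup>2 \<le> c\<^sup>2" using that by (intro power_mono) auto
    then have "(y * k)\<^sup>2 \<le> 1 - y\<^sup>2" using c c2
      by (simp add: power_mult_distrib k(2) divide_simps algebra_simps)
    then show ?thesis by (simp add: min_absorb1 real_le_rsqrt)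
  qed
  have min2: "min (y * k) (sqrt (1 - y\<^sup>2)) = sqrt (1 - y\<^sup>2)" if "c \<le> y" "y \<le> 1" for y
  proof -
    have "c\<^sup>2 \<le> y\<^sup>2" using that c by (intro power_mono) auto
    then have "1 - y\<^sup>2 \<le> (y * k)\<^sup>2" using c c2
      by (simp add: power_mult_distrib k(2) divide_simps algebra_simps)
    then have "sqrt (1 - y\<^sup>2) \<le> y * k" using that c k by (intro real_le_lsqrt) auto
    then show ?thesis by simp
  qed
  have "(\<integral>\<^sup>+y. indicator {0<..<1} y * ennreal (min (y * k) (sqrt (1 - y\<^sup>2)) ^ n) \<partial>lborel)
    = (\<integral>\<^sup>+y. ennreal ((y * k) ^ n) * indicator {0..c} y + ennreal (sqrt (1 - y\<^sup>2) ^ n) * indicator {c..1} y \<partial>lborel)"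
  proof (rule nn_integral_cong_AE)
    have "AE y in lborel. y \<notin> {0, c, 1}"
      by (intro AE_not_in countable_imp_null_set_lborel) auto
    then show "AE y in lborel. indicator {0<..<1} y * ennreal (min (y * k) (sqrt (1 - y\<^sup>2)) ^ n) =
        ennreal ((y * k) ^ n) * indicator {0..c} y + ennreal (sqrt (1 - y\<^sup>2) ^ n) * indicator {c..1} y"
      by eventually_elim (use c min1 min2 in \<open>auto simp: indicator_def not_le\<close>)
  qed
  also have "\<dots> = (\<integral>\<^sup>+y. ennreal ((y * k) ^ n) * indicator {0..c} y \<partial>lborel)
     + (\<integral>\<^sup>+y. ennreal (sqrt (1 - y\<^sup>2) ^ n) * indicator {c..1} y \<partial>lborel)"
    by (rule nn_integral_add) auto
  also have "(\<integral>\<^sup>+y. ennreal ((y * k) ^ n) * indicator {0..c} y \<partial>lborel)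
      = ennreal (k ^ n * c ^ (n + 1) / real (n + 1) - k ^ n * 0 ^ (n + 1) / real (n + 1))"
  proof (intro nn_integral_FTC_Icc)
    fix y :: real
    show "((\<lambda>y. k ^ n * y ^ (n + 1) / real (n + 1)) has_real_derivative (y * k) ^ n) (at y)"
      using DERIV_cdivide[OF DERIV_cmult[OF DERIV_pow[of "n + 1" y], of "k ^ n"], of "real (n + 1)"]
      by (simp add: power_mult_distrib mult_ac)
  qed (use c k in auto)
  also have "k ^ n * c ^ (n + 1) / real (n + 1) - k ^ n * 0 ^ (n + 1) / real (n + 1) = c * sqrt (1 - c\<^sup>2) ^ n / (real n + 1)"
    using c by (simp add: k_def power_divide field_simps)
  also have "(\<integral>\<^sup>+y. ennreal (sqrt (1 - y\<^sup>2) ^ n) * indicator {c..1} y \<partial>lborel)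
      = ennreal (integral {c..1} (\<lambda>t. sqrt (1 - t\<^sup>2) ^ n))"
  proof -
    have "((\<lambda>t. sqrt (1 - t\<^sup>2) ^ n) has_integral integral {c..1} (\<lambda>t. sqrt (1 - t\<^sup>2) ^ n)) {c..1}"
      by (intro integrable_integral integrable_continuous_interval continuous_intros)
    then have "((\<lambda>t. if t \<in> {c..1} then sqrt (1 - t\<^sup>2) ^ n else 0) has_integral integral {c..1} (\<lambda>t. sqrt (1 - t\<^sup>2) ^ n)) UNIV"
      by (subst has_integral_restrict_UNIV)
    then have "(\<integral>\<^sup>+t. ennreal (if t \<in> {c..1} then sqrt (1 - t\<^sup>2) ^ n else 0) \<partial>lborel)
        = ennreal (integral {c..1} (\<lambda>t. sqrt (1 - t\<^sup>2) ^ n))"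
      by (intro nn_integral_has_integral_lborel) (use c in \<open>auto simp: abs_square_le_1\<close>)
    then show ?thesis
      by (subst (asm) nn_integral_cong[where v="\<lambda>y. ennreal (sqrt (1 - y\<^sup>2) ^ n) * indicator {c..1} y"]) auto
  qed
  also have "ennreal (c * sqrt (1 - c\<^sup>2) ^ n / (real n + 1)) + ennreal (integral {c..1} (\<lambda>t. sqrt (1 - t\<^sup>2) ^ n))
      = ennreal (c * sqrt (1 - c\<^sup>2) ^ n / (real n + 1) + integral {c..1} (\<lambda>t. sqrt (1 - t\<^sup>2) ^ n))"
    using c c2 by (intro ennreal_plus[symmetric] integral_nonneg integrable_continuous_interval continuous_intros)
      (auto simp: abs_square_le_1)
  finally show ?thesis by (simp add: k_def)
qed

lemma emeasure_cone_basis: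
  fixes b :: "'a::euclidean_space"
  assumes b: "b \<in> Basis" and c: "0 < c" "c < 1"
  shows "emeasure lborel {x::'a. norm x \<le> 1 \<and> c * norm x \<le> x \<bullet> b} =
    ennreal (unit_ball_vol (real (DIM('a) - 1)) * (c * sqrt (1 - c\<^sup>2) ^ (DIM('a) - 1) / real DIM('a)
      + integral {c..1} (\<lambda>t. sqrt (1 - t\<^sup>2) ^ (DIM('a) - 1))))"
proof -
  interpret product_sigma_finite "\<lambda>_. lborel :: real measure" by standard
  define A where "A = Basis - {b}"
  define n where "n = card A"
  have A: "finite A" "b \<notin> A" "Basis = insert b A" using b by (auto simp: A_def)
  have "DIM('a) = Suc n" unfolding n_def by (subst A(3)) (simp add: A(1,2))
  then have n: "DIM('a) - 1 = n" "real DIM('a) = real n + 1" by simp_all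
  define C where "C = {x::'a. norm x \<le> 1 \<and> c * norm x \<le> x \<bullet> b}"
  define P where "P = Pi\<^sub>M A (\<lambda>_. lborel :: real measure)"
  define q where "q f = sqrt (\<Sum>i\<in>A. (f i)\<^sup>2)" for f :: "'a \<Rightarrow> real"
  define m where "m y = min (y * (sqrt (1 - c\<^sup>2) / c)) (sqrt (1 - y\<^sup>2))" for y
  have c2: "c\<^sup>2 < 1" using c by (simp add: power_less_one_iff abs_square_less_1)
  have iffq: "c\<^sup>2 * (y\<^sup>2 + z) \<le> y\<^sup>2 \<longleftrightarrow> z \<le> (y * (sqrt (1 - c\<^sup>2) / c))\<^sup>2" for y z
  proof -
    have "(y * (sqrt (1 - c\<^sup>2) / c))\<^sup>2 = y\<^sup>2 * (1 - c\<^sup>2) / c\<^sup>2"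
      using c2 by (simp add: power_mult_distrib power_divide)
    moreover have "z \<le> y\<^sup>2 * (1 - c\<^sup>2) / c\<^sup>2 \<longleftrightarrow> z * c\<^sup>2 \<le> y\<^sup>2 * (1 - c\<^sup>2)"
      using c by (intro pos_le_divide_eq) simp
    moreover have "\<dots> \<longleftrightarrow> c\<^sup>2 * (y\<^sup>2 + z) \<le> y\<^sup>2" by (simp add: algebra_simps)
    ultimately show ?thesis by simp
  qed
  have [measurable]: "q \<in> borel_measurable P"
    unfolding q_def P_def by measurable
  have Cm[measurable]: "C \<in> sets borel" unfolding C_def by measurable
  let ?g = "\<lambda>f. \<Sum>i\<in>Basis. f i *\<^sub>R i :: 'a"
  \<comment> \<open>The heights 0 and 1 are excluded because there the cone contains the apex and
    the pole, outside the open interval of heights; both heights are null.\<close>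
  have key: "?g (f(b := y)) \<in> C \<longleftrightarrow> y \<in> {0<..<1} \<and> q f \<le> m y" if "y \<notin> {0, 1}" for f y
  proof -
    have q0: "q f \<ge> 0" by (simp add: q_def sum_nonneg)
    have q2: "(q f)\<^sup>2 = (\<Sum>i\<in>A. (f i)\<^sup>2)" by (simp add: q_def sum_nonneg)
    have nrm: "norm (?g (f(b := y))) = sqrt (y\<^sup>2 + (q f)\<^sup>2)"
    proof -
      have "norm (?g (f(b := y))) = sqrt (\<Sum>i\<in>Basis. ((f(b := y)) i)\<^sup>2)"
        using euclidean_dist_l2[of "?g (f(b := y))" 0] by (simp add: L2_set_def)
      also have "(\<Sum>i\<in>Basis. ((f(b := y)) i)\<^sup>2) = (\<Sum>i\<in>insert b A. ((f(b := y)) i)\<^sup>2)"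
        by (rule sum.cong[OF A(3) refl])
      also have "\<dots> = y\<^sup>2 + (\<Sum>i\<in>A. ((f(b := y)) i)\<^sup>2)"
        by (subst sum.insert[OF A(1,2)]) simp
      also have "(\<Sum>i\<in>A. ((f(b := y)) i)\<^sup>2) = (\<Sum>i\<in>A. (f i)\<^sup>2)"
        by (rule sum.cong) (use A(2) in auto)
      finally show ?thesis by (simp add: q2)
    qed
    have inn: "?g (f(b := y)) \<bullet> b = y" using b by simp
    show ?thesis
    proof
      assume "?g (f(b := y)) \<in> C"
      then have 1: "sqrt (y\<^sup>2 + (q f)\<^sup>2) \<le> 1" and 2: "c * sqrt (y\<^sup>2 + (q f)\<^sup>2) \<le> y"
        unfolding C_def mem_Collect_eq inn nrm by auto
      have "y \<ge> 0" using 2 c by (smt (verit) mult_nonneg_nonneg real_sqrt_ge_zero sum_power2_ge_zero)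
      moreover have le1: "y\<^sup>2 + (q f)\<^sup>2 \<le> 1" using 1 by simp
      then have "y\<^sup>2 \<le> 1" by (smt (verit) zero_le_power2)
      then have "\<bar>y\<bar> \<le> 1" by (simp add: abs_square_le_1)
      ultimately have y: "y \<in> {0<..<1}" using that by auto
      have "(c * sqrt (y\<^sup>2 + (q f)\<^sup>2))\<^sup>2 \<le> y\<^sup>2" using 2 c by (intro power_mono) auto
      then have "c\<^sup>2 * (y\<^sup>2 + (q f)\<^sup>2) \<le> y\<^sup>2" by (simp add: power_mult_distrib)
      then have "(q f)\<^sup>2 \<le> (y * (sqrt (1 - c\<^sup>2) / c))\<^sup>2" by (simp only: iffq)
      moreover have "0 \<le> y * (sqrt (1 - c\<^sup>2) / c)"
        using \<open>y \<ge> 0\<close> c c2 by (intro mult_nonneg_nonneg divide_nonneg_nonneg) auto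
      ultimately have "q f \<le> y * (sqrt (1 - c\<^sup>2) / c)" by (rule power2_le_imp_le)
      moreover have "q f \<le> sqrt (1 - y\<^sup>2)" using le1 by (intro real_le_rsqrt) auto
      ultimately show "y \<in> {0<..<1} \<and> q f \<le> m y" using y by (simp add: m_def)
    next
      assume *: "y \<in> {0<..<1} \<and> q f \<le> m y"
      then have y: "0 < y" "y < 1" by auto
      then have y2: "y\<^sup>2 \<le> 1" by (simp add: abs_square_le_1)
      have "(q f)\<^sup>2 \<le> (sqrt (1 - y\<^sup>2))\<^sup>2" using * q0 by (intro power_mono) (auto simp: m_def)
      then have 1: "y\<^sup>2 + (q f)\<^sup>2 \<le> 1" using y2 by simp
      have "(q f)\<^sup>2 \<le> (y * (sqrt (1 - c\<^sup>2) / c))\<^sup>2" using * q0 by (intro power_mono) (auto simp: m_def)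
      then have "c\<^sup>2 * (y\<^sup>2 + (q f)\<^sup>2) \<le> y\<^sup>2" by (simp only: iffq)
      then have "(c * sqrt (y\<^sup>2 + (q f)\<^sup>2))\<^sup>2 \<le> y\<^sup>2" by (simp add: power_mult_distrib)
      then have "c * sqrt (y\<^sup>2 + (q f)\<^sup>2) \<le> y" by (rule power2_le_imp_le) (use y in simp)
      with 1 show "?g (f(b := y)) \<in> C" unfolding C_def mem_Collect_eq inn nrm by auto
    qed
  qed
  have gm[measurable]: "?g \<in> measurable (Pi\<^sub>M Basis (\<lambda>_. lborel)) borel" by measurable
  have "emeasure lborel C = (\<integral>\<^sup>+x. indicator C x \<partial>distr (Pi\<^sub>M Basis (\<lambda>_. lborel)) borel ?g)"
    by (simp add: lborel_eq[symmetric])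
  also have "\<dots> = (\<integral>\<^sup>+f. indicator C (?g f) \<partial>Pi\<^sub>M Basis (\<lambda>_. lborel))"
    using Cm by (intro nn_integral_distr) auto
  also have "\<dots> = (\<integral>\<^sup>+y. (\<integral>\<^sup>+f. indicator C (?g (f(b := y))) \<partial>P) \<partial>lborel)"
    unfolding P_def using A gm Cm by (subst A(3), subst product_nn_integral_insert_rev) (auto simp: A(3)[symmetric])
  also have "\<dots> = (\<integral>\<^sup>+y. indicator {0<..<1} y * emeasure P {f \<in> space P. q f \<le> m y} \<partial>lborel)"
  proof (rule nn_integral_cong_AE)
    have "AE y in lborel. y \<notin> {0, 1::real}"
      by (intro AE_not_in countable_imp_null_set_lborel) auto
    then show "AE y in lborel. (\<integral>\<^sup>+f. indicator C (?g (f(b := y))) \<partial>P) =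
       indicator {0<..<1} y * emeasure P {f \<in> space P. q f \<le> m y}"
    proof eventually_elim
      case (elim y)
      have "(\<integral>\<^sup>+f. indicator C (?g (f(b := y))) \<partial>P) = (\<integral>\<^sup>+f. indicator {0<..<1} y * indicator {f \<in> space P. q f \<le> m y} f \<partial>P)"
        by (intro nn_integral_cong) (use key[OF elim] in \<open>auto simp: indicator_def\<close>)
      also have "\<dots> = indicator {0<..<1} y * emeasure P {f \<in> space P. q f \<le> m y}"
        by (subst nn_integral_cmult) auto
      finally show ?case .
    qed
  qed
  also have "\<dots> = (\<integral>\<^sup>+y. ennreal (unit_ball_vol (real n)) * (indicator {0<..<1} y * ennreal (m y ^ n)) \<partial>lborel)"
  proof (intro nn_integral_cong)
    fix y :: real
    show "indicator {0<..<1} y * emeasure P {f \<in> space P. q f \<le> m y} =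
       ennreal (unit_ball_vol (real n)) * (indicator {0<..<1} y * ennreal (m y ^ n))"
    proof (cases "y \<in> {0<..<1}")
      case True
      then have "m y > 0" using c c2 by (auto simp: m_def abs_square_less_1)
      then have "emeasure P {f \<in> space P. q f \<le> m y} = ennreal (unit_ball_vol (real n) * m y ^ n)"
        using emeasure_cball_aux[OF A(1), of "m y"] unfolding P_def q_def n_def
        by (simp add: Int_def conj_commute)
      then show ?thesis using True by (simp add: ennreal_mult')
    qed simp
  qed
  also have "\<dots> = ennreal (unit_ball_vol (real n)) * (\<integral>\<^sup>+y. (indicator {0<..<1} y * ennreal (m y ^ n)) \<partial>lborel)"
    unfolding m_def by (rule nn_integral_cmult) measurable
  also have "(\<integral>\<^sup>+y. (indicator {0<..<1} y * ennreal (m y ^ n)) \<partial>lborel) =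
     ennreal (c * sqrt (1 - c\<^sup>2) ^ n / (real n + 1) + integral {c..1} (\<lambda>t. sqrt (1 - t\<^sup>2) ^ n))"
    unfolding m_def by (rule nn_integral_cone_slices[OF c])
  finally show ?thesis unfolding C_def n by (simp add: ennreal_mult')
qed

lemma emeasure_sphere_measure:
  assumes "B \<in> sets borel" "B \<subseteq> sphere 0 1"
  shows "emeasure (sphere_measure :: 'a::euclidean_space measure) B =
    emeasure lborel (ball 0 1 \<inter> sgn -` B) / emeasure lborel (ball 0 1 :: 'a set)"
proof -
  have [measurable]: "(sgn :: 'a \<Rightarrow> 'a) \<in> borel_measurable borel"
    unfolding sgn_div_norm[abs_def] by measurable
  have "emeasure (sphere_measure :: 'a measure) B = emeasure (distr (uniform_measure lborel (ball 0 1)) borel sgn) B"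
    unfolding sphere_measure_def using assms by (subst emeasure_restrict_space) (auto simp: borel_closed)
  also have "\<dots> = emeasure (uniform_measure lborel (ball 0 1)) (sgn -` B)"
    using assms by (subst emeasure_distr) auto
  also have "\<dots> = emeasure lborel (ball 0 1 \<inter> sgn -` B) / emeasure lborel (ball 0 1 :: 'a set)"
    using assms measurable_sets[of sgn borel borel B] by (subst emeasure_uniform_measure) auto
  finally show ?thesis .
qed

text \<open>The preimage of the cap under \<open>sgn\<close> is the solid cone up to the apex and
  the unit sphere, which are null. Rotation invariance then moves the axis to a basis vector, where
  the cone can be sliced.\<close>

lemma emeasure_sphere_measure_cap:
  fixes v :: "'a::euclidean_space"
  assumes v: "norm v = 1" and c: "0 < c" "c < 1"
  shows "emeasure sphere_measure {u \<in> sphere 0 1. c \<le> u \<bullet> v} = ennreal (cap_measure DIM('a) c)"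
proof -
  obtain b :: 'a where b: "b \<in> Basis" using nonempty_Basis by blast
  obtain f where f: "orthogonal_transformation f" "f v = b"
    using orthogonal_transformation_to_basis[OF v, of b] b by auto
  have lin: "linear f" using f(1) by (rule orthogonal_transformation_linear)
  then have [measurable]: "f \<in> borel_measurable borel"
    by (intro borel_measurable_continuous_onI linear_continuous_on linear_conv_bounded_linear[THEN iffD1])
  let ?C = "\<lambda>v. {x::'a. norm x \<le> 1 \<and> c * norm x \<le> x \<bullet> v}"
  have [measurable]: "?C v \<in> sets borel" for v by measurable
  have capm: "{u \<in> sphere 0 1. c \<le> u \<bullet> v} \<in> sets borel" by measurable
  have "emeasure lborel (ball 0 1 \<inter> sgn -` {u \<in> sphere 0 1. c \<le> u \<bullet> v}) = emeasure lborel (?C v)"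
  proof (rule emeasure_eq_AE)
    have "AE x in lborel. x \<notin> sphere (0::'a) 1"
      by (rule AE_not_in[OF null_sphere])
    moreover have "AE x in lborel. x \<noteq> (0::'a)"
      by (rule AE_lborel_singleton)
    ultimately show "AE x in lborel. (x \<in> ball 0 1 \<inter> sgn -` {u \<in> sphere 0 1. c \<le> u \<bullet> v}) = (x \<in> ?C v)"
      by eventually_elim (auto simp: norm_sgn sgn_div_norm field_simps)
    have [measurable]: "(sgn :: 'a \<Rightarrow> 'a) \<in> borel_measurable borel"
      unfolding sgn_div_norm[abs_def] by measurable
    show "ball 0 1 \<inter> sgn -` {u \<in> sphere 0 1. c \<le> u \<bullet> v} \<in> sets lborel"
      using measurable_sets[OF _ capm, of sgn borel] by auto
  qed auto
  also have "?C v = f -` ?C b"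
    using orthogonal_transformation_norm[OF f(1)] f by (auto simp: orthogonal_transformation_def)
  also have "emeasure lborel (f -` ?C b) = emeasure (distr lborel borel f) (?C b)"
    by (subst emeasure_distr) auto
  also have "\<dots> = emeasure lborel (?C b)" by (simp add: lborel_distr_orthogonal_transformation[OF f(1)])
  finally have *: "emeasure lborel (ball 0 1 \<inter> sgn -` {u \<in> sphere 0 1. c \<le> u \<bullet> v}) = emeasure lborel (?C b)" .
  have e1: "emeasure sphere_measure {u \<in> sphere 0 1. c \<le> u \<bullet> v} =
      emeasure lborel (ball 0 1 \<inter> sgn -` {u \<in> sphere 0 1. c \<le> u \<bullet> v}) / emeasure lborel (ball 0 1 :: 'a set)"
    by (rule emeasure_sphere_measure[OF capm]) auto
  have c2: "c\<^sup>2 \<le> 1" using c by (simp add: abs_square_le_1)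
  have J0: "integral {c..1} (\<lambda>t. sqrt (1 - t\<^sup>2) ^ (DIM('a) - 1)) \<ge> 0"
    using c by (intro integral_nonneg integrable_continuous_interval continuous_intros) (auto simp: abs_square_le_1)
  define J where "J = integral {c..1} (\<lambda>t. sqrt (1 - t\<^sup>2) ^ (DIM('a) - 1))"
  define S where "S = c * sqrt (1 - c\<^sup>2) ^ (DIM('a) - 1)"
  define W where "W = unit_ball_vol (real (DIM('a) - 1))"
  define V where "V = unit_ball_vol (real DIM('a))"
  define n where "n = real DIM('a)"
  have pos: "J \<ge> 0" "S \<ge> 0" "W \<ge> 0" "V > 0" "n > 0"
    using J0 c c2 by (auto simp: J_def S_def W_def V_def n_def)
  have "ennreal (W * (S / n + J)) / ennreal V = ennreal (W * (S / n + J) / V)"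
    using pos by (intro divide_ennreal) auto
  also have "W * (S / n + J) / V = W / (n * V) * (S + n * J)"
    using pos by (simp add: field_simps)
  finally show ?thesis
    unfolding e1 * emeasure_cone_basis[OF b c] emeasure_ball[OF zero_le_one] cap_measure_def cap_const_def
      J_def S_def W_def V_def n_def
    by simp
qed

section \<open>The constant \<kappa> in terms of the Gamma function\<close>

lemma cap_const_pos: "d \<ge> 1 \<Longrightarrow> cap_const d > 0"
  by (simp add: cap_const_def)

lemma cap_const_eq:
  assumes "d \<ge> 1"
  shows "cap_const d = Gamma (real d / 2) / (2 * sqrt pi * Gamma ((real d + 1) / 2))"
proof -
  have G: "Gamma (real d / 2 + 1) = real d / 2 * Gamma (real d / 2)"
    using assms by (intro Gamma_plus1) (auto simp: nonpos_Ints_def)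
  define p where "p = pi powr ((real d - 1) / 2)"
  define g where "g = Gamma (real d / 2)"
  define h where "h = Gamma ((real d + 1) / 2)"
  have 1: "pi powr (real d / 2) = p * sqrt pi"
    by (simp add: p_def powr_half_sqrt[symmetric] powr_add[symmetric] field_simps)
  have 2: "(real d - 1) / 2 + 1 = (real d + 1) / 2" by (simp add: field_simps)
  have "g > 0" "h > 0" "p > 0" using assms by (auto simp: g_def h_def p_def)
  then show ?thesis
    using assms unfolding cap_const_def unit_ball_vol_def G 1 of_nat_diff[OF assms] of_nat_1 2
      p_def[symmetric] g_def[symmetric] h_def[symmetric]
    by (simp add: divide_simps)
qed

lemma gamma_star_eq: "d \<ge> 1 \<Longrightarrow> gamma_star d \<gamma> = \<gamma> * cap_const d"
  by (simp add: gamma_star_def cap_const_eq)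

text \<open>The critical intensity is thus the one at which the decay exponent \<gamma>\<kappa> of
  the visibility probability equals d - 1, the growth exponent of hyperbolic spheres.\<close>

lemma gamma_crit_cap_const:
  assumes "d \<ge> 2"
  shows "gamma_crit d * cap_const d = real d - 1"
proof -
  have "Gamma ((real d + 1) / 2) = Gamma ((real d - 1) / 2 + 1)" by (simp add: field_simps)
  also have "\<dots> = (real d - 1) / 2 * Gamma ((real d - 1) / 2)"
    using assms by (intro Gamma_plus1) (auto simp: nonpos_Ints_def)
  finally have G: "Gamma ((real d + 1) / 2) = (real d - 1) / 2 * Gamma ((real d - 1) / 2)" .
  define g where "g = Gamma (real d / 2)"
  define h where "h = Gamma ((real d - 1) / 2)"
  have "g > 0" "h > 0" using assms by (auto simp: g_def h_def)
  moreover have "cap_const d = g / (2 * sqrt pi * ((real d - 1) / 2 * h))"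
    using assms by (simp only: cap_const_eq G g_def h_def)
  moreover have "gamma_crit d = sqrt pi * (real d - 1)\<^sup>2 * h / g"
    by (simp add: gamma_crit_def g_def h_def)
  ultimately have "gamma_crit d * cap_const d
      = (sqrt pi * (real d - 1)\<^sup>2 * h / g) * (g / (2 * sqrt pi * ((real d - 1) / 2 * h)))" by (simp only:)
  then show ?thesis
    using assms \<open>g > 0\<close> \<open>h > 0\<close> by (simp add: power2_eq_square)
qed

section \<open>Derivative and two-sided bounds of the cap measure\<close>

lemma has_real_derivative_sqrt_one_minus_power:
  fixes c :: real
  assumes "0 < c" "c < 1"
  shows "((\<lambda>t. sqrt (1 - t\<^sup>2) ^ n) has_real_derivative - (real n * c * sqrt (1 - c\<^sup>2) ^ n / (1 - c\<^sup>2))) (at c)"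
proof (cases n)
  case (Suc m)
  have c2: "1 - c\<^sup>2 > 0" using assms by (simp add: abs_square_less_1)
  define S where "S = sqrt (1 - c\<^sup>2)"
  have S: "S > 0" "1 - c\<^sup>2 = S * S" using c2 by (simp_all add: S_def)
  have "((\<lambda>t. sqrt (1 - t\<^sup>2)) has_real_derivative - (c / S)) (at c)"
    unfolding S_def using c2 by (auto intro!: derivative_eq_intros simp: field_simps)
  from DERIV_power[OF this, of n]
  have "((\<lambda>t. sqrt (1 - t\<^sup>2) ^ n) has_real_derivative real n * (- (c / S) * S ^ m)) (at c)"
    by (simp add: Suc S_def)
  also have "real n * (- (c / S) * S ^ m) = - (real n * c * S ^ n / (1 - c\<^sup>2))"
    unfolding S(2) Suc using S(1) by (simp add: divide_simps)
  finally show ?thesis by (simp add: S_def)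
qed simp

text \<open>Up to sign this is the density of one coordinate of a uniform point of the sphere, with
  exponent (d - 3)/2 of \<open>1 - c\<^sup>2\<close>. The quotient form keeps natural powers
  although that exponent is negative for d = 2.\<close>

lemma cap_measure_has_derivative:
  assumes "d \<ge> 1" "0 < c" "c < 1"
  shows "(cap_measure d has_real_derivative
    - (real (d - 1) * cap_const d * sqrt (1 - c\<^sup>2) ^ (d - 1) / (1 - c\<^sup>2))) (at c)"
proof -
  define n where "n = d - 1"
  have d: "real d = real n + 1" using assms by (simp add: n_def)
  define S where "S = sqrt (1 - c\<^sup>2)"
  have c2: "1 - c\<^sup>2 > 0" using assms by (simp add: abs_square_less_1)
  have cont: "continuous_on A (\<lambda>t. sqrt (1 - t\<^sup>2) ^ n)" for A :: "real set" by (intro continuous_intros)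
  have "((\<lambda>x. integral {x..1} (\<lambda>t. sqrt (1 - t\<^sup>2) ^ n)) has_real_derivative - (S ^ n)) (at c within {0..1})"
    unfolding S_def using assms by (intro integral_has_real_derivative' cont) auto
  then have I: "((\<lambda>x. integral {x..1} (\<lambda>t. sqrt (1 - t\<^sup>2) ^ n)) has_real_derivative - (S ^ n)) (at c)"
    using at_within_Icc_at[of 0 c 1] assms by simp
  have "((\<lambda>x. cap_const d * (x * sqrt (1 - x\<^sup>2) ^ n + real d * integral {x..1} (\<lambda>t. sqrt (1 - t\<^sup>2) ^ n)))
     has_real_derivative cap_const d * ((1 * S ^ n + - (real n * c * S ^ n / (1 - c\<^sup>2)) * c) + real d * - (S ^ n))) (at c)"
    unfolding S_def
    by (intro DERIV_cmult DERIV_add DERIV_mult DERIV_ident has_real_derivative_sqrt_one_minus_power assms I[unfolded S_def])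
  also have "cap_const d * ((1 * S ^ n + - (real n * c * S ^ n / (1 - c\<^sup>2)) * c) + real d * - (S ^ n))
     = - (real n * cap_const d * S ^ n / (1 - c\<^sup>2))"
  proof -
    define x where "x = S ^ n"
    define y where "y = 1 - c\<^sup>2"
    have "y > 0" "c * c = 1 - y" using c2 by (simp_all add: y_def power2_eq_square)
    have "real n * c * x / y * c = real n * x * (c * c) / y" by simp
    also have "\<dots> = real n * x / y - real n * x"
      unfolding \<open>c * c = 1 - y\<close> using \<open>y > 0\<close> by (simp add: right_diff_distrib diff_divide_distrib)
    finally have "1 * x + - (real n * c * x / y) * c + real d * - x = - (real n * x / y)"
      unfolding d by (simp only: minus_mult_left[symmetric]) (simp add: distrib_right)
    then show ?thesis unfolding x_def[symmetric] y_def[symmetric] by simp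
  qed
  finally show ?thesis unfolding cap_measure_def[abs_def] n_def S_def .
qed

lemma continuous_on_cap_measure: "continuous_on {0..1} (cap_measure d)"
  unfolding cap_measure_def[abs_def]
  by (intro continuous_intros indefinite_integral_continuous_1' integrable_continuous_interval)

lemma cap_measure_1: "d \<ge> 2 \<Longrightarrow> cap_measure d 1 = 0"
  by (simp add: cap_measure_def power_0_left)

text \<open>Both sides vanish at 1, so it is enough to compare derivatives: that of the left side
  carries an extra factor t \<le> 1.\<close>

lemma cap_measure_ge:
  assumes d: "d \<ge> 2" and c: "0 < c" "c \<le> 1"
  shows "cap_const d * sqrt (1 - c\<^sup>2) ^ (d - 1) \<le> cap_measure d c"
proof -
  let ?n = "d - 1"
  have K: "cap_const d > 0" using d by (simp add: cap_const_pos)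
  have "cap_measure d 1 - cap_const d * sqrt (1 - 1\<^sup>2) ^ ?n \<le> cap_measure d c - cap_const d * sqrt (1 - c\<^sup>2) ^ ?n"
  proof (rule DERIV_nonpos_imp_decreasing_open[OF c(2)])
    fix t assume t: "c < t" "t < 1"
    have t2: "1 - t\<^sup>2 > 0" using t c by (simp add: abs_square_less_1)
    have "((\<lambda>t. cap_measure d t - cap_const d * sqrt (1 - t\<^sup>2) ^ ?n) has_real_derivative
       - (real ?n * cap_const d * sqrt (1 - t\<^sup>2) ^ ?n / (1 - t\<^sup>2)) - cap_const d * - (real ?n * t * sqrt (1 - t\<^sup>2) ^ ?n / (1 - t\<^sup>2))) (at t)"
      using t c d by (intro DERIV_diff DERIV_cmult cap_measure_has_derivative has_real_derivative_sqrt_one_minus_power) auto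
    moreover have "- (real ?n * cap_const d * sqrt (1 - t\<^sup>2) ^ ?n / (1 - t\<^sup>2)) - cap_const d * - (real ?n * t * sqrt (1 - t\<^sup>2) ^ ?n / (1 - t\<^sup>2))
        = - ((1 - t) * (real ?n * cap_const d * sqrt (1 - t\<^sup>2) ^ ?n / (1 - t\<^sup>2)))"
      by (simp add: divide_inverse algebra_simps)
    moreover have "\<dots> \<le> 0" using t t2 K by simp
    ultimately show "\<exists>y. ((\<lambda>t. cap_measure d t - cap_const d * sqrt (1 - t\<^sup>2) ^ ?n) has_real_derivative y) (at t) \<and> y \<le> 0"
      by force
  next
    show "continuous_on {c..1} (\<lambda>t. cap_measure d t - cap_const d * sqrt (1 - t\<^sup>2) ^ ?n)"
      using c by (intro continuous_intros continuous_on_subset[OF continuous_on_cap_measure]) auto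
  qed
  then show ?thesis using d by (simp add: cap_measure_1 power_0_left)
qed

text \<open>As in \<open>cap_measure_ge\<close>; after division by \<open>c\<close> the extra factor
  becomes t / c, which is at least 1 between \<open>c\<close> and 1.\<close>

lemma cap_measure_le:
  assumes d: "d \<ge> 2" and c: "0 < c" "c \<le> 1"
  shows "cap_measure d c \<le> cap_const d * sqrt (1 - c\<^sup>2) ^ (d - 1) / c"
proof -
  let ?n = "d - 1"
  have K: "cap_const d > 0" using d by (simp add: cap_const_pos)
  have "cap_const d / c * sqrt (1 - 1\<^sup>2) ^ ?n - cap_measure d 1 \<le> cap_const d / c * sqrt (1 - c\<^sup>2) ^ ?n - cap_measure d c"
  proof (rule DERIV_nonpos_imp_decreasing_open[OF c(2)])
    fix t assume t: "c < t" "t < 1"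
    have t2: "1 - t\<^sup>2 > 0" using t c by (simp add: abs_square_less_1)
    have "((\<lambda>t. cap_const d / c * sqrt (1 - t\<^sup>2) ^ ?n - cap_measure d t) has_real_derivative
       cap_const d / c * - (real ?n * t * sqrt (1 - t\<^sup>2) ^ ?n / (1 - t\<^sup>2)) - - (real ?n * cap_const d * sqrt (1 - t\<^sup>2) ^ ?n / (1 - t\<^sup>2))) (at t)"
      using t c d by (intro DERIV_diff DERIV_cmult cap_measure_has_derivative has_real_derivative_sqrt_one_minus_power) auto
    moreover have "cap_const d / c * - (real ?n * t * sqrt (1 - t\<^sup>2) ^ ?n / (1 - t\<^sup>2)) - - (real ?n * cap_const d * sqrt (1 - t\<^sup>2) ^ ?n / (1 - t\<^sup>2))
        = - ((t / c - 1) * (real ?n * cap_const d * sqrt (1 - t\<^sup>2) ^ ?n / (1 - t\<^sup>2)))"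
      by (simp add: divide_inverse algebra_simps)
    moreover have "\<dots> \<le> 0" using t t2 K c by simp
    ultimately show "\<exists>y. ((\<lambda>t. cap_const d / c * sqrt (1 - t\<^sup>2) ^ ?n - cap_measure d t) has_real_derivative y) (at t) \<and> y \<le> 0"
      by force
  next
    show "continuous_on {c..1} (\<lambda>t. cap_const d / c * sqrt (1 - t\<^sup>2) ^ ?n - cap_measure d t)"
      using c by (intro continuous_intros continuous_on_subset[OF continuous_on_cap_measure]) auto
  qed
  then show ?thesis using d by (simp add: cap_measure_1 power_0_left)
qed

text \<open>Finiteness gives access to Fubini's theorem; the later estimates carry the total mass
  along as a constant \<open>m\<close>.\<close>

lemma finite_measure_sphere_measure: "finite_measure (sphere_measure :: 'a::euclidean_space measure)"
proof
  have "emeasure (sphere_measure :: 'a measure) (space sphere_measure)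
      = emeasure lborel (ball 0 1 \<inter> sgn -` sphere (0::'a) 1) / emeasure lborel (ball 0 1 :: 'a set)"
    by (subst emeasure_sphere_measure) (auto simp: sphere_measure_def space_restrict_space)
  also have "\<dots> \<le> emeasure lborel (ball 0 1 :: 'a set) / emeasure lborel (ball 0 1 :: 'a set)"
    by (intro divide_right_mono_ennreal emeasure_mono) auto
  also have "\<dots> < \<infinity>"
    by (simp add: emeasure_ball divide_ennreal)
  finally show "emeasure (sphere_measure :: 'a measure) (space sphere_measure) \<noteq> \<infinity>" by simp
qed

lemma sets_sphere_measure: "sets (sphere_measure :: 'a::euclidean_space measure) = sets (restrict_space borel (sphere 0 1))"
  unfolding sphere_measure_def by (rule sets_restrict_space_cong) simp

lemma space_sphere_measure: "space (sphere_measure :: 'a::euclidean_space measure) = sphere 0 1"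
  by (simp add: sphere_measure_def space_restrict_space)

section \<open>Geometry of the hyperplanes\<close>

definition amp :: "real \<Rightarrow> real \<Rightarrow> real" where
  "amp lam s = cosh s + lam * sinh s"

definition amp_deriv :: "real \<Rightarrow> real \<Rightarrow> real" where
  "amp_deriv lam s = sinh s + lam * cosh s"

text \<open>The Minkowski norm of the normal vector: spacelike for \<open>lam < 1\<close>, lightlike
  for horospheres.\<close>

lemma amp_sq: "(amp lam s)\<^sup>2 = (amp_deriv lam s)\<^sup>2 + 1 - lam\<^sup>2"
proof -
  have "(amp lam s)\<^sup>2 - (amp_deriv lam s)\<^sup>2 = ((cosh s)\<^sup>2 - (sinh s)\<^sup>2) * (1 - lam\<^sup>2)"
    unfolding amp_def amp_deriv_def by (simp add: power2_eq_square algebra_simps)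
  then show ?thesis by (simp add: cosh_square_eq)
qed

lemma amp_has_derivative: "(amp_deriv lam has_real_derivative amp lam s) (at s)"
  unfolding amp_deriv_def[abs_def] amp_def by (auto intro!: derivative_eq_intros)

lemma continuous_on_amp_deriv: "continuous_on A (amp_deriv lam)"
  unfolding amp_deriv_def[abs_def] by (intro continuous_intros)

lemma amp_bounds:
  assumes "0 \<le> lam" "lam \<le> 1" "0 \<le> s"
  shows "1 \<le> amp lam s" "amp lam s \<le> exp s" "exp s / 2 \<le> amp lam s" "amp_deriv lam s \<le> exp s"
    "lam \<le> amp_deriv lam s"
proof -
  have e: "exp s = cosh s + sinh s" by (simp add: cosh_plus_sinh)
  have s: "sinh s \<ge> 0" "cosh s \<ge> 1" using assms by (simp_all add: cosh_real_ge_1)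
  have "lam * sinh s \<le> sinh s" "lam * cosh s \<le> cosh s"
    using assms s by (auto intro!: mult_left_le_one_le)
  moreover have "lam * sinh s \<ge> 0" "lam \<le> lam * cosh s" using assms s by (auto simp: mult_le_cancel_left1)
  moreover have "sinh s \<le> cosh s" using sinh_le_cosh_real by auto
  ultimately show "1 \<le> amp lam s" "amp lam s \<le> exp s" "exp s / 2 \<le> amp lam s" "amp_deriv lam s \<le> exp s"
    "lam \<le> amp_deriv lam s"
    unfolding amp_def amp_deriv_def e using s by (auto simp: field_simps)
qed

lemma amp_deriv_strict_mono:
  assumes "0 \<le> lam" "0 \<le> s" "s < t"
  shows "amp_deriv lam s < amp_deriv lam t"
proof -
  have "lam * cosh s \<le> lam * cosh t" using assms by (intro mult_left_mono) (auto simp: cosh_real_nonneg_le_iff)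
  then show ?thesis using assms by (simp add: amp_deriv_def add_less_le_mono)
qed

lemma amp_deriv_gt:
  assumes "0 \<le> lam" "0 < s"
  shows "lam < amp_deriv lam s"
  using amp_deriv_strict_mono[OF assms(1), of 0 s] assms by (simp add: amp_deriv_def)

text \<open>With G the cosine of the angle at which the hyperplane cuts the sphere of radius
  \<open>t\<close> about the origin, division by \<open>(amp lam s * sinh t)\<^sup>2\<close> gives
  \<open>1 - G\<^sup>2\<close> as the last bracket over that square. The bracket is at most
  \<open>(sinh t)\<^sup>2\<close>, with equality when \<open>amp_deriv lam s = lam * cosh t\<close>:
  there the shadow is widest, with sine \<open>1 / amp lam s\<close>.\<close>

lemma amp_identity:
  "(amp_deriv lam s * cosh t - lam)\<^sup>2 = (amp lam s)\<^sup>2 * (sinh t)\<^sup>2 - ((sinh t)\<^sup>2 - (amp_deriv lam s - lam * cosh t)\<^sup>2)"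
proof -
  have c: "cosh t * cosh t = 1 + sinh t * sinh t" using cosh_square_eq[of t] by (simp add: power2_eq_square)
  have "(a * cosh t - lam)\<^sup>2 = (a\<^sup>2 + 1 - lam\<^sup>2) * (sinh t)\<^sup>2 - ((sinh t)\<^sup>2 - (a - lam * cosh t)\<^sup>2)" for a
    using c by (simp add: power2_eq_square algebra_simps)
  then show ?thesis unfolding amp_sq .
qed

text \<open>At distance \<open>t\<close> the ray in direction \<open>v\<close> is on the hyperplane if equality holds below, and on its convex side if
  the inequality is strict.\<close>

definition ray_hits :: "real \<Rightarrow> real \<Rightarrow> 'a::euclidean_space \<Rightarrow> (real \<times> 'a) set" where
  "ray_hits lam \<tau> v = {(s, u). 0 < s \<and> norm u = 1 \<and>
     (\<exists>t. 0 < t \<and> t \<le> \<tau> \<and> amp_deriv lam s * cosh t - (u \<bullet> v) * amp lam s * sinh t \<le> lam)}"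

section \<open>From the ball model to the equation in polar coordinates\<close>

lemma tanh_half:
  fixes t :: real
  shows "cosh t * (1 - (tanh (t/2))\<^sup>2) = 1 + (tanh (t/2))\<^sup>2" "sinh t * (1 - (tanh (t/2))\<^sup>2) = 2 * tanh (t/2)"
proof -
  have c: "cosh (t/2) > 0" by simp
  have 1: "cosh t = (cosh (t/2))\<^sup>2 + (sinh (t/2))\<^sup>2" "sinh t = 2 * sinh (t/2) * cosh (t/2)"
    using cosh_double[of "t/2"] sinh_double[of "t/2"] by simp_all
  have 2: "1 - (tanh (t/2))\<^sup>2 = 1 / (cosh (t/2))\<^sup>2"
  proof -
    have "1 - (tanh (t/2))\<^sup>2 = ((cosh (t/2))\<^sup>2 - (sinh (t/2))\<^sup>2) / (cosh (t/2))\<^sup>2"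
      using c by (simp add: tanh_def power_divide diff_divide_distrib)
    then show ?thesis by (simp add: cosh_square_eq)
  qed
  show "cosh t * (1 - (tanh (t/2))\<^sup>2) = 1 + (tanh (t/2))\<^sup>2" "sinh t * (1 - (tanh (t/2))\<^sup>2) = 2 * tanh (t/2)"
    unfolding 1 2 using c by (simp_all add: tanh_def power2_eq_square field_simps)
qed

text \<open>Multiplying the equation of the sphere by \<open>2 * (lam + r)\<close> removes the
  radius \<open>R\<close> and all divisions. The result is continuous in \<open>x\<close>,
  \<open>u\<close> and all real \<open>s\<close>, which \<open>sets_hyp_meets\<close> relies
  on.\<close>

lemma lambda_hyperplane_iff:
  fixes u x :: "'a::euclidean_space"
  assumes u: "norm u = 1" and lam: "0 \<le> lam" and s: "0 < s"
  defines "r \<equiv> tanh (s/2)"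
  shows "x \<in> lambda_hyperplane lam s u \<longleftrightarrow> x \<in> ball 0 1 \<and>
    (2 * r + lam * (1 + r\<^sup>2)) * (1 + (norm x)\<^sup>2) - (u \<bullet> x) * ((1 + r\<^sup>2) + lam * (2 * r)) * 2
      - lam * (1 - r\<^sup>2) * (1 - (norm x)\<^sup>2) = 0"
proof -
  define R where "R = (1 - r\<^sup>2) / (2 * (lam + r))"
  define c where "c = u \<bullet> x"
  define q where "q = (norm x)\<^sup>2"
  have r: "0 < r" "r < 1" using s by (simp_all add: r_def tanh_real_lt_1)
  have r2: "r\<^sup>2 < 1" using r by (simp_all add: abs_square_less_1)
  define p where "p = lam + r"
  have p: "p > 0" using r lam by (simp add: p_def)
  have R: "R \<ge> 0" "2 * (R * (lam + r)) = 1 - r\<^sup>2"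
    unfolding R_def p_def[symmetric] using p r2 by simp_all
  have uu: "u \<bullet> u = 1" using u by (simp add: norm_eq_1)
  have "x \<in> lambda_hyperplane lam s u \<longleftrightarrow> x \<in> ball 0 1 \<and> norm (x - (r + R) *\<^sub>R u) = R"
    by (simp add: lambda_hyperplane_def Let_def r_def R_def)
  also have "norm (x - (r + R) *\<^sub>R u) = R \<longleftrightarrow> (norm (x - (r + R) *\<^sub>R u))\<^sup>2 = R\<^sup>2"
    using R(1) by (simp add: power2_eq_iff_nonneg)
  also have "(norm (x - (r + R) *\<^sub>R u))\<^sup>2 = q - 2 * (r + R) * c + (r + R)\<^sup>2"
    unfolding power2_norm_eq_inner q_def
    by (simp add: inner_diff uu c_def inner_commute power2_eq_square algebra_simps)
  also have "\<dots> = R\<^sup>2 \<longleftrightarrow> 2 * (lam + r) * (q - 2 * (r + R) * c + (r + R)\<^sup>2 - R\<^sup>2) = 0"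
    using r lam by simp
  also have "2 * (lam + r) * (q - 2 * (r + R) * c + (r + R)\<^sup>2 - R\<^sup>2)
      = 2 * (lam + r) * q - 2 * c * (2 * r * (lam + r) + 2 * (R * (lam + r))) + 2 * (lam + r) * r\<^sup>2 + 2 * r * (2 * (R * (lam + r)))"
    by (simp add: power2_eq_square algebra_simps)
  also have "\<dots> = (2 * r + lam * (1 + r\<^sup>2)) * (1 + q) - c * ((1 + r\<^sup>2) + lam * (2 * r)) * 2 - lam * (1 - r\<^sup>2) * (1 - q)"
    unfolding R(2) by (simp add: power2_eq_square algebra_simps)
  finally show ?thesis by (simp add: c_def q_def)
qed

text \<open>The half-angle formulas exhibit the polynomial of \<open>lambda_hyperplane_iff\<close>
  as the difference of the two sides times \<open>(1 - r\<^sup>2) * (1 - q\<^sup>2)\<close>, which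
  is positive.\<close>

lemma hyperplane_equation:
  fixes u v :: "'a::euclidean_space"
  assumes uv: "norm u = 1" "norm v = 1" and lam: "0 \<le> lam" and s: "0 < s" and t: "0 \<le> t"
  shows "tanh (t/2) *\<^sub>R v \<in> lambda_hyperplane lam s u \<longleftrightarrow>
    amp_deriv lam s * cosh t - (u \<bullet> v) * amp lam s * sinh t = lam"
proof -
  define r where "r = tanh (s/2)"
  define q where "q = tanh (t/2)"
  define c where "c = u \<bullet> v"
  have r: "0 < r" "r < 1" using s by (simp_all add: r_def tanh_real_lt_1)
  have q: "0 \<le> q" "q < 1" using t by (simp_all add: q_def tanh_real_lt_1)
  have r2: "r\<^sup>2 < 1" and q2: "q\<^sup>2 < 1" using r q by (simp_all add: abs_square_less_1)
  have nq: "norm (q *\<^sub>R v) = q" "u \<bullet> (q *\<^sub>R v) = q * c" "q *\<^sub>R v \<in> ball 0 1"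
    using q uv by (simp_all add: c_def)
  have "tanh (t/2) *\<^sub>R v \<in> lambda_hyperplane lam s u \<longleftrightarrow>
      (2 * r + lam * (1 + r\<^sup>2)) * (1 + q\<^sup>2) - (q * c) * ((1 + r\<^sup>2) + lam * (2 * r)) * 2 - lam * (1 - r\<^sup>2) * (1 - q\<^sup>2) = 0"
    unfolding q_def[symmetric] lambda_hyperplane_iff[OF uv(1) lam s] nq r_def[symmetric] using nq(3) by simp
  also have "(2 * r + lam * (1 + r\<^sup>2)) * (1 + q\<^sup>2) - (q * c) * ((1 + r\<^sup>2) + lam * (2 * r)) * 2 - lam * (1 - r\<^sup>2) * (1 - q\<^sup>2)
      = (2 * r + lam * (1 + r\<^sup>2)) * (1 + q\<^sup>2) - c * ((1 + r\<^sup>2) + lam * (2 * r)) * (2 * q) - lam * (1 - r\<^sup>2) * (1 - q\<^sup>2)"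
    by simp
  also have "\<dots> = (1 - r\<^sup>2) * (1 - q\<^sup>2) * (amp_deriv lam s * cosh t - c * amp lam s * sinh t - lam)"
    unfolding amp_def amp_deriv_def tanh_half[of s, folded r_def, symmetric] tanh_half[of t, folded q_def, symmetric]
    by (simp add: algebra_simps)
  also have "\<dots> = 0 \<longleftrightarrow> amp_deriv lam s * cosh t - c * amp lam s * sinh t = lam"
    using r2 q2 by simp
  finally show ?thesis by (simp add: c_def)
qed

text \<open>At distance 0 the left side of the inequality in \<open>ray_hits\<close> is
  \<open>amp_deriv lam s\<close>, which exceeds \<open>lam\<close>. By the intermediate value
  theorem it drops to \<open>lam\<close> or below only if it takes the value \<open>lam\<close>,
  that is, if the segment meets the hyperplane.\<close>

lemma ray_hits_iff:
  fixes u v :: "'a::euclidean_space"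
  assumes uv: "norm u = 1" "norm v = 1" and lam: "0 \<le> lam" and s: "0 < s" and tau: "0 \<le> \<tau>"
  shows "(s, u) \<in> ray_hits lam \<tau> v \<longleftrightarrow> closed_segment 0 (tanh (\<tau>/2) *\<^sub>R v) \<inter> lambda_hyperplane lam s u \<noteq> {}"
proof
  define f where "f t = amp_deriv lam s * cosh t - (u \<bullet> v) * amp lam s * sinh t" for t
  assume "(s, u) \<in> ray_hits lam \<tau> v"
  then obtain t where t: "0 < t" "t \<le> \<tau>" "f t \<le> lam" by (auto simp: ray_hits_def f_def)
  have "\<exists>x\<ge>0. x \<le> t \<and> f x = lam"
    using t amp_deriv_gt[OF lam s] by (intro IVT2') (auto simp: f_def intro!: continuous_intros)
  then obtain x where x: "0 \<le> x" "x \<le> t" "f x = lam" by blast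
  have "tanh (x/2) *\<^sub>R v \<in> closed_segment 0 (tanh (\<tau>/2) *\<^sub>R v)"
  proof (cases "\<tau> = 0")
    case False
    then have "tanh (\<tau>/2) > 0" using tau by simp
    moreover have "tanh (x/2) \<le> tanh (\<tau>/2)" "0 \<le> tanh (x/2)" using x t by auto
    ultimately show ?thesis
      unfolding closed_segment_def by (intro CollectI exI[of _ "tanh (x/2) / tanh (\<tau>/2)"]) auto
  qed (use t in auto)
  moreover have "tanh (x/2) *\<^sub>R v \<in> lambda_hyperplane lam s u"
    using x by (subst hyperplane_equation[OF uv lam s]) (auto simp: f_def)
  ultimately show "closed_segment 0 (tanh (\<tau>/2) *\<^sub>R v) \<inter> lambda_hyperplane lam s u \<noteq> {}" by blast
next
  assume "closed_segment 0 (tanh (\<tau>/2) *\<^sub>R v) \<inter> lambda_hyperplane lam s u \<noteq> {}"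
  then obtain a where a: "0 \<le> a" "a \<le> 1" "(a * tanh (\<tau>/2)) *\<^sub>R v \<in> lambda_hyperplane lam s u"
    by (auto simp: closed_segment_def)
  have "\<exists>x\<ge>0. x \<le> \<tau> \<and> tanh (x/2) = a * tanh (\<tau>/2)"
    using a tau by (intro IVT') (auto intro!: continuous_intros mult_left_le_one_le)
  then obtain x where x: "0 \<le> x" "x \<le> \<tau>" "tanh (x/2) = a * tanh (\<tau>/2)" by blast
  have *: "amp_deriv lam s * cosh x - (u \<bullet> v) * amp lam s * sinh x = lam"
    using a x by (subst hyperplane_equation[OF uv lam s x(1), symmetric]) simp
  have "x \<noteq> 0" using * amp_deriv_gt[OF lam s] by auto
  then show "(s, u) \<in> ray_hits lam \<tau> v"
    using * x s uv by (auto simp: ray_hits_def intro!: exI[of _ x])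
qed

text \<open>The last bound is \<open>amp_identity\<close> without the square
  \<open>(amp_deriv lam s - lam * cosh t)\<^sup>2\<close>: no shadow is wider than sine
  \<open>1 / amp lam s\<close>.\<close>

lemma ray_hits_bounds:
  assumes lam: "0 \<le> lam" "lam \<le> 1" and v: "norm v = 1" and hit: "(s, u) \<in> ray_hits lam \<tau> v"
  shows "0 < s" "s \<le> \<tau>" "norm u = 1" "0 < u \<bullet> v" "(1 - (u \<bullet> v)\<^sup>2) * (amp lam s)\<^sup>2 \<le> 1"
proof -
  obtain t where t: "0 < t" "t \<le> \<tau>" "amp_deriv lam s * cosh t - (u \<bullet> v) * amp lam s * sinh t \<le> lam"
    and s: "0 < s" and u: "norm u = 1"
    using hit by (auto simp: ray_hits_def)
  define c where "c = u \<bullet> v"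
  have c1: "c \<le> 1" using norm_cauchy_schwarz[of u v] u v by (simp add: c_def)
  have sh: "sinh t > 0" "cosh t \<ge> 1" using t by (simp_all add: cosh_real_ge_1)
  have A: "amp lam s > 0" using amp_bounds(1)[OF lam, of s] s by simp
  have "amp_deriv lam s \<le> amp_deriv lam s * cosh t"
    using sh amp_deriv_gt[OF lam(1) s] lam by (simp add: mult_le_cancel_left1)
  then have pos: "amp_deriv lam s * cosh t - lam > 0" using amp_deriv_gt[OF lam(1) s] by simp
  have le: "amp_deriv lam s * cosh t - lam \<le> c * (amp lam s * sinh t)" using t by (simp add: c_def mult.assoc)
  then have "0 < c * (amp lam s * sinh t)" using pos by simp
  then have c0: "c > 0" using A sh zero_less_mult_pos2[of c "amp lam s * sinh t"] by simp
  have "(amp_deriv lam s * cosh t - lam)\<^sup>2 \<le> (c * (amp lam s * sinh t))\<^sup>2"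
    using le pos by (intro power_mono) auto
  then have "(amp lam s)\<^sup>2 * (sinh t)\<^sup>2 - (sinh t)\<^sup>2 \<le> c\<^sup>2 * (amp lam s)\<^sup>2 * (sinh t)\<^sup>2"
    unfolding amp_identity power_mult_distrib
    by (smt (verit) mult.assoc zero_le_power2)
  then have "((1 - c\<^sup>2) * (amp lam s)\<^sup>2) * (sinh t)\<^sup>2 \<le> 1 * (sinh t)\<^sup>2"
    by (simp add: algebra_simps)
  then have "(1 - c\<^sup>2) * (amp lam s)\<^sup>2 \<le> 1" using sh by (simp add: mult_le_cancel_right)
  \<comment> \<open>Even with cosine 1 the inequality reads
    \<open>sinh (s - t) + lam * cosh (s - t) \<le> lam\<close>, which fails for t < s.\<close>
  moreover have "s \<le> t"
  proof (rule ccontr)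
    assume "\<not> s \<le> t"
    then have st: "s - t > 0" by simp
    have "c * (amp lam s * sinh t) \<le> 1 * (amp lam s * sinh t)" using c1 A sh by (intro mult_right_mono) auto
    then have "amp_deriv lam s * cosh t - amp lam s * sinh t \<le> lam" using le by simp
    also have "amp_deriv lam s * cosh t - amp lam s * sinh t = sinh (s - t) + lam * cosh (s - t)"
      by (simp add: amp_def amp_deriv_def sinh_diff cosh_diff algebra_simps)
    also have "\<dots> > lam" using amp_deriv_gt[OF lam(1) st] by (simp add: amp_deriv_def)
    finally show False by simp
  qed
  ultimately show "0 < s" "s \<le> \<tau>" "norm u = 1" "0 < u \<bullet> v" "(1 - (u \<bullet> v)\<^sup>2) * (amp lam s)\<^sup>2 \<le> 1"
    using s u t c0 by (auto simp: c_def)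
qed

text \<open>A partial converse of \<open>ray_hits_bounds\<close>. Either the shadow is widest at
  some distance before \<tau>, and that distance serves as \<open>t\<close>; or
  \<open>t = \<tau>\<close> works, where the shadow falls short of its full width by a square of at
  most \<open>(exp s)\<^sup>2\<close>, and the term \<open>(exp s / sinh \<tau>)\<^sup>2\<close>
  pays for it.\<close>

lemma ray_hitsI:
  assumes lam: "0 \<le> lam" "lam \<le> 1" and s: "0 < s" and u: "norm u = 1" and tau: "0 < \<tau>"
    and c: "0 < u \<bullet> v"
    and le: "(1 - (u \<bullet> v)\<^sup>2) * (amp lam s)\<^sup>2 \<le> 1 - (exp s / sinh \<tau>)\<^sup>2"
  shows "(s, u) \<in> ray_hits lam \<tau> v"
proof -
  define c where "c = u \<bullet> v"
  define b where "b = exp s / sinh \<tau>"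
  have A: "amp lam s > 0" using amp_bounds(1)[OF lam, of s] s by simp
  have suff: "(s, u) \<in> ray_hits lam \<tau> v" if t: "0 < t" "t \<le> \<tau>"
    and w: "(1 - c\<^sup>2) * (amp lam s)\<^sup>2 * (sinh t)\<^sup>2 \<le> (sinh t)\<^sup>2 - (amp_deriv lam s - lam * cosh t)\<^sup>2" for t
  proof -
    have "(amp_deriv lam s * cosh t - lam)\<^sup>2 \<le> (c * (amp lam s * sinh t))\<^sup>2"
    proof -
      have "(c * (amp lam s * sinh t))\<^sup>2 = (amp lam s)\<^sup>2 * (sinh t)\<^sup>2 - (1 - c\<^sup>2) * (amp lam s)\<^sup>2 * (sinh t)\<^sup>2"
        by (simp add: power_mult_distrib left_diff_distrib)
      then show ?thesis unfolding amp_identity using w by linarith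
    qed
    then have "amp_deriv lam s * cosh t - lam \<le> c * (amp lam s * sinh t)"
      by (rule power2_le_imp_le) (use A t c in \<open>simp add: c_def\<close>)
    then show ?thesis using t s u unfolding ray_hits_def c_def
      by (auto intro!: exI[of _ t] simp: mult.assoc)
  qed
  show ?thesis
  proof (cases "lam * cosh \<tau> \<le> amp_deriv lam s")
    case True
    have "sinh \<tau> > 0" using tau by simp
    have "amp_deriv lam s - lam * cosh \<tau> \<le> exp s"
      using amp_bounds(4)[OF lam, of s] s lam by (smt (verit) cosh_real_nonneg mult_nonneg_nonneg)
    then have "(amp_deriv lam s - lam * cosh \<tau>)\<^sup>2 \<le> (exp s)\<^sup>2" using True by (intro power_mono) auto
    also have "(exp s)\<^sup>2 = b\<^sup>2 * (sinh \<tau>)\<^sup>2"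
      using \<open>sinh \<tau> > 0\<close> by (simp add: b_def power_divide)
    finally have 1: "(amp_deriv lam s - lam * cosh \<tau>)\<^sup>2 \<le> b\<^sup>2 * (sinh \<tau>)\<^sup>2" .
    have "(1 - c\<^sup>2) * (amp lam s)\<^sup>2 * (sinh \<tau>)\<^sup>2 \<le> (1 - b\<^sup>2) * (sinh \<tau>)\<^sup>2"
      using le by (intro mult_right_mono) (auto simp: b_def c_def)
    with 1 show ?thesis using tau by (intro suff[of \<tau>]) (auto simp: algebra_simps)
  next
    case False
    have "\<exists>t\<ge>0. t \<le> \<tau> \<and> lam * cosh t = amp_deriv lam s"
      using False amp_deriv_gt[OF lam(1) s] tau by (intro IVT') (auto intro!: continuous_intros)
    then obtain t where t: "0 \<le> t" "t \<le> \<tau>" "lam * cosh t = amp_deriv lam s" by blast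
    have "t \<noteq> 0" using t amp_deriv_gt[OF lam(1) s] by auto
    moreover have "(1 - c\<^sup>2) * (amp lam s)\<^sup>2 \<le> 1"
      using le zero_le_power2[of "exp s / sinh \<tau>"] unfolding c_def by linarith
    then have "(1 - c\<^sup>2) * (amp lam s)\<^sup>2 * (sinh t)\<^sup>2 \<le> 1 * (sinh t)\<^sup>2" by (intro mult_right_mono) auto
    ultimately show ?thesis using t by (intro suff[of t]) auto
  qed
qed

text \<open>The ball of radius \<open>tanh (s/2)\<close> about the origin touches the sphere
  carrying the hyperplane from outside, in a single point. This point determines \<open>s\<close>
  and \<open>u\<close>, whence injectivity of the parametrisation.\<close>

lemma lambda_hyperplane_nearest_point:
  fixes u :: "'a::euclidean_space"
  assumes u: "norm u = 1" and lam: "0 \<le> lam" and s: "0 < s"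
  shows "tanh (s/2) *\<^sub>R u \<in> lambda_hyperplane lam s u"
    and "x \<in> lambda_hyperplane lam s u \<Longrightarrow> tanh (s/2) \<le> norm x"
    and "x \<in> lambda_hyperplane lam s u \<Longrightarrow> norm x = tanh (s/2) \<Longrightarrow> x = tanh (s/2) *\<^sub>R u"
proof -
  define r where "r = tanh (s/2)"
  define R where "R = (1 - r\<^sup>2) / (2 * (lam + r))"
  have r: "0 < r" "r < 1" using s by (simp_all add: r_def tanh_real_lt_1)
  have r2: "r\<^sup>2 < 1" using r by (simp_all add: abs_square_less_1)
  have R: "R \<ge> 0" using r r2 lam by (simp add: R_def)
  have H: "lambda_hyperplane lam s u = {x \<in> ball 0 1. norm (x - (r + R) *\<^sub>R u) = R}"
    by (simp add: lambda_hyperplane_def Let_def r_def R_def)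
  have uu: "u \<bullet> u = 1" using u by (simp add: norm_eq_1)
  have "r *\<^sub>R u - (r + R) *\<^sub>R u = (- R) *\<^sub>R u" by (simp add: algebra_simps)
  then show "tanh (s/2) *\<^sub>R u \<in> lambda_hyperplane lam s u"
    unfolding H r_def[symmetric] using R r u by simp
  show ge: "tanh (s/2) \<le> norm x" if "x \<in> lambda_hyperplane lam s u" for x
  proof -
    have "norm ((r + R) *\<^sub>R u) \<le> norm x + norm (x - (r + R) *\<^sub>R u)"
      by (metis norm_minus_commute norm_triangle_sub)
    then show ?thesis using that R r u unfolding H by (simp add: r_def)
  qed
  show "x = tanh (s/2) *\<^sub>R u" if x: "x \<in> lambda_hyperplane lam s u" "norm x = tanh (s/2)" for x
  proof -
    have xx: "x \<bullet> x = r\<^sup>2" using x(2) by (simp add: power2_norm_eq_inner[symmetric] r_def)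
    have "(norm (x - (r + R) *\<^sub>R u))\<^sup>2 = R\<^sup>2" using x(1) unfolding H by simp
    then have "r\<^sup>2 - 2 * (r + R) * (x \<bullet> u) + (r + R)\<^sup>2 = R\<^sup>2"
      unfolding power2_norm_eq_inner by (simp add: inner_diff uu xx inner_commute power2_eq_square algebra_simps)
    then have "2 * (r + R) * (x \<bullet> u - r) = 0" by (simp add: power2_eq_square algebra_simps)
    then have "x \<bullet> u = r" using r R by simp
    then have "(x - r *\<^sub>R u) \<bullet> (x - r *\<^sub>R u) = 0"
      by (simp add: inner_diff uu xx inner_commute power2_eq_square algebra_simps)
    then show ?thesis by (simp add: r_def)
  qed
qed

lemma inj_on_lambda_hyperplane:
  assumes lam: "0 \<le> lam"
  shows "inj_on (\<lambda>(s, u::'a::euclidean_space). lambda_hyperplane lam s u) ({0<..} \<times> sphere 0 1)"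
proof (rule inj_onI, clarsimp)
  fix s s' :: real and u u' :: 'a
  assume *: "0 < s" "norm u = 1" "0 < s'" "norm u' = 1"
    and eq: "lambda_hyperplane lam s u = lambda_hyperplane lam s' u'"
  note n = lambda_hyperplane_nearest_point[OF *(2) lam *(1)]
  note n' = lambda_hyperplane_nearest_point[OF *(4) lam *(3)]
  have nn: "norm (tanh (s/2) *\<^sub>R u) = tanh (s/2)" "norm (tanh (s'/2) *\<^sub>R u') = tanh (s'/2)" using * by auto
  have "tanh (s/2) = tanh (s'/2)"
    using n(2)[of "tanh (s'/2) *\<^sub>R u'"] n'(2)[of "tanh (s/2) *\<^sub>R u"] n(1) n'(1) eq nn by auto
  moreover from this have "tanh (s/2) *\<^sub>R u = tanh (s'/2) *\<^sub>R u'"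
    using n'(3)[of "tanh (s/2) *\<^sub>R u"] n(1) eq nn by auto
  moreover have "tanh (s/2) > 0" using * by simp
  ultimately show "s = s' \<and> u = u'" by simp
qed

section \<open>The hyperplanes hit by a ray\<close>

text \<open>The intensity on parameters instead of sets of points. All measures are computed here
  and transferred by \<open>inj_on_lambda_hyperplane\<close>.\<close>

definition hyp_par :: "real \<Rightarrow> (real \<times> 'a::euclidean_space) measure" where
  "hyp_par lam = density (restrict_space lborel {0<..} \<Otimes>\<^sub>M (sphere_measure :: 'a measure))
     (\<lambda>(s, u). ennreal ((cosh s + lam * sinh s) ^ (DIM('a) - 1)))"

section \<open>Measurability of sets of parameters\<close>

lemma borel_measurable_cosh [measurable (raw)]:
  "f \<in> borel_measurable M \<Longrightarrow> (\<lambda>x. cosh (f x :: real)) \<in> borel_measurable M"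
  by (rule measurable_compose[of f M borel]) (auto intro!: borel_measurable_continuous_onI continuous_intros)

lemma borel_measurable_sinh [measurable (raw)]:
  "f \<in> borel_measurable M \<Longrightarrow> (\<lambda>x. sinh (f x :: real)) \<in> borel_measurable M"
  by (rule measurable_compose[of f M borel]) (auto intro!: borel_measurable_continuous_onI continuous_intros)

lemma borel_measurable_amp [measurable (raw)]:
  "f \<in> borel_measurable M \<Longrightarrow> (\<lambda>x. amp lam (f x)) \<in> borel_measurable M"
  unfolding amp_def by (intro borel_measurable_add borel_measurable_times borel_measurable_const borel_measurable_cosh borel_measurable_sinh)

lemma borel_measurable_amp_deriv [measurable (raw)]:
  "f \<in> borel_measurable M \<Longrightarrow> (\<lambda>x. amp_deriv lam (f x)) \<in> borel_measurable M"
  unfolding amp_deriv_def by (intro borel_measurable_add borel_measurable_times borel_measurable_const borel_measurable_cosh borel_measurable_sinh)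

lemma space_hyp_par: "space (hyp_par lam :: (real \<times> 'a::euclidean_space) measure) = {0<..} \<times> sphere 0 1"
  by (simp add: hyp_par_def space_pair_measure space_restrict_space space_sphere_measure)

lemma measurable_pair_to_borel:
  "(\<lambda>x. x) \<in> measurable (restrict_space lborel {0<..} \<Otimes>\<^sub>M (sphere_measure :: 'a::euclidean_space measure)) (borel :: (real \<times> 'a) measure)"
proof -
  let ?M = "(restrict_space lborel {0<..} :: real measure) \<Otimes>\<^sub>M (sphere_measure :: 'a measure)"
  have 1: "(\<lambda>x. x) \<in> measurable (restrict_space lborel {0<..}) (borel :: real measure)"
    by (intro measurable_restrict_space1) simp
  have 2: "(\<lambda>x. x) \<in> measurable (sphere_measure :: 'a measure) borel"
    unfolding measurable_cong_sets[OF sets_sphere_measure refl] by (intro measurable_restrict_space1) simp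
  have "fst \<in> measurable ?M borel" "snd \<in> measurable ?M borel"
    by (rule measurable_compose[OF measurable_fst 1], rule measurable_compose[OF measurable_snd 2])
  then have "(\<lambda>x. (fst x, snd x)) \<in> measurable ?M (borel \<Otimes>\<^sub>M borel)"
    by (rule measurable_Pair)
  then show ?thesis by (simp add: borel_prod)
qed

lemma sets_hyp_parI:
  fixes X :: "(real \<times> 'a::euclidean_space) set"
  assumes "X \<in> sets borel"
  shows "X \<inter> ({0<..} \<times> sphere 0 1) \<in> sets (hyp_par lam)"
  using measurable_sets[OF measurable_pair_to_borel assms]
  by (simp add: hyp_par_def space_pair_measure space_restrict_space space_sphere_measure)

lemma closed_sets_hyp_parI:
  fixes X C :: "(real \<times> 'a::euclidean_space) set"
  assumes "closed C" "X = C \<inter> ({0<..} \<times> sphere 0 1)"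
  shows "X \<in> sets (hyp_par lam)"
  using sets_hyp_parI[of C lam] assms by (simp add: borel_closed)

lemma emeasure_hyp_par:
  fixes X :: "(real \<times> 'a::euclidean_space) set"
  assumes X: "X \<in> sets (hyp_par lam)"
  shows "emeasure (hyp_par lam) X = (\<integral>\<^sup>+s. indicator {0<..} s * (ennreal (amp lam s ^ (DIM('a) - 1)) *
    emeasure sphere_measure {u \<in> sphere 0 1. (s, u) \<in> X}) \<partial>lborel)"
proof -
  let ?S = "sphere_measure :: 'a measure"
  let ?L = "restrict_space lborel {0<..} :: real measure"
  interpret finite_measure ?S by (rule finite_measure_sphere_measure)
  have X': "X \<in> sets (?L \<Otimes>\<^sub>M ?S)" using X by (simp add: hyp_par_def)
  have Xs: "X \<subseteq> {0<..} \<times> sphere 0 1" using sets.sets_into_space[OF X] by (simp add: space_hyp_par)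
  have m1: "(\<lambda>s. ennreal (amp lam s ^ (DIM('a) - 1))) \<in> borel_measurable ?L"
    by (intro measurable_restrict_space1) measurable
  have m: "(\<lambda>(s, u). ennreal (amp lam s ^ (DIM('a) - 1))) \<in> borel_measurable (?L \<Otimes>\<^sub>M ?S)"
    using measurable_compose[OF measurable_fst m1] by (simp add: split_beta')
  have "emeasure (hyp_par lam) X = (\<integral>\<^sup>+p. (case p of (s, u) \<Rightarrow> ennreal (amp lam s ^ (DIM('a) - 1))) * indicator X p \<partial>(?L \<Otimes>\<^sub>M ?S))"
    unfolding hyp_par_def amp_def[symmetric] by (rule emeasure_density[OF m X'])
  also have "\<dots> = (\<integral>\<^sup>+s. \<integral>\<^sup>+u. ennreal (amp lam s ^ (DIM('a) - 1)) * indicator X (s, u) \<partial>?S \<partial>?L)"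
    by (subst nn_integral_fst[symmetric]) (use m X' in \<open>auto intro!: borel_measurable_times borel_measurable_indicator\<close>)
  also have "\<dots> = (\<integral>\<^sup>+s. ennreal (amp lam s ^ (DIM('a) - 1)) * emeasure ?S {u \<in> sphere 0 1. (s, u) \<in> X} \<partial>?L)"
  proof (rule nn_integral_cong)
    fix s
    have sec: "Pair s -` X \<in> sets ?S" by (rule sets_Pair1[OF X'])
    have eq: "{u \<in> sphere 0 1. (s, u) \<in> X} = Pair s -` X" using Xs by auto
    have "(\<integral>\<^sup>+u. ennreal (amp lam s ^ (DIM('a) - 1)) * indicator X (s, u) \<partial>?S)
        = (\<integral>\<^sup>+u. ennreal (amp lam s ^ (DIM('a) - 1)) * indicator (Pair s -` X) u \<partial>?S)"
      by (simp add: indicator_def)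
    also have "\<dots> = ennreal (amp lam s ^ (DIM('a) - 1)) * emeasure ?S (Pair s -` X)"
      by (rule nn_integral_cmult_indicator[OF sec])
    finally show "(\<integral>\<^sup>+u. ennreal (amp lam s ^ (DIM('a) - 1)) * indicator X (s, u) \<partial>?S) =
       ennreal (amp lam s ^ (DIM('a) - 1)) * emeasure ?S {u \<in> sphere 0 1. (s, u) \<in> X}" by (simp only: eq)
  qed
  also have "\<dots> = (\<integral>\<^sup>+s. indicator {0<..} s * (ennreal (amp lam s ^ (DIM('a) - 1)) * emeasure ?S {u \<in> sphere 0 1. (s, u) \<in> X}) \<partial>lborel)"
    by (subst nn_integral_restrict_space) (auto simp: mult.commute)
  finally show ?thesis .
qed

lemma closed_projection_compact:
  fixes K :: "'b::euclidean_space set" and C :: "('b \<times> 'c::euclidean_space) set"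
  assumes "compact K" "closed C"
  shows "closed {p. \<exists>x\<in>K. (x, p) \<in> C}"
proof -
  have "closedin (top_of_set (K \<times> UNIV)) (K \<times> UNIV \<inter> C)"
    using assms(2) by (rule closedin_closed_Int)
  from closedin_compact_projection[OF assms(1) this]
  have "closed {y. \<exists>x. x \<in> K \<and> (x, y) \<in> K \<times> UNIV \<inter> C}" by simp
  also have "{y. \<exists>x. x \<in> K \<and> (x, y) \<in> K \<times> UNIV \<inter> C} = {p. \<exists>x\<in>K. (x, p) \<in> C}" by auto
  finally show ?thesis .
qed

definition hyp_meets :: "real \<Rightarrow> 'a::euclidean_space set \<Rightarrow> (real \<times> 'a) set" where
  "hyp_meets lam K = {(s, u). 0 < s \<and> norm u = 1 \<and> lambda_hyperplane lam s u \<inter> K \<noteq> {}}"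

text \<open>The incidence relation is closed, and its projection along the compact set
  \<open>K\<close> is closed again; intersecting with the parameter space gives the hitting
  set.\<close>

lemma sets_hyp_meets:
  fixes K :: "'a::euclidean_space set"
  assumes lam: "0 \<le> lam" and K: "compact K" "K \<subseteq> ball 0 1"
  shows "hyp_meets lam K \<in> sets (hyp_par lam)"
proof -
  define f where "f = (\<lambda>(x :: 'a, s, u :: 'a). (2 * tanh (s/2) + lam * (1 + (tanh (s/2))\<^sup>2)) * (1 + (norm x)\<^sup>2)
      - (u \<bullet> x) * ((1 + (tanh (s/2))\<^sup>2) + lam * (2 * tanh (s/2))) * 2 - lam * (1 - (tanh (s/2))\<^sup>2) * (1 - (norm x)\<^sup>2))"
  have iff: "x \<in> lambda_hyperplane lam s u \<longleftrightarrow> f (x, s, u) = 0" if "0 < s" "norm u = 1" "x \<in> K" for x s u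
    using lambda_hyperplane_iff[OF that(2) lam that(1), of x] K(2) that(3) by (auto simp: f_def)
  have "closed {p. f p = 0}"
    unfolding f_def split_beta' by (intro closed_Collect_eq continuous_intros) auto
  from closed_projection_compact[OF K(1) this]
  have cl: "closed {p. \<exists>x\<in>K. f (x, p) = 0}" by simp
  have "hyp_meets lam K = {p. \<exists>x\<in>K. f (x, p) = 0} \<inter> {0<..} \<times> sphere 0 1"
  proof (intro set_eqI iffI)
    fix p assume "p \<in> hyp_meets lam K"
    then obtain x where "0 < fst p" "norm (snd p) = 1" "x \<in> K" "x \<in> lambda_hyperplane lam (fst p) (snd p)"
      by (auto simp: hyp_meets_def)
    then show "p \<in> {p. \<exists>x\<in>K. f (x, p) = 0} \<inter> {0<..} \<times> sphere 0 1"
      using iff[of "fst p" "snd p" x] by (cases p) auto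
  next
    fix p assume "p \<in> {p. \<exists>x\<in>K. f (x, p) = 0} \<inter> {0<..} \<times> sphere 0 1"
    then obtain x where "0 < fst p" "norm (snd p) = 1" "x \<in> K" "f (x, p) = 0" by auto
    then have "x \<in> lambda_hyperplane lam (fst p) (snd p)" using iff[of "fst p" "snd p" x] by simp
    then show "p \<in> hyp_meets lam K"
      using \<open>0 < fst p\<close> \<open>norm (snd p) = 1\<close> \<open>x \<in> K\<close> by (cases p) (auto simp: hyp_meets_def)
  qed
  with cl show ?thesis by (rule closed_sets_hyp_parI)
qed

lemma ray_hits_eq_hyp_meets:
  fixes v :: "'a::euclidean_space"
  assumes "norm v = 1" "0 \<le> lam" "0 \<le> \<tau>"
  shows "ray_hits lam \<tau> v = hyp_meets lam (closed_segment 0 (tanh (\<tau>/2) *\<^sub>R v))"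
proof -
  have "(s, u) \<in> ray_hits lam \<tau> v \<longleftrightarrow> (s, u) \<in> hyp_meets lam (closed_segment 0 (tanh (\<tau>/2) *\<^sub>R v))" for s u
  proof (cases "0 < s \<and> norm u = 1")
    case True
    then show ?thesis using ray_hits_iff[of u v lam s \<tau>] assms by (auto simp: hyp_meets_def)
  qed (auto simp: ray_hits_def hyp_meets_def)
  then show ?thesis by auto
qed

lemma segment_subset_ball: "norm x < 1 \<Longrightarrow> closed_segment 0 x \<subseteq> ball (0::'a::euclidean_space) 1"
  by (intro closed_segment_subset) auto

lemma sets_ray_hits:
  fixes v :: "'a::euclidean_space"
  assumes "norm v = 1" "0 \<le> lam" "0 \<le> \<tau>"
  shows "ray_hits lam \<tau> v \<in> sets (hyp_par lam)"
  unfolding ray_hits_eq_hyp_meets[OF assms]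
  using assms by (intro sets_hyp_meets segment_subset_ball compact_segment) (auto simp: tanh_real_lt_1)

text \<open>The integrands below can blow up at an endpoint, for instance like an inverse square
  root when d = 2. Hence the derivative is required inside the interval only, and mere continuity of
  \<open>F\<close> at its ends.\<close>

lemma nn_integral_FTC_Ioo:
  fixes F f :: "real \<Rightarrow> real"
  assumes "a \<le> b" and [measurable]: "f \<in> borel_measurable borel" and F: "continuous_on {a..b} F"
    and deriv: "\<And>x. a < x \<Longrightarrow> x < b \<Longrightarrow> (F has_real_derivative f x) (at x)"
    and nonneg: "\<And>x. a < x \<Longrightarrow> x < b \<Longrightarrow> 0 \<le> f x"
  shows "(\<integral>\<^sup>+x. indicator {a<..<b} x * ennreal (f x) \<partial>lborel) = ennreal (F b - F a)"
proof -
  have "(f has_integral (F b - F a)) {a..b}"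
    using deriv by (intro fundamental_theorem_of_calculus_interior[OF assms(1) F])
      (auto simp: has_real_derivative_iff_has_vector_derivative)
  then have "(f has_integral (F b - F a)) {a<..<b}"
    by (simp add: has_integral_Icc_iff_Ioo)
  then have "((\<lambda>x. if x \<in> {a<..<b} then f x else 0) has_integral (F b - F a)) UNIV"
    by (subst has_integral_restrict_UNIV)
  then have "(\<integral>\<^sup>+x. ennreal (if x \<in> {a<..<b} then f x else 0) \<partial>lborel) = ennreal (F b - F a)"
    by (intro nn_integral_has_integral_lborel) (use nonneg in auto)
  also have "(\<integral>\<^sup>+x. ennreal (if x \<in> {a<..<b} then f x else 0) \<partial>lborel) = (\<integral>\<^sup>+x. indicator {a<..<b} x * ennreal (f x) \<partial>lborel)"
    by (intro nn_integral_cong) auto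
  finally show ?thesis .
qed

lemma has_real_derivative_sqrt_power:
  fixes q :: "real \<Rightarrow> real"
  assumes "(q has_real_derivative q') (at x)" "q x > 0"
  shows "((\<lambda>x. sqrt (q x) ^ n) has_real_derivative real n * q' / 2 * (sqrt (q x) ^ n / q x)) (at x)"
proof (cases n)
  case (Suc m)
  define S where "S = sqrt (q x)"
  have S: "S > 0" "q x = S * S" using assms(2) by (simp_all add: S_def)
  have "((\<lambda>x. sqrt (q x)) has_real_derivative q' / (2 * S)) (at x)"
    unfolding S_def using assms by (auto intro!: derivative_eq_intros simp: field_simps)
  from DERIV_power[OF this, of n]
  have "((\<lambda>x. sqrt (q x) ^ n) has_real_derivative real n * (q' / (2 * S) * S ^ m)) (at x)"
    by (simp add: Suc S_def)
  also have "real n * (q' / (2 * S) * S ^ m) = real n * q' / 2 * (S ^ n / q x)"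
    unfolding S(2) Suc using S(1) by simp
  finally show ?thesis by (simp add: S_def)
qed simp

text \<open>The density of the point \<open>t\<close> at which the ray enters the convex side of the hyperplane.\<close>

definition entry_density :: "nat \<Rightarrow> real \<Rightarrow> real \<Rightarrow> real \<Rightarrow> real" where
  "entry_density n lam s t = (if 0 < s \<and> s < t \<and> lam * cosh t < amp_deriv lam s
     then (let w = amp_deriv lam s - lam * cosh t; q = (sinh t)\<^sup>2 - w\<^sup>2
           in real n * cap_const (n + 1) * (sqrt q ^ n / q) * w * amp lam s / sinh t ^ n)
     else 0)"

lemma borel_measurable_entry_density:
  "(\<lambda>(s, t). entry_density n lam s t) \<in> borel_measurable (borel \<Otimes>\<^sub>M borel)"
  unfolding entry_density_def Let_def split_beta' by measurable

lemma entry_density_q_pos: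
  assumes "0 \<le> lam" "0 < s" "s < t" "lam * cosh t < amp_deriv lam s"
  shows "0 < (sinh t)\<^sup>2 - (amp_deriv lam s - lam * cosh t)\<^sup>2"
proof -
  have "amp_deriv lam s < amp_deriv lam t" using assms by (intro amp_deriv_strict_mono) auto
  then have "amp_deriv lam s - lam * cosh t < sinh t" by (simp add: amp_deriv_def)
  then have "(amp_deriv lam s - lam * cosh t)\<^sup>2 < (sinh t)\<^sup>2" using assms by (intro power_strict_mono) auto
  then show ?thesis by simp
qed

text \<open>As a function of \<open>s\<close> the density is the derivative of
  \<open>- (?k / sinh t ^ n) * sqrt (q s) ^ n\<close>. At the lower end \<open>s0\<close> of its
  support \<open>w\<close> vanishes, so \<open>q\<close> equals \<open>(sinh t)\<^sup>2\<close>; at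
  the upper end \<open>s = t\<close> and \<open>q = 0\<close>. Everything that depends on
  \<open>t\<close> or \<open>lam\<close> cancels.\<close>

lemma nn_integral_entry_density:
  assumes n: "n \<ge> 1" and lam: "0 \<le> lam" "lam \<le> 1" and t: "0 < t"
  shows "(\<integral>\<^sup>+s. ennreal (entry_density n lam s t) \<partial>lborel) = ennreal (cap_const (n + 1))"
proof -
  let ?k = "cap_const (n + 1)"
  have sh: "sinh t > 0" using t by simp
  have "\<exists>s\<ge>0. s \<le> t \<and> amp_deriv lam s = lam * cosh t"
    using t lam sh by (intro IVT' continuous_on_amp_deriv) (auto simp: cosh_real_ge_1 amp_deriv_def mult_le_cancel_left1)
  then obtain s0 where s0: "0 \<le> s0" "s0 \<le> t" "amp_deriv lam s0 = lam * cosh t" by blast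
  define w where "w s = amp_deriv lam s - lam * cosh t" for s
  define q where "q s = (sinh t)\<^sup>2 - (w s)\<^sup>2" for s
  define f where "f s = real n * ?k * (sqrt (q s) ^ n / q s) * w s * amp lam s / sinh t ^ n" for s
  have iff: "0 < s \<and> s < t \<and> lam * cosh t < amp_deriv lam s \<longleftrightarrow> s0 < s \<and> s < t" for s
  proof
    assume *: "0 < s \<and> s < t \<and> lam * cosh t < amp_deriv lam s"
    have "\<not> s \<le> s0"
    proof
      assume "s \<le> s0"
      then have "amp_deriv lam s \<le> amp_deriv lam s0"
        using amp_deriv_strict_mono[OF lam(1), of s s0] * by (cases "s = s0") auto
      then show False using * s0 by simp
    qed
    then show "s0 < s \<and> s < t" using * by simp
  next
    assume "s0 < s \<and> s < t"
    then show "0 < s \<and> s < t \<and> lam * cosh t < amp_deriv lam s"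
      using amp_deriv_strict_mono[OF lam(1), of s0 s] s0 by auto
  qed
  have q_pos: "0 < q s" if "s0 < s" "s < t" for s
    using iff[of s] that entry_density_q_pos[OF lam(1), of s t] by (simp add: q_def w_def)
  have "(\<integral>\<^sup>+s. ennreal (entry_density n lam s t) \<partial>lborel) = (\<integral>\<^sup>+s. indicator {s0<..<t} s * ennreal (f s) \<partial>lborel)"
    by (intro nn_integral_cong) (auto simp: entry_density_def iff f_def q_def w_def Let_def indicator_def)
  also have "\<dots> = ennreal (- (?k / sinh t ^ n) * sqrt (q t) ^ n - - (?k / sinh t ^ n) * sqrt (q s0) ^ n)"
  proof (rule nn_integral_FTC_Ioo)
    show "s0 \<le> t" by fact
    show "f \<in> borel_measurable borel" unfolding f_def q_def w_def by measurable
    show "continuous_on {s0..t} (\<lambda>s. - (?k / sinh t ^ n) * sqrt (q s) ^ n)"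
      unfolding q_def w_def by (intro continuous_intros continuous_on_amp_deriv)
  next
    fix s assume s: "s0 < s" "s < t"
    have "(q has_real_derivative - (2 * w s * amp lam s)) (at s)"
      unfolding q_def w_def by (auto intro!: derivative_eq_intros amp_has_derivative)
    from DERIV_cmult[OF has_real_derivative_sqrt_power[OF this q_pos[OF s], of n], of "- (?k / sinh t ^ n)"]
    show "((\<lambda>s. - (?k / sinh t ^ n) * sqrt (q s) ^ n) has_real_derivative f s) (at s)"
      by (simp add: f_def mult_ac)
    have "w s > 0" using iff[of s] s by (simp add: w_def)
    moreover have "amp lam s > 0" using amp_bounds(1)[OF lam, of s] s s0 by simp
    ultimately show "0 \<le> f s"
      using q_pos[OF s] sh cap_const_pos[of "n + 1"] by (simp add: f_def)
  qed
  also have "q t = 0" by (simp add: q_def w_def amp_deriv_def)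
  also have "q s0 = (sinh t)\<^sup>2" by (simp add: q_def w_def s0)
  finally show ?thesis using n sh by (simp add: power_0_left)
qed

text \<open>The directions in which the point at distance \<open>t\<close> is on the convex side or
  the hyperplane form the cap of cosine \<open>G t\<close>. It starts at \<open>t = s\<close> as a
  single point and grows as long as \<open>w\<close> is positive; afterwards it shrinks. The
  directions hit by time \<tau> are thus the largest cap, and its measure is recovered by
  integrating its growth rate.\<close>

lemma ray_hits_section:
  fixes v :: "'a::euclidean_space"
  assumes d: "DIM('a) = n + 1" "n \<ge> 1" and lam: "0 \<le> lam" "lam \<le> 1" and v: "norm v = 1" and s: "0 < s" "s < \<tau>"
  shows "ennreal (amp lam s ^ n) * emeasure sphere_measure {u \<in> sphere 0 1. (s, u) \<in> ray_hits lam \<tau> v}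
    = (\<integral>\<^sup>+t. indicator {0<..<\<tau>} t * ennreal (entry_density n lam s t) \<partial>lborel)"
proof -
  let ?k = "cap_const (n + 1)"
  define A where "A = amp lam s"
  define A' where "A' = amp_deriv lam s"
  have A: "A > 0" using amp_bounds(1)[OF lam, of s] s by (simp add: A_def)
  have A'l: "lam < A'" using amp_deriv_gt[OF lam(1) s(1)] by (simp add: A'_def)
  define w where "w t = A' - lam * cosh t" for t
  define q where "q t = (sinh t)\<^sup>2 - (w t)\<^sup>2" for t
  define G where "G t = (A' * cosh t - lam) / (A * sinh t)" for t
  define f where "f t = real n * ?k * (sqrt (1 - (G t)\<^sup>2) ^ n / (1 - (G t)\<^sup>2)) * (w t / (A * (sinh t)\<^sup>2))" for t
  have w_mono: "w t' \<le> w t" if "0 \<le> t" "t \<le> t'" for t t'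
    using that lam by (auto simp: w_def intro!: mult_left_mono simp: cosh_real_nonneg_le_iff)
  have num: "A' * cosh t - lam > 0" for t
    using A'l lam cosh_real_ge_1[of t] by (smt (verit) mult_le_cancel_left1)
  have G_pos: "G t > 0" if "t > 0" for t
    using that A num by (simp add: G_def)
  have G_sq: "(G t)\<^sup>2 = 1 - q t / (A * sinh t)\<^sup>2" if "t > 0" for t
  proof -
    have "(A' * cosh t - lam)\<^sup>2 = (A * sinh t)\<^sup>2 - q t"
      using amp_identity[of lam s t] by (simp add: A_def A'_def q_def w_def power_mult_distrib)
    then have "(G t)\<^sup>2 = ((A * sinh t)\<^sup>2 - q t) / (A * sinh t)\<^sup>2" by (simp only: G_def power_divide)
    then show ?thesis using that A by (simp add: diff_divide_distrib)
  qed
  have G_s: "G s = 1"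
  proof -
    have "A' * cosh s - lam = A * sinh s"
      using cosh_square_eq[of s] by (simp add: A_def A'_def amp_def amp_deriv_def power2_eq_square algebra_simps)
    then show ?thesis using A s by (simp add: G_def)
  qed
  \<comment> \<open>The time of the largest cap: \<tau> itself, or the zero of \<open>w\<close> if
    that comes earlier.\<close>
  obtain te where te: "s < te" "te \<le> \<tau>" "0 \<le> w te" "te = \<tau> \<or> w te = 0"
  proof (cases "0 \<le> w \<tau>")
    case True
    then show ?thesis using that[of \<tau>] s by simp
  next
    case False
    have ws: "w s = sinh s" by (simp add: w_def A'_def amp_deriv_def)
    have "\<exists>t\<ge>s. t \<le> \<tau> \<and> w t = 0"
      using False s ws by (intro IVT2') (auto simp: w_def intro!: continuous_intros)
    then obtain t where t: "s \<le> t" "t \<le> \<tau>" "w t = 0" by blast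
    then show ?thesis using that[of t] ws s by (cases "t = s") auto
  qed
  have te0: "0 < te" using te s by simp
  have w_pos: "0 < w t" if "0 < t" "t < te" for t
  proof (cases "lam = 0")
    case False
    then have "lam * cosh t < lam * cosh te" using that lam by (simp add: cosh_real_nonneg_less_iff)
    then show ?thesis using te by (simp add: w_def)
  qed (use A'l in \<open>simp add: w_def\<close>)
  have iff: "0 < t \<and> t < \<tau> \<and> s < t \<and> 0 < w t \<longleftrightarrow> s < t \<and> t < te" for t
    using te s w_pos[of t] w_mono[of te t] by (cases "t < te") auto
  have q_pos: "0 < q t" if "s < t" "t < te" for t
    using entry_density_q_pos[OF lam(1) s(1) that(1)] iff[of t] that by (simp add: q_def w_def A'_def)
  have G_te: "G te < 1"
  proof -
    have "w te < sinh te"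
    proof -
      have "A' < amp_deriv lam te" using amp_deriv_strict_mono[OF lam(1), of s te] te s by (simp add: A'_def)
      then show ?thesis by (simp add: w_def amp_deriv_def)
    qed
    then have "q te > 0" using te by (auto simp: q_def intro!: power_strict_mono)
    then have "(G te)\<^sup>2 < 1\<^sup>2" using A te0 by (simp add: G_sq)
    then show ?thesis by (rule power2_less_imp_less) simp
  qed
  \<comment> \<open>Up to the factor \<open>(amp lam s)\<^sup>2\<close>,
    \<open>1 - (G t)\<^sup>2\<close> equals \<open>1 - (w t / sinh t)\<^sup>2\<close>. So
    \<open>G\<close> is smallest where the ratio is smallest in absolute value.\<close>
  have G_min: "G te \<le> G t" if t: "0 < t" "t \<le> \<tau>" for t
  proof -
    have "w te / sinh te \<le> \<bar>w t\<bar> / sinh t"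
    proof (cases "w te = 0")
      case False
      then have "te = \<tau>" using te by simp
      then have "w te \<le> \<bar>w t\<bar>" "sinh t \<le> sinh te" using w_mono[of t te] t by auto
      then show ?thesis using t te by (intro frac_le) auto
    qed (use t in simp)
    then have "(w te / sinh te)\<^sup>2 \<le> (\<bar>w t\<bar> / sinh t)\<^sup>2"
      using te te0 by (intro power_mono) auto
    then have "(w te)\<^sup>2 / (sinh te)\<^sup>2 \<le> (w t)\<^sup>2 / (sinh t)\<^sup>2" by (simp add: power_divide)
    moreover have "q t / (sinh t)\<^sup>2 = 1 - (w t)\<^sup>2 / (sinh t)\<^sup>2" if "t > 0" for t
      using that by (simp add: q_def diff_divide_distrib)
    ultimately have "q t / (sinh t)\<^sup>2 / A\<^sup>2 \<le> q te / (sinh te)\<^sup>2 / A\<^sup>2"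
      using t te0 by (intro divide_right_mono) auto
    then have "(G te)\<^sup>2 \<le> (G t)\<^sup>2"
      using t te0 by (simp add: G_sq power_mult_distrib mult.commute)
    then show ?thesis by (rule power2_le_imp_le) (use G_pos[OF t(1)] in simp)
  qed
  have sec: "{u \<in> sphere 0 1. (s, u) \<in> ray_hits lam \<tau> v} = {u \<in> sphere 0 1. G te \<le> u \<bullet> v}"
  proof -
    have hit_iff: "A' * cosh t - c * A * sinh t \<le> lam \<longleftrightarrow> G t \<le> c" if "0 < t" for t c
      using that A by (simp add: G_def pos_divide_le_eq mult.assoc) linarith
    have "(\<exists>t. 0 < t \<and> t \<le> \<tau> \<and> A' * cosh t - c * A * sinh t \<le> lam) \<longleftrightarrow> G te \<le> c" for c
    proof
      assume "\<exists>t. 0 < t \<and> t \<le> \<tau> \<and> A' * cosh t - c * A * sinh t \<le> lam"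
      then show "G te \<le> c" using hit_iff G_min by force
    next
      assume "G te \<le> c"
      then show "\<exists>t. 0 < t \<and> t \<le> \<tau> \<and> A' * cosh t - c * A * sinh t \<le> lam"
        using hit_iff[OF te0] te te0 by blast
    qed
    then show ?thesis using s by (auto simp: ray_hits_def A_def A'_def)
  qed
  have "emeasure sphere_measure {u \<in> sphere 0 1. (s, u) \<in> ray_hits lam \<tau> v} = ennreal (cap_measure (n + 1) (G te) - cap_measure (n + 1) (G s))"
    unfolding sec using emeasure_sphere_measure_cap[OF v G_pos[OF te0] G_te] d by (simp add: G_s cap_measure_1)
  also have "\<dots> = (\<integral>\<^sup>+t. indicator {s<..<te} t * ennreal (f t) \<partial>lborel)"
  proof (rule nn_integral_FTC_Ioo[symmetric])
    show "s \<le> te" using te by simp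
    show "f \<in> borel_measurable borel" unfolding f_def G_def w_def by measurable
    have G01: "G t \<in> {0<..<1}" if "s < t" "t < te" for t
    proof -
      have "0 < q t / (A * sinh t)\<^sup>2" using q_pos[OF that] that A s by simp
      then have "(G t)\<^sup>2 < 1\<^sup>2" using G_sq[of t] that s by simp
      then have "G t < 1" by (rule power2_less_imp_less) simp
      then show ?thesis using G_pos[of t] that s by simp
    qed
    have G_cont: "continuous_on {s..te} G"
      unfolding G_def using A s by (intro continuous_intros) auto
    have G_img: "G ` {s..te} \<subseteq> {0..1}"
    proof
      fix y assume "y \<in> G ` {s..te}"
      then obtain t where t: "t \<in> {s..te}" "y = G t" by auto
      then consider "t = s" | "t = te" | "s < t" "t < te" by force
      then show "y \<in> {0..1}" using G_s G_te G_pos[OF te0] G01[of t] t by cases auto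
    qed
    show "continuous_on {s..te} (\<lambda>t. cap_measure (n + 1) (G t))"
      by (rule continuous_on_compose2[OF continuous_on_cap_measure G_cont G_img])
    fix t assume t: "s < t" "t < te"
    have t0: "t > 0" using t s by simp
    have "(G has_real_derivative ((A' * sinh t) * (A * sinh t) - (A' * cosh t - lam) * (A * cosh t)) / ((A * sinh t) * (A * sinh t))) (at t)"
      unfolding G_def using A t0 by (auto intro!: derivative_eq_intros)
    also have "(A' * sinh t) * (A * sinh t) - (A' * cosh t - lam) * (A * cosh t) = - (A * w t)"
    proof -
      have "cosh t * cosh t = sinh t * sinh t + 1" using cosh_square_eq[of t] by (simp add: power2_eq_square)
      then show ?thesis by (simp add: w_def algebra_simps)
    qed
    also have "- (A * w t) / ((A * sinh t) * (A * sinh t)) = - (w t / (A * (sinh t)\<^sup>2))"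
      using A by (simp add: power2_eq_square)
    finally have G': "(G has_real_derivative - (w t / (A * (sinh t)\<^sup>2))) (at t)" .
    have "((\<lambda>t. cap_measure (n + 1) (G t)) has_real_derivative
       - (real n * ?k * sqrt (1 - (G t)\<^sup>2) ^ n / (1 - (G t)\<^sup>2)) * - (w t / (A * (sinh t)\<^sup>2))) (at t)"
      using cap_measure_has_derivative[of "n + 1" "G t"] G01[OF t] by (intro DERIV_chain2[OF _ G']) auto
    then show "((\<lambda>t. cap_measure (n + 1) (G t)) has_real_derivative f t) (at t)"
      by (simp add: f_def)
    have "(G t)\<^sup>2 < 1" using G01[OF t] by (simp add: abs_square_less_1)
    then show "0 \<le> f t"
      using w_pos[of t] t s A cap_const_pos[of "n + 1"] by (simp add: f_def)
  qed
  finally have "ennreal (A ^ n) * emeasure sphere_measure {u \<in> sphere 0 1. (s, u) \<in> ray_hits lam \<tau> v}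
     = (\<integral>\<^sup>+t. ennreal (A ^ n) * (indicator {s<..<te} t * ennreal (f t)) \<partial>lborel)"
    by (subst nn_integral_cmult) (auto simp: f_def G_def w_def)
  also have "\<dots> = (\<integral>\<^sup>+t. indicator {0<..<\<tau>} t * ennreal (entry_density n lam s t) \<partial>lborel)"
  proof (rule nn_integral_cong)
    fix t :: real
    show "ennreal (A ^ n) * (indicator {s<..<te} t * ennreal (f t)) = indicator {0<..<\<tau>} t * ennreal (entry_density n lam s t)"
    proof (cases "s < t \<and> t < te")
      case True
      then have t: "0 < t" "t < \<tau>" "0 < w t" "0 < q t" using iff[of t] q_pos[of t] by auto
      define D where "D = A * sinh t"
      have D: "D > 0" using A t by (simp add: D_def)
      have "A ^ n * f t = A ^ n * (real n * ?k * ((sqrt (q t) / D) ^ n / (q t / D\<^sup>2)) * (w t / (A * (sinh t)\<^sup>2)))"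
        using D t by (simp add: f_def G_sq real_sqrt_divide D_def[symmetric] power_divide)
      also have "\<dots> = real n * ?k * (sqrt (q t) ^ n / q t) * w t * (A ^ n / D ^ n) * (D\<^sup>2 / (A * (sinh t)\<^sup>2))"
        by (simp add: power_divide mult_ac)
      also have "D\<^sup>2 / (A * (sinh t)\<^sup>2) = A" using A t by (simp add: D_def power2_eq_square)
      also have "A ^ n / D ^ n = 1 / sinh t ^ n" using A t by (simp add: D_def power_mult_distrib)
      finally have "A ^ n * f t = entry_density n lam s t"
        using t True s by (simp add: entry_density_def Let_def q_def w_def A_def A'_def)
      then show ?thesis using True t A by (simp add: ennreal_mult'[symmetric])
    next
      case False
      then have "\<not> (0 < t \<and> t < \<tau> \<and> s < t \<and> 0 < w t)" using iff by blast
      then show ?thesis using False by (auto simp: indicator_def entry_density_def w_def A'_def)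
    qed
  qed
  finally show ?thesis by (simp add: A_def)
qed

text \<open>Slicing by \<open>s\<close> produces the caps of \<open>ray_hits_section\<close>,
  slicing by \<open>t\<close> the constant of \<open>nn_integral_entry_density\<close>.\<close>

theorem emeasure_ray_hits:
  fixes v :: "'a::euclidean_space"
  assumes d: "DIM('a) \<ge> 2" and lam: "0 \<le> lam" "lam \<le> 1" and v: "norm v = 1" and tau: "0 \<le> \<tau>"
  shows "emeasure (hyp_par lam) (ray_hits lam \<tau> v) = ennreal (cap_const DIM('a) * \<tau>)"
proof -
  define n where "n = DIM('a) - 1"
  have n: "DIM('a) = n + 1" "n \<ge> 1" "DIM('a) - 1 = n" using d by (auto simp: n_def)
  note [measurable] = borel_measurable_entry_density[of n lam]
  let ?g = "\<lambda>s t. indicator {0<..<\<tau>} t * ennreal (entry_density n lam s t)"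
  have "emeasure (hyp_par lam) (ray_hits lam \<tau> v) = (\<integral>\<^sup>+s. indicator {0<..} s * (ennreal (amp lam s ^ n) *
      emeasure sphere_measure {u \<in> sphere 0 1. (s, u) \<in> ray_hits lam \<tau> v}) \<partial>lborel)"
    using emeasure_hyp_par[OF sets_ray_hits[OF v lam(1) tau]] by (simp only: n(3))
  also have "\<dots> = (\<integral>\<^sup>+s. \<integral>\<^sup>+t. ?g s t \<partial>lborel \<partial>lborel)"
  proof (rule nn_integral_cong_AE)
    have "AE s in lborel. s \<noteq> \<tau>" by (rule AE_lborel_singleton)
    then show "AE s in lborel. indicator {0<..} s * (ennreal (amp lam s ^ n) *
      emeasure sphere_measure {u \<in> sphere 0 1. (s, u) \<in> ray_hits lam \<tau> v}) = (\<integral>\<^sup>+t. ?g s t \<partial>lborel)"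
    proof eventually_elim
      case (elim s)
      consider "s \<le> 0" | "0 < s" "s < \<tau>" | "\<tau> < s" "0 < s" using elim tau by linarith
      then show ?case
      proof cases
        case 1
        then show ?thesis by (simp add: entry_density_def)
      next
        case 2
        then show ?thesis using ray_hits_section[OF n(1,2) lam v 2] by simp
      next
        case 3
        then have "{u \<in> sphere 0 1. (s, u) \<in> ray_hits lam \<tau> v} = {}"
          using ray_hits_bounds(2)[OF lam v] by fastforce
        moreover have "?g s t = 0" for t using 3 by (auto simp: entry_density_def indicator_def)
        ultimately show ?thesis by (simp only: emeasure_empty mult_zero_right nn_integral_const mult_zero_left)
      qed
    qed
  qed
  also have "\<dots> = (\<integral>\<^sup>+t. \<integral>\<^sup>+s. ?g s t \<partial>lborel \<partial>lborel)"
    by (rule lborel_pair.Fubini'[symmetric]) measurable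
  also have "\<dots> = (\<integral>\<^sup>+t. ennreal (cap_const (n + 1)) * indicator {0<..<\<tau>} t \<partial>lborel)"
  proof (rule nn_integral_cong)
    fix t :: real
    show "(\<integral>\<^sup>+s. ?g s t \<partial>lborel) = ennreal (cap_const (n + 1)) * indicator {0<..<\<tau>} t"
      using nn_integral_entry_density[OF n(2) lam, of t] by (auto simp: indicator_def)
  qed
  also have "\<dots> = ennreal (cap_const (n + 1)) * ennreal \<tau>" using tau by (simp add: nn_integral_cmult_indicator)
  finally show ?thesis using tau by (simp add: n(1) ennreal_mult'')
qed

section \<open>The visibility region\<close>

lemma hyperplane_measure_eq:
  "hyperplane_measure lam = embed_measure (hyp_par lam) (\<lambda>(s, u::'a::euclidean_space). lambda_hyperplane lam s u)"
  by (simp add: hyperplane_measure_def hyp_par_def)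

lemma num_points_eq_0_iff: "num_points S = 0 \<longleftrightarrow> S = {}"
  by (simp add: num_points_def emeasure_count_space_eq_0)

lemma tanh_artanh_real: "\<bar>x\<bar> < 1 \<Longrightarrow> tanh (artanh x) = (x::real)"
proof -
  assume "\<bar>x\<bar> < 1"
  then have x: "1 + x > 0" "1 - x > 0" by auto
  define z where "z = artanh x"
  have e: "exp (2 * z) = (1 + x) / (1 - x)"
    using x by (simp add: z_def artanh_def)
  have "exp (- 2 * z) = (1 - x) / (1 + x)"
    using e exp_minus[of "2 * z"] by simp
  then have "tanh z = (1 - (1 - x) / (1 + x)) / (1 + (1 - x) / (1 + x))"
    by (simp add: tanh_real_altdef)
  also have "\<dots> = x" using x by (simp add: divide_simps)
  finally show ?thesis by (simp add: z_def)
qed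

lemma hyp_dist_origin_le_iff:
  fixes y :: "'a::euclidean_space"
  assumes "norm y < 1"
  shows "hyp_dist_origin y \<le> C \<longleftrightarrow> norm y \<le> tanh (C / 2)"
proof -
  have "norm y = tanh (artanh (norm y))" using assms by (simp add: tanh_artanh_real)
  then have "norm y \<le> tanh (C / 2) \<longleftrightarrow> artanh (norm y) \<le> C / 2"
    by (metis tanh_real_le_iff)
  then show ?thesis by (auto simp: hyp_dist_origin_def)
qed

lemma hyp_bounded_iff:
  fixes S :: "'a::euclidean_space set"
  assumes "S \<subseteq> ball 0 1"
  shows "hyp_bounded S \<longleftrightarrow> (\<exists>n::nat. S \<subseteq> cball 0 (tanh (real n / 2)))"
proof
  assume "hyp_bounded S"
  then obtain C where C: "\<And>y. y \<in> S \<Longrightarrow> hyp_dist_origin y \<le> C" by (auto simp: hyp_bounded_def)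
  obtain n :: nat where n: "C \<le> real n" using real_arch_simple by blast
  have "norm y \<le> tanh (real n / 2)" if "y \<in> S" for y
    using hyp_dist_origin_le_iff[of y "real n"] C[OF that] n assms that by auto
  then show "\<exists>n::nat. S \<subseteq> cball 0 (tanh (real n / 2))" by (intro exI[of _ n]) auto
next
  assume "\<exists>n::nat. S \<subseteq> cball 0 (tanh (real n / 2))"
  then obtain n :: nat where n: "S \<subseteq> cball 0 (tanh (real n / 2))" by blast
  have "hyp_dist_origin y \<le> real n" if "y \<in> S" for y
  proof -
    have "norm y < 1" "norm y \<le> tanh (real n / 2)" using n assms that by auto
    then show ?thesis by (simp add: hyp_dist_origin_le_iff)
  qed
  then show "hyp_bounded S" using assms by (auto simp: hyp_bounded_def)
qed

text \<open>The union of the segments from the origin to the points of a closed ball. A hyperplane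
  that avoids it hides no point of the ball, and compactness makes the corresponding void event
  measurable.\<close>

definition radial_hull :: "'a::euclidean_space \<Rightarrow> real \<Rightarrow> 'a set" where
  "radial_hull q e = (\<lambda>(t, y). t *\<^sub>R y) ` ({0..1} \<times> cball q e)"

lemma compact_radial_hull: "compact (radial_hull q e)"
  unfolding radial_hull_def split_beta'
  by (intro compact_continuous_image compact_Times continuous_intros) auto

lemma radial_hull_subset_ball:
  fixes q :: "'a::euclidean_space"
  assumes "cball q e \<subseteq> ball 0 r"
  shows "radial_hull q e \<subseteq> ball 0 r"
proof
  fix z assume "z \<in> radial_hull q e"
  then obtain t y where z: "z = t *\<^sub>R y" "0 \<le> t" "t \<le> 1" "y \<in> cball q e"
    by (auto simp: radial_hull_def)
  then have "norm z \<le> norm y" by (simp add: mult_left_le_one_le)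
  also have "norm y < r" using z assms by auto
  finally show "z \<in> ball 0 r" by simp
qed

lemma closed_segment_subset_radial_hull: "x \<in> cball q e \<Longrightarrow> closed_segment 0 x \<subseteq> radial_hull q e"
  by (force simp: closed_segment_def radial_hull_def)

section \<open>Void events and the visibility region as a random open set\<close>

locale hyperplane_process = prob_space M
  for M :: "'w measure" +
  fixes \<gamma> lam :: real and \<eta> :: "'w \<Rightarrow> 'a::euclidean_space set set" and d :: nat
  assumes d_eq: "d = DIM('a)" and dim: "d \<ge> 2" and gamma: "0 < \<gamma>" and lam: "0 \<le> lam" "lam \<le> 1"
    and process: "poisson_hyperplane_process M \<gamma> lam \<eta>"
begin

definition params :: "'w \<Rightarrow> (real \<times> 'a) set" where
  "params \<omega> = {(s, u). 0 < s \<and> norm u = 1 \<and> lambda_hyperplane lam s u \<in> \<eta> \<omega>}"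

definition void :: "(real \<times> 'a) set \<Rightarrow> 'w set" where
  "void A = {\<omega> \<in> space M. params \<omega> \<inter> A = {}}"

definition vis :: "'w \<Rightarrow> 'a set" where
  "vis \<omega> = visibility_region (\<eta> \<omega>)"

abbreviation \<kappa> :: real where "\<kappa> \<equiv> cap_const d"

lemma kappa_pos: "\<kappa> > 0"
  using dim by (intro cap_const_pos) simp

lemma void_num_points:
  assumes A: "A \<in> sets (hyp_par lam)" and w: "\<omega> \<in> space M"
  shows "\<omega> \<in> void A \<longleftrightarrow> num_points (\<eta> \<omega> \<inter> (\<lambda>(s, u). lambda_hyperplane lam s u) ` A) = 0"
proof -
  have "A \<subseteq> {0<..} \<times> sphere 0 1" using sets.sets_into_space[OF A] by (simp add: space_hyp_par)
  then have "(a, b) \<in> params \<omega> \<longleftrightarrow> lambda_hyperplane lam a b \<in> \<eta> \<omega>" if "(a, b) \<in> A" for a b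
    using that by (auto simp: params_def)
  then have "params \<omega> \<inter> A = {} \<longleftrightarrow> \<eta> \<omega> \<inter> (\<lambda>(s, u). lambda_hyperplane lam s u) ` A = {}"
    by fastforce
  then show ?thesis using w by (simp add: num_points_eq_0_iff void_def)
qed

text \<open>The void event is the event of Poisson count 0 in the image set, whose intensity is
  \<gamma> times the measure of \<open>A\<close> by injectivity of the parametrisation.\<close>

lemma
  assumes A: "A \<in> sets (hyp_par lam)"
  shows void_event: "void A \<in> events"
    and prob_void: "emeasure (hyp_par lam) A < \<infinity> \<Longrightarrow> prob (void A) = exp (- \<gamma> * measure (hyp_par lam) A)"
proof -
  let ?f = "\<lambda>(s, u::'a). lambda_hyperplane lam s u"
  let ?L = "scale_measure (ennreal \<gamma>) (hyperplane_measure lam :: 'a set measure)"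
  have fA: "?f ` A \<in> sets ?L"
    using A by (simp add: hyperplane_measure_eq in_sets_embed_measure)
  have inj: "inj_on ?f (space (hyp_par lam))"
    using inj_on_lambda_hyperplane[OF lam(1)] by (simp add: space_hyp_par)
  have em: "emeasure ?L (?f ` A) = ennreal \<gamma> * emeasure (hyp_par lam) A"
    using A by (simp add: hyperplane_measure_eq emeasure_embed_measure_image'[OF inj])
  have eq: "void A = {\<omega> \<in> space M. num_points (\<eta> \<omega> \<inter> ?f ` A) = of_nat 0}"
    using void_num_points[OF A] by (auto simp: void_def)
  have pp: "poisson_process M ?L \<eta>" using process by (simp add: poisson_hyperplane_process_def)
  have m: "(\<lambda>\<omega>. num_points (\<eta> \<omega> \<inter> ?f ` A)) \<in> borel_measurable M"
    using pp fA unfolding poisson_process_def by blast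
  then show "void A \<in> events" unfolding eq by measurable
  assume fin: "emeasure (hyp_par lam) A < \<infinity>"
  then have "emeasure ?L (?f ` A) < \<infinity>" unfolding em by (simp add: ennreal_mult_less_top)
  then have "prob {\<omega> \<in> space M. num_points (\<eta> \<omega> \<inter> ?f ` A) = of_nat 0} =
      measure ?L (?f ` A) ^ 0 / fact 0 * exp (- measure ?L (?f ` A))"
    using pp fA unfolding poisson_process_def by blast
  also have "measure ?L (?f ` A) = \<gamma> * measure (hyp_par lam) A"
    unfolding measure_def em using gamma by (simp add: enn2real_mult)
  finally show "prob (void A) = exp (- \<gamma> * measure (hyp_par lam) A)" by (simp add: eq)
qed

lemma eta_image:
  assumes "\<omega> \<in> space M" "H \<in> \<eta> \<omega>"
  obtains s u where "(s, u) \<in> params \<omega>" "H = lambda_hyperplane lam s u"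
proof -
  have "\<eta> \<omega> \<subseteq> space (scale_measure (ennreal \<gamma>) (hyperplane_measure lam :: 'a set measure))"
    using process assms(1) unfolding poisson_hyperplane_process_def poisson_process_def by blast
  then have "H \<in> (\<lambda>(s, u). lambda_hyperplane lam s u) ` ({0<..} \<times> sphere 0 1)"
    using assms(2) by (auto simp: hyperplane_measure_eq space_embed_measure space_hyp_par space_scale_measure)
  then show ?thesis using that assms(2) by (auto simp: params_def)
qed

lemma void_hyp_meets: "\<omega> \<in> void (hyp_meets lam K) \<longleftrightarrow> \<omega> \<in> space M \<and> (\<forall>H\<in>\<eta> \<omega>. K \<inter> H = {})"
proof (cases "\<omega> \<in> space M")
  case True
  show ?thesis
  proof
    assume *: "\<omega> \<in> void (hyp_meets lam K)"
    show "\<omega> \<in> space M \<and> (\<forall>H\<in>\<eta> \<omega>. K \<inter> H = {})"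
    proof (intro conjI ballI True)
      fix H assume "H \<in> \<eta> \<omega>"
      then obtain s u where "(s, u) \<in> params \<omega>" "H = lambda_hyperplane lam s u" using eta_image True by blast
      then show "K \<inter> H = {}" using * by (auto simp: void_def hyp_meets_def params_def)
    qed
  next
    assume "\<omega> \<in> space M \<and> (\<forall>H\<in>\<eta> \<omega>. K \<inter> H = {})"
    then show "\<omega> \<in> void (hyp_meets lam K)" by (fastforce simp: void_def hyp_meets_def params_def)
  qed
qed (simp add: void_def)

lemma vis_iff: "\<omega> \<in> space M \<Longrightarrow> x \<in> vis \<omega> \<longleftrightarrow> norm x < 1 \<and> \<omega> \<in> void (hyp_meets lam (closed_segment 0 x))"
  by (simp add: vis_def visibility_region_def void_hyp_meets)

lemma vis_ray_iff:
  assumes "\<omega> \<in> space M" "norm v = 1" "0 \<le> \<tau>"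
  shows "tanh (\<tau>/2) *\<^sub>R v \<in> vis \<omega> \<longleftrightarrow> \<omega> \<in> void (ray_hits lam \<tau> v)"
  using assms by (simp add: vis_iff ray_hits_eq_hyp_meets[OF assms(2) lam(1) assms(3)] tanh_real_lt_1)

lemma prob_void_ray_hits:
  assumes "norm v = 1" "0 \<le> \<tau>"
  shows "prob (void (ray_hits lam \<tau> v)) = exp (- \<gamma> * \<kappa> * \<tau>)"
proof -
  have "emeasure (hyp_par lam) (ray_hits lam \<tau> v) = ennreal (\<kappa> * \<tau>)"
    unfolding d_eq using assms dim by (intro emeasure_ray_hits lam) (simp_all add: d_eq)
  moreover from this have "measure (hyp_par lam) (ray_hits lam \<tau> v) = \<kappa> * \<tau>"
    using kappa_pos assms by (simp add: measure_def)
  ultimately show ?thesis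
    using assms by (subst prob_void) (auto intro!: sets_ray_hits lam)
qed

lemma vis_subset: "vis \<omega> \<subseteq> ball 0 1"
  by (auto simp: vis_def visibility_region_def)

lemma vis_star:
  assumes "x \<in> vis \<omega>" "0 \<le> t" "t \<le> 1"
  shows "t *\<^sub>R x \<in> vis \<omega>"
proof -
  have "closed_segment 0 (t *\<^sub>R x) \<subseteq> closed_segment 0 x"
  proof (rule closed_segment_subset)
    show "0 \<in> closed_segment 0 x" "convex (closed_segment 0 x)" by auto
    show "t *\<^sub>R x \<in> closed_segment 0 x" using assms by (auto simp: closed_segment_def)
  qed
  moreover have "norm (t *\<^sub>R x) \<le> norm x" using assms by (simp add: mult_left_le_one_le)
  ultimately show ?thesis using assms by (fastforce simp: vis_def visibility_region_def)
qed

definition dense_set :: "'a set" where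
  "dense_set = (SOME D. countable D \<and> (\<forall>X. open X \<longrightarrow> X \<noteq> {} \<longrightarrow> (\<exists>d\<in>D. d \<in> X)))"

lemma dense_set: "countable dense_set" "open X \<Longrightarrow> X \<noteq> {} \<Longrightarrow> \<exists>d\<in>dense_set. d \<in> X"
proof -
  have "\<exists>D::'a set. countable D \<and> (\<forall>X. open X \<longrightarrow> X \<noteq> {} \<longrightarrow> (\<exists>d\<in>D. d \<in> X))"
    using countable_dense_exists by blast
  from someI_ex[OF this] show "countable dense_set" "open X \<Longrightarrow> X \<noteq> {} \<Longrightarrow> \<exists>d\<in>dense_set. d \<in> X"
    unfolding dense_set_def by blast+
qed

definition test_balls :: "('a \<times> real) set" where
  "test_balls = {(q, e). q \<in> dense_set \<and> e \<in> \<rat> \<and> 0 < e \<and> cball q e \<subseteq> ball 0 1}"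

lemma countable_test_balls: "countable test_balls"
  by (rule countable_subset[OF _ countable_SIGMA[of dense_set "\<lambda>_. \<rat>"]])
    (auto simp: test_balls_def dense_set countable_rat)

text \<open>Local finiteness makes the visibility region a countable union of balls, each present on a
  void event; all measurability statements follow from this representation.\<close>

lemma vis_eq_union:
  assumes w: "\<omega> \<in> space M"
  shows "vis \<omega> = (\<Union>(q, e)\<in>{(q, e) \<in> test_balls. \<omega> \<in> void (hyp_meets lam (radial_hull q e))}. ball q e)"
proof (intro set_eqI iffI)
  fix x assume "x \<in> (\<Union>(q, e)\<in>{(q, e) \<in> test_balls. \<omega> \<in> void (hyp_meets lam (radial_hull q e))}. ball q e)"
  then obtain q e where qe: "(q, e) \<in> test_balls" "\<omega> \<in> void (hyp_meets lam (radial_hull q e))" "x \<in> ball q e" by auto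
  then have x: "x \<in> cball q e" "cball q e \<subseteq> ball 0 1" by (auto simp: test_balls_def)
  then have nx: "norm x < 1" by fastforce
  then have "hyp_meets lam (closed_segment 0 x) \<subseteq> hyp_meets lam (radial_hull q e)"
    using closed_segment_subset_radial_hull[OF x(1)] by (auto simp: hyp_meets_def)
  then show "x \<in> vis \<omega>" using qe nx vis_iff[OF w] by (auto simp: void_def)
next
  fix x assume x: "x \<in> vis \<omega>"
  then have nx: "norm x < 1" and vx: "\<And>H. H \<in> \<eta> \<omega> \<Longrightarrow> closed_segment 0 x \<inter> H = {}"
    by (auto simp: vis_def visibility_region_def)
  \<comment> \<open>Local finiteness speaks of compact sets only, so the hyperplanes are cut off at
    a radius \<open>r < 1\<close>. The part \<open>T\<close> inside is a finite union of closed
    sets, at positive distance \<delta> from the segment.\<close>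
  obtain r where r: "norm x < r" "r < 1" using nx dense by blast
  have fin: "finite {H \<in> \<eta> \<omega>. H \<inter> cball 0 r \<noteq> {}}" (is "finite ?F")
    using process w r unfolding poisson_hyperplane_process_def by (auto simp: subset_eq)
  have cl: "closed (H \<inter> cball 0 r)" if "H \<in> ?F" for H
  proof -
    from that
    obtain s u where H: "H = lambda_hyperplane lam s u" using eta_image w by blast
    define c R where "c = (tanh (s/2) + (1 - (tanh (s/2))\<^sup>2) / (2 * (lam + tanh (s/2)))) *\<^sub>R u"
      and "R = (1 - (tanh (s/2))\<^sup>2) / (2 * (lam + tanh (s/2)))"
    have "H \<inter> cball 0 r = {x. norm (x - c) = R} \<inter> cball 0 r"
      using r by (auto simp: H lambda_hyperplane_def Let_def c_def R_def)
    also have "closed \<dots>" by (intro closed_Int closed_Collect_eq continuous_intros closed_cball)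
    finally show ?thesis .
  qed
  define T where "T = (\<Union>H\<in>?F. H \<inter> cball 0 r)"
  have clT: "closed T" unfolding T_def using fin cl by (intro closed_UN) auto
  have "closed_segment 0 x \<inter> T = {}" using vx by (auto simp: T_def)
  from separate_compact_closed[OF compact_segment clT this]
  obtain \<delta> where \<delta>: "\<delta> > 0" "\<And>y z. y \<in> closed_segment 0 x \<Longrightarrow> z \<in> T \<Longrightarrow> \<delta> \<le> dist y z" by auto
  \<comment> \<open>The bound \<delta> / 2 keeps the hull of the ball away from \<open>T\<close>;
    the other bound keeps the ball inside radius \<open>r\<close>, beyond which nothing is known of
    the hyperplanes.\<close>
  obtain e where e: "e \<in> \<rat>" "0 < e" "e < min (\<delta> / 2) ((r - norm x) / 2)"
    using Rats_dense_in_real[of 0 "min (\<delta> / 2) ((r - norm x) / 2)"] \<delta> r by auto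
  obtain q where q: "q \<in> dense_set" "q \<in> ball x e" using dense_set(2)[of "ball x e"] e by auto
  have near: "dist y x < 2 * e" if "y \<in> cball q e" for y
    using that q(2) dist_triangle[of y x q] by (simp add: dist_commute)
  have sub: "cball q e \<subseteq> ball 0 r"
  proof
    fix y assume "y \<in> cball q e"
    then have "norm (y - x) < r - norm x" using near[of y] e by (simp add: dist_norm)
    then show "y \<in> ball 0 r" using norm_triangle_sub[of y x] by simp
  qed
  have "\<omega> \<in> void (hyp_meets lam (radial_hull q e))"
    unfolding void_hyp_meets
  proof (intro conjI w ballI)
    fix H assume H: "H \<in> \<eta> \<omega>"
    show "radial_hull q e \<inter> H = {}"
    proof (rule ccontr)
      assume "radial_hull q e \<inter> H \<noteq> {}"
      then obtain z where z: "z \<in> radial_hull q e" "z \<in> H" by blast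
      then obtain t y where ty: "z = t *\<^sub>R y" "0 \<le> t" "t \<le> 1" "y \<in> cball q e" by (auto simp: radial_hull_def)
      have "z \<in> cball 0 r" using radial_hull_subset_ball[OF sub] z by fastforce
      then have "z \<in> T" unfolding T_def using z H by (intro UN_I[of H]) blast+
      moreover have "t *\<^sub>R x \<in> closed_segment 0 x" using ty by (auto simp: closed_segment_def)
      ultimately have "\<delta> \<le> dist (t *\<^sub>R x) z" using \<delta> by blast
      also have "\<dots> = t * dist x y" using ty by (simp add: dist_norm scaleR_diff_right[symmetric])
      also have "\<dots> \<le> dist x y" using ty by (simp add: mult_left_le_one_le)
      also have "\<dots> < \<delta>" using near[OF ty(4)] e by (simp add: dist_commute)
      finally show False by simp
    qed
  qed
  moreover have "(q, e) \<in> test_balls" using sub q e r by (auto simp: test_balls_def)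
  moreover have "x \<in> ball q e" using q by (simp add: dist_commute)
  ultimately show "x \<in> (\<Union>(q, e)\<in>{(q, e) \<in> test_balls. \<omega> \<in> void (hyp_meets lam (radial_hull q e))}. ball q e)" by auto
qed

lemma open_vis: "\<omega> \<in> space M \<Longrightarrow> open (vis \<omega>)"
  by (subst vis_eq_union) auto

lemma void_radial_hull_event: "(q, e) \<in> test_balls \<Longrightarrow> void (hyp_meets lam (radial_hull q e)) \<in> events"
  by (intro void_event sets_hyp_meets lam compact_radial_hull radial_hull_subset_ball) (auto simp: test_balls_def)

lemma void_segment_event: "norm x < 1 \<Longrightarrow> void (hyp_meets lam (closed_segment 0 x)) \<in> events"
  by (intro void_event sets_hyp_meets lam compact_segment segment_subset_ball)

text \<open>A countable union of rectangles. Joint measurability makes Fubini's theorem available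
  for the volume and for averages over directions.\<close>

lemma vis_joint_sets: "{p \<in> space (M \<Otimes>\<^sub>M borel). snd p \<in> vis (fst p)} \<in> sets (M \<Otimes>\<^sub>M (borel :: 'a measure))"
proof -
  have "{p \<in> space (M \<Otimes>\<^sub>M borel). snd p \<in> vis (fst p)} =
      (\<Union>p\<in>test_balls. void (hyp_meets lam (radial_hull (fst p) (snd p))) \<times> ball (fst p) (snd p))" (is "?L = ?R")
  proof (intro set_eqI iffI)
    fix x assume "x \<in> ?L"
    then have "fst x \<in> space M" "snd x \<in> vis (fst x)" by (auto simp: space_pair_measure)
    then obtain q e where "(q, e) \<in> test_balls" "fst x \<in> void (hyp_meets lam (radial_hull q e))" "snd x \<in> ball q e"
      using vis_eq_union[of "fst x"] by auto
    then show "x \<in> ?R" by (intro UN_I[of "(q, e)"]) (auto simp: mem_Times_iff)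
  next
    fix x assume "x \<in> ?R"
    then obtain q e where *: "(q, e) \<in> test_balls" "fst x \<in> void (hyp_meets lam (radial_hull q e))" "snd x \<in> ball q e" by auto
    then have "fst x \<in> space M" by (simp add: void_def)
    moreover from this have "snd x \<in> vis (fst x)"
      unfolding vis_eq_union[OF \<open>fst x \<in> space M\<close>] using * by (intro UN_I[of "(q, e)"]) auto
    ultimately show "x \<in> ?L" by (auto simp: space_pair_measure mem_Times_iff)
  qed
  also have "\<dots> \<in> sets (M \<Otimes>\<^sub>M borel)"
    using void_radial_hull_event by (intro sets.countable_UN'' countable_test_balls pair_measureI) auto
  finally show ?thesis .
qed

text \<open>An open set that leaves a closed ball does so at a point of the countable dense set, so
  countably many segment events decide boundedness.\<close>

lemma bounded_event: "{\<omega> \<in> space M. hyp_bounded (vis \<omega>)} \<in> events"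
proof -
  have sub: "{\<omega> \<in> space M. vis \<omega> \<subseteq> cball 0 (tanh (real n / 2))} =
     space M - (\<Union>q\<in>{q \<in> dense_set. norm q < 1 \<and> tanh (real n / 2) < norm q}. void (hyp_meets lam (closed_segment 0 q)))" for n
  proof (intro set_eqI iffI)
    fix \<omega> assume "\<omega> \<in> {\<omega> \<in> space M. vis \<omega> \<subseteq> cball 0 (tanh (real n / 2))}"
    then show "\<omega> \<in> space M - (\<Union>q\<in>{q \<in> dense_set. norm q < 1 \<and> tanh (real n / 2) < norm q}. void (hyp_meets lam (closed_segment 0 q)))"
      using vis_iff[of \<omega>] by force
  next
    fix \<omega> assume *: "\<omega> \<in> space M - (\<Union>q\<in>{q \<in> dense_set. norm q < 1 \<and> tanh (real n / 2) < norm q}. void (hyp_meets lam (closed_segment 0 q)))"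
    have "vis \<omega> - cball 0 (tanh (real n / 2)) = {}"
    proof (rule ccontr)
      assume "vis \<omega> - cball 0 (tanh (real n / 2)) \<noteq> {}"
      moreover have "open (vis \<omega> - cball 0 (tanh (real n / 2)))" using * by (intro open_Diff open_vis) auto
      ultimately obtain q where "q \<in> dense_set" "q \<in> vis \<omega> - cball 0 (tanh (real n / 2))" using dense_set(2) by blast
      then show False using * vis_iff[of \<omega> q] by auto
    qed
    then show "\<omega> \<in> {\<omega> \<in> space M. vis \<omega> \<subseteq> cball 0 (tanh (real n / 2))}" using * by auto
  qed
  have ev: "{\<omega> \<in> space M. vis \<omega> \<subseteq> cball 0 (tanh (real n / 2))} \<in> events" for n
    unfolding sub by (intro sets.Diff sets.top sets.countable_UN'' countable_Collect dense_set void_segment_event) auto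
  have "{\<omega> \<in> space M. hyp_bounded (vis \<omega>)} = (\<Union>n. {\<omega> \<in> space M. vis \<omega> \<subseteq> cball 0 (tanh (real n / 2))})"
    using hyp_bounded_iff[OF vis_subset] by auto
  also have "\<dots> \<in> events" using ev by (intro sets.countable_UN) auto
  finally show ?thesis .
qed

end

section \<open>Expected volume\<close>

text \<open>In the variable \<open>z = exp (-2 \<tau>)\<close>, with \<open>\<tau>\<close> the hyperbolic distance to the origin, the expected
  volume becomes a Beta integral.\<close>

definition dist_var :: "'a::euclidean_space \<Rightarrow> real" where
  "dist_var y = ((1 - norm y) / (1 + norm y))\<^sup>2"

text \<open>Minus the derivative of \<open>unit_ball_vol (real d) * r ^ d\<close>, where
  \<open>r = (1 - sqrt z) / (1 + sqrt z)\<close> is the radius at which \<open>dist_var\<close>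
  takes the value \<open>z\<close>.\<close>

definition dist_var_density :: "nat \<Rightarrow> real \<Rightarrow> real" where
  "dist_var_density d z = unit_ball_vol (real d) * real d * ((1 - sqrt z) / (1 + sqrt z)) ^ (d - 1) / ((1 + sqrt z)\<^sup>2 * sqrt z)"

lemma dist_var_gt_iff:
  fixes y :: "'a::euclidean_space"
  assumes "norm y < 1" "0 \<le> x" 
  shows "x < dist_var y \<longleftrightarrow> norm y < (1 - sqrt x) / (1 + sqrt x)"
proof -
  have p: "1 + norm y > 0" by (simp add: add_pos_nonneg)
  have q: "1 + sqrt x > 0" using assms by (simp add: add_pos_nonneg)
  have "x < dist_var y \<longleftrightarrow> sqrt x < (1 - norm y) / (1 + norm y)"
    using assms p unfolding dist_var_def
    by (metis (no_types, lifting) diff_gt_0_iff_gt divide_pos_pos less_imp_le real_sqrt_less_iff real_sqrt_unique)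
  also have "\<dots> \<longleftrightarrow> sqrt x * (1 + norm y) < 1 - norm y" using p by (rule pos_less_divide_eq)
  also have "\<dots> \<longleftrightarrow> norm y * (1 + sqrt x) < 1 - sqrt x" by (simp add: algebra_simps)
  also have "\<dots> \<longleftrightarrow> norm y < (1 - sqrt x) / (1 + sqrt x)" using q by (rule pos_less_divide_eq[symmetric])
  finally show ?thesis .
qed

text \<open>Two finite measures on the line are compared on upper rays, whose preimages are balls
  about the origin. The term \<open>max x 0\<close> and the case \<open>x \<ge> 1\<close> treat rays
  that start outside the unit interval.\<close>

lemma distr_dist_var:
  assumes d: "d = DIM('a::euclidean_space)"
  shows "distr (restrict_space lborel (ball (0::'a) 1)) borel dist_var
    = density lborel (\<lambda>z. indicator {0<..<1} z * ennreal (dist_var_density d z))" (is "?L = ?R")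
proof -
  let ?V = "unit_ball_vol (real d)"
  have d1: "d \<ge> 1" unfolding d using DIM_positive by (simp add: Suc_leI)
  have [measurable]: "(dist_var :: 'a \<Rightarrow> real) \<in> borel_measurable borel"
    unfolding dist_var_def[abs_def] by measurable
  have m: "(dist_var :: 'a \<Rightarrow> real) \<in> measurable (restrict_space lborel (ball (0::'a) 1)) borel"
    by (intro measurable_restrict_space1) simp
  have [measurable]: "dist_var_density d \<in> borel_measurable borel"
    unfolding dist_var_density_def[abs_def] by measurable
  let ?r = "\<lambda>x::real. (1 - sqrt x) / (1 + sqrt x)"
  have L: "emeasure ?L {x<..} = ennreal (if x \<ge> 1 then 0 else ?V * ?r (max x 0) ^ d)" for x
  proof -
    have "emeasure ?L {x<..} = emeasure (restrict_space lborel (ball (0::'a) 1)) (dist_var -` {x<..} \<inter> ball 0 1)"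
      by (subst emeasure_distr[OF m]) (auto simp: space_restrict_space)
    also have "\<dots> = emeasure lborel (dist_var -` {x<..} \<inter> ball (0::'a) 1)"
      by (subst emeasure_restrict_space) auto
    also have "dist_var -` {x<..} \<inter> ball (0::'a) 1 = (if x \<ge> 1 then {} else ball 0 (?r (max x 0)))"
    proof -
      have pos: "dist_var y > 0" if "norm y < 1" for y :: 'a
        using that norm_ge_zero[of y] unfolding dist_var_def by (intro zero_less_power divide_pos_pos) linarith+
      have le1: "dist_var y \<le> 1" if "norm y < 1" for y :: 'a
        using that by (auto simp: dist_var_def add_pos_nonneg intro!: power_le_one divide_le_eq_1_pos[THEN iffD2] divide_nonneg_nonneg)
      have "y \<in> dist_var -` {x<..} \<inter> ball 0 1 \<longleftrightarrow> norm y < ?r (max x 0)" if "x < 1" for y :: 'a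
      proof -
        have s: "0 \<le> sqrt (max x 0)" "sqrt (max x 0) < 1" using that by auto
        have r1: "?r (max x 0) \<le> 1" using s by (simp add: divide_le_eq_1 add_pos_nonneg)
        have "x < dist_var y \<longleftrightarrow> max x 0 < dist_var y" if "norm y < 1" using pos[OF that] by auto
        then show ?thesis using dist_var_gt_iff[of y "max x 0"] r1 by auto
      qed
      note key = this
      show ?thesis
      proof (cases "x \<ge> 1")
        case True
        then have "y \<notin> dist_var -` {x<..} \<inter> ball 0 1" for y :: 'a using le1[of y] by auto
        then show ?thesis using True by auto
      next
        case False
        then have "dist_var -` {x<..} \<inter> ball (0::'a) 1 = ball 0 (?r (max x 0))"
          by (intro set_eqI) (simp only: key mem_ball_0 not_le)
        then show ?thesis using False by simp
      qed
    qed
    also have "emeasure lborel \<dots> = ennreal (if x \<ge> 1 then 0 else ?V * ?r (max x 0) ^ d)"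
    proof (cases "x \<ge> 1")
      case False
      then have "sqrt (max x 0) \<le> 1" by auto
      then have "?r (max x 0) \<ge> 0" by (intro divide_nonneg_nonneg) auto
      then show ?thesis using False by (simp add: emeasure_ball d)
    qed simp
    finally show ?thesis .
  qed
  have R: "emeasure ?R {x<..} = ennreal (if x \<ge> 1 then 0 else ?V * ?r (max x 0) ^ d)" for x
  proof (cases "x \<ge> 1")
    case True
    have "emeasure ?R {x<..} = (\<integral>\<^sup>+z. indicator {0<..<1} z * ennreal (dist_var_density d z) * indicator {x<..} z \<partial>lborel)"
      by (rule emeasure_density) auto
    also have "\<dots> = (\<integral>\<^sup>+z. 0 \<partial>(lborel :: real measure))" using True by (intro nn_integral_cong) (auto simp: indicator_def)
    finally show ?thesis using True by simp
  next
    case False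
    define a where "a = max x 0"
    have a: "0 \<le> a" "a < 1" using False by (auto simp: a_def)
    have "emeasure ?R {x<..} = (\<integral>\<^sup>+z. indicator {0<..<1} z * ennreal (dist_var_density d z) * indicator {x<..} z \<partial>lborel)"
      by (rule emeasure_density) auto
    also have "\<dots> = (\<integral>\<^sup>+z. indicator {a<..<1} z * ennreal (dist_var_density d z) \<partial>lborel)"
      by (intro nn_integral_cong) (auto simp: indicator_def a_def)
    also have "\<dots> = ennreal (- (?V * ?r 1 ^ d) - - (?V * ?r a ^ d))"
    proof (rule nn_integral_FTC_Ioo)
      show "continuous_on {a..1} (\<lambda>z. - (?V * ?r z ^ d))"
        using a by (intro continuous_intros) (smt (verit) atLeastAtMost_iff real_sqrt_ge_zero)
      fix z assume z: "a < z" "z < 1"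
      define w where "w = sqrt z"
      have w: "0 < w" "w < 1" using z a by (simp_all add: w_def)
      have "(sqrt has_real_derivative inverse w / 2) (at z)"
        using z a by (auto intro!: derivative_eq_intros simp: w_def)
      then have "(?r has_real_derivative ((0 - inverse w / 2) * (1 + w) - (1 - w) * (0 + inverse w / 2)) / ((1 + w) * (1 + w))) (at z)"
        unfolding w_def
      proof (intro DERIV_divide DERIV_diff DERIV_add DERIV_const)
        show "1 + sqrt z \<noteq> 0" using w(1) unfolding w_def by linarith
      qed (use \<open>(sqrt has_real_derivative inverse w / 2) (at z)\<close> in \<open>simp_all add: w_def\<close>)
      also have "((0 - inverse w / 2) * (1 + w) - (1 - w) * (0 + inverse w / 2)) / ((1 + w) * (1 + w)) = - (1 / ((1 + w)\<^sup>2 * w))"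
        using w by (simp add: power2_eq_square divide_simps)
      finally have "(?r has_real_derivative - (1 / ((1 + w)\<^sup>2 * w))) (at z)" .
      from DERIV_minus[OF DERIV_cmult[OF DERIV_power[OF this, of d], of ?V]]
      show "((\<lambda>z. - (?V * ?r z ^ d)) has_real_derivative dist_var_density d z) (at z)"
        by (simp add: dist_var_density_def w_def mult_ac)
      show "0 \<le> dist_var_density d z"
        using w by (simp add: dist_var_density_def w_def[symmetric])
    qed (use a in auto)
    finally show ?thesis using False d1 by (simp add: a_def)
  qed
  show ?thesis
  proof (rule measure_eqI_lessThan)
    show "emeasure ?L {x<..} < \<infinity>" for x unfolding L by simp
    show "emeasure ?L {x<..} = emeasure ?R {x<..}" for x unfolding L R ..
  qed auto
qed

text \<open>With \<open>w = sqrt z\<close> the metric factor is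
  \<open>(1 + w)\<^sup>2 / (2 * w)\<close>. Its powers of \<open>1 + w\<close> combine with those of
  the density to leave a power of \<open>1 - z\<close> and one of \<open>w\<close>. The exponent of
  \<open>z\<close> is -1 exactly at \<open>c = real d - 1\<close>, where integrability is
  lost.\<close>

lemma hyp_volume_integrand:
  assumes "d \<ge> 1" and z: "0 < z" "z < 1"
  defines "r \<equiv> (1 - sqrt z) / (1 + sqrt z)"
  shows "dist_var_density d z * ((2 / (1 - r\<^sup>2)) ^ d * z powr (c / 2))
    = unit_ball_vol (real d) * real d / 2 ^ d * (z powr ((c - real d + 1) / 2 - 1) * (1 - z) powr (real d - 1))"
proof -
  define w where "w = sqrt z"
  have w: "0 < w" "w < 1" "z = w * w" using z by (simp_all add: w_def)
  define n where "n = d - 1"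
  have dn: "d = Suc n" using assms by (simp add: n_def)
  have "1 - r\<^sup>2 = 4 * w / (1 + w)\<^sup>2"
  proof -
    have "1 - r\<^sup>2 = ((1 + w)\<^sup>2 - (1 - w)\<^sup>2) / (1 + w)\<^sup>2"
    proof -
      have "r\<^sup>2 = (1 - w)\<^sup>2 / (1 + w)\<^sup>2" by (simp only: r_def w_def[symmetric] power_divide)
      then show ?thesis using w by (simp add: diff_divide_distrib)
    qed
    also have "(1 + w)\<^sup>2 - (1 - w)\<^sup>2 = 4 * w" by (simp add: power2_eq_square algebra_simps)
    finally show ?thesis .
  qed
  then have "2 / (1 - r\<^sup>2) = (1 + w)\<^sup>2 / (2 * w)" using w by simp
  then have "dist_var_density d z * (2 / (1 - r\<^sup>2)) ^ d
      = unit_ball_vol (real d) * real d * (((1 - w) / (1 + w)) ^ n / ((1 + w)\<^sup>2 * w) * ((1 + w)\<^sup>2 / (2 * w)) ^ d)"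
    by (simp add: dist_var_density_def w_def[symmetric] n_def)
  also have "((1 - w) / (1 + w)) ^ n / ((1 + w)\<^sup>2 * w) * ((1 + w)\<^sup>2 / (2 * w)) ^ d
      = ((1 - w) * (1 + w)) ^ n / (2 ^ d * w ^ (d + 1))"
  proof -
    define p where "p = 1 + w"
    have p: "p > 0" using w by (simp add: p_def)
    have "((1 - w) / p) ^ n / (p\<^sup>2 * w) * (p\<^sup>2 / (2 * w)) ^ d = ((1 - w) * p) ^ n / (2 ^ d * w ^ (d + 1))"
      using p w unfolding dn by (simp add: power_divide power_mult_distrib power2_eq_square)
    then show ?thesis by (simp only: p_def)
  qed
  also have "(1 - w) * (1 + w) = 1 - z" using w by (simp add: algebra_simps)
  also have "(1 - z) ^ n = (1 - z) powr (real d - 1)" using z by (simp add: powr_realpow dn)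
  finally have 1: "dist_var_density d z * (2 / (1 - r\<^sup>2)) ^ d
    = unit_ball_vol (real d) * real d / 2 ^ d * (1 - z) powr (real d - 1) / w ^ (d + 1)" by simp
  have "w ^ (d + 1) = z powr ((real d + 1) / 2)"
  proof -
    have "w ^ (d + 1) = w powr (real d + 1)"
      using powr_realpow[OF w(1), of "d + 1"] by (simp only: of_nat_add of_nat_1)
    also have "\<dots> = (z powr (1/2)) powr (real d + 1)" using z by (simp add: w_def powr_half_sqrt)
    finally show ?thesis by (simp add: powr_powr)
  qed
  then have 2: "z powr (c / 2) / w ^ (d + 1) = z powr ((c - real d + 1) / 2 - 1)"
    by (simp add: powr_diff[symmetric] field_simps)
  show ?thesis using 1 unfolding 2[symmetric] by (simp add: mult.assoc[symmetric])
qed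

section \<open>Beta integrals and Gamma identities\<close>

lemma nn_integral_Beta:
  assumes "0 < a" "0 < b"
  shows "(\<integral>\<^sup>+z. indicator {0<..<1} z * ennreal (z powr (a - 1) * (1 - z) powr (b - 1)) \<partial>lborel) = ennreal (Beta a b)"
proof -
  have "((\<lambda>t. t powr (a - 1) * (1 - t) powr (b - 1)) has_integral Beta a b) {0<..<1}"
    using has_integral_Beta_real[OF assms] by (simp add: has_integral_Icc_iff_Ioo)
  then have "((\<lambda>t. if t \<in> {0<..<1} then t powr (a - 1) * (1 - t) powr (b - 1) else 0) has_integral Beta a b) UNIV"
    by (subst has_integral_restrict_UNIV)
  then have "(\<integral>\<^sup>+t. ennreal (if t \<in> {0<..<1} then t powr (a - 1) * (1 - t) powr (b - 1) else 0) \<partial>lborel) = ennreal (Beta a b)"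
    by (intro nn_integral_has_integral_lborel) auto
  also have "(\<integral>\<^sup>+t. ennreal (if t \<in> {0<..<1} then t powr (a - 1) * (1 - t) powr (b - 1) else 0) \<partial>lborel)
    = (\<integral>\<^sup>+z. indicator {0<..<1} z * ennreal (z powr (a - 1) * (1 - z) powr (b - 1)) \<partial>lborel)"
    by (intro nn_integral_cong) auto
  finally show ?thesis .
qed

text \<open>Near 0 the integrand dominates a multiple of 1 / z. The lower limit
  \<open>exp (- R) / 2\<close> is chosen so that the integral of 1 / z from there to 1/2 is exactly
  \<open>R\<close>.\<close>

lemma nn_integral_Beta_infinite:
  assumes a: "a \<le> 0" and b: "1 \<le> b"
  shows "(\<integral>\<^sup>+z. indicator {0<..<1} z * ennreal (z powr (a - 1) * (1 - z) powr (b - 1)) \<partial>lborel) = \<infinity>" (is "?I = _")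
proof -
  define K where "K = (1/2::real) powr (b - 1)"
  have K: "K > 0" by (simp add: K_def)
  have "ennreal (K * R) \<le> ?I" if R: "R > 0" for R :: real
  proof -
    define e where "e = exp (- R) / 2"
    have e: "0 < e" "e < 1/2" using R by (simp_all add: e_def)
    have lne: "ln e = - R - ln 2" by (simp add: e_def ln_div)
    have "ennreal (K * R) = ennreal (K * ln (1/2) - K * ln e)"
      by (simp add: lne ln_div algebra_simps)
    also have "\<dots> = (\<integral>\<^sup>+z. ennreal (K / z) * indicator {e..1/2} z \<partial>lborel)"
    proof (rule nn_integral_FTC_Icc[symmetric])
      fix z assume "z \<in> {e..1/2}"
      then have "z > 0" using e by simp
      then show "((\<lambda>z. K * ln z) has_real_derivative K / z) (at z)" "0 \<le> K / z"
        using K by (auto intro!: derivative_eq_intros)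
    qed (use e in auto)
    also have "\<dots> \<le> ?I"
    proof (rule nn_integral_mono)
      fix z :: real
      show "ennreal (K / z) * indicator {e..1/2} z \<le> indicator {0<..<1} z * ennreal (z powr (a - 1) * (1 - z) powr (b - 1))"
      proof (cases "z \<in> {e..1/2}")
        case True
        then have z: "0 < z" "z \<le> 1/2" using e by auto
        have "1 / z = z powr (- 1)" using z by (simp add: powr_minus_divide)
        also have "\<dots> \<le> z powr (a - 1)" using z a by (intro powr_mono') auto
        finally have 1: "1 / z \<le> z powr (a - 1)" .
        have "K \<le> (1 - z) powr (b - 1)" unfolding K_def using z b by (intro powr_mono2) auto
        then have "(1 / z) * K \<le> z powr (a - 1) * (1 - z) powr (b - 1)"
          using 1 K by (intro mult_mono) auto
        then show ?thesis using True z by (auto intro!: ennreal_leI simp: mult.commute)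
      qed simp
    qed
    finally show ?thesis .
  qed
  note ge = this
  show ?thesis
  proof (cases ?I)
    case (real r)
    have "ennreal (K * ((\<bar>r\<bar> + 1) / K)) \<le> ennreal r" using ge[of "(\<bar>r\<bar> + 1) / K"] K real by simp
    then have "\<bar>r\<bar> + 1 \<le> r" using K real by simp
    then show ?thesis by simp
  qed simp
qed

lemma Gamma_legendre_duplication_real:
  fixes x :: real
  assumes "x > 0"
  shows "Gamma x * Gamma (x + 1/2) = exp ((1 - 2 * x) * ln 2) * sqrt pi * Gamma (2 * x)"
proof -
  have np: "complex_of_real y \<notin> \<int>\<^sub>\<le>\<^sub>0" if "y > 0" for y
    using that by (auto elim!: nonpos_Ints_cases simp: complex_eq_iff)
  have "Gamma (complex_of_real x) * Gamma (complex_of_real x + 1/2) =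
      exp ((1 - 2 * complex_of_real x) * of_real (ln 2)) * of_real (sqrt pi) * Gamma (2 * complex_of_real x)"
    using np[of x] np[of "x + 1/2"] assms by (intro Gamma_legendre_duplication) auto
  then have "complex_of_real (Gamma x * Gamma (x + 1/2)) =
      complex_of_real (exp ((1 - 2 * x) * ln 2) * sqrt pi * Gamma (2 * x))"
    by (simp add: Gamma_complex_of_real[symmetric] exp_of_real[symmetric])
  then show ?thesis by (simp only: of_real_eq_iff)
qed

lemma exp_artanh:
  fixes r c :: real
  assumes "0 \<le> r" "r < 1"
  shows "exp (- c * (2 * artanh r)) = (((1 - r) / (1 + r))\<^sup>2) powr (c / 2)"
proof -
  have "(((1 - r) / (1 + r))\<^sup>2) powr (c / 2) = exp (c / 2 * ln (((1 - r) / (1 + r))\<^sup>2))"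
    using assms by (auto simp: powr_def)
  also have "ln (((1 - r) / (1 + r))\<^sup>2) = 2 * (ln (1 - r) - ln (1 + r))"
    using assms by (simp add: ln_realpow ln_div)
  finally show ?thesis using assms by (simp add: artanh_def ln_div field_simps)
qed

context hyperplane_process begin

lemma prob_vis:
  assumes x: "norm x < 1" "x \<noteq> 0"
  shows "prob {\<omega> \<in> space M. x \<in> vis \<omega>} = dist_var x powr (\<gamma> * \<kappa> / 2)"
proof -
  define v where "v = sgn x"
  have v: "norm v = 1" using x by (simp add: v_def norm_sgn)
  define \<tau> where "\<tau> = 2 * artanh (norm x)"
  have "tanh (\<tau>/2) = norm x" using x by (simp add: \<tau>_def tanh_artanh_real)
  then have xv: "x = tanh (\<tau>/2) *\<^sub>R v" "0 < tanh (\<tau>/2)" using x by (simp_all add: v_def sgn_div_norm)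
  then have tau: "0 \<le> \<tau>" by simp
  have "{\<omega> \<in> space M. x \<in> vis \<omega>} = void (ray_hits lam \<tau> v)"
    using vis_ray_iff[OF _ v tau] xv by (auto simp: void_def)
  then show ?thesis
    using prob_void_ray_hits[OF v tau] exp_artanh[of "norm x" "\<gamma> * \<kappa>"] x
    by (simp add: \<tau>_def dist_var_def)
qed

lemma expected_volume_Beta_integral:
  "expected_visible_volume M \<eta> = ennreal (unit_ball_vol (real d) * real d / 2 ^ d) *
    (\<integral>\<^sup>+z. indicator {0<..<1} z * ennreal (z powr ((\<gamma> * \<kappa> - real d + 1) / 2 - 1) * (1 - z) powr (real d - 1)) \<partial>lborel)"
proof -
  let ?B = "ball (0::'a) 1"
  define \<rho> where "\<rho> y = ennreal ((2 / (1 - (norm y)\<^sup>2)) ^ d)" for y :: 'a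
  define c where "c = \<gamma> * \<kappa>"
  have [measurable]: "\<rho> \<in> borel_measurable borel" unfolding \<rho>_def[abs_def] by measurable
  have [measurable]: "(dist_var :: 'a \<Rightarrow> real) \<in> borel_measurable borel"
    unfolding dist_var_def[abs_def] by measurable
  interpret P: pair_sigma_finite M "lborel :: 'a measure" ..
  have vol: "emeasure hyp_vol (vis \<omega>) = (\<integral>\<^sup>+y. \<rho> y * indicator (vis \<omega>) y \<partial>lborel)" if "\<omega> \<in> space M" for \<omega>
  proof -
    have [measurable]: "vis \<omega> \<in> sets borel" using open_vis[OF that] by simp
    have s: "vis \<omega> \<in> sets (restrict_space lborel ?B)"
      using vis_subset by (subst sets_restrict_space_iff) auto
    have "emeasure hyp_vol (vis \<omega>) = (\<integral>\<^sup>+y. \<rho> y * indicator (vis \<omega>) y \<partial>restrict_space lborel ?B)"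
      unfolding hyp_vol_def \<rho>_def d_eq by (rule emeasure_density[OF measurable_restrict_space1 s]) measurable
    also have "\<dots> = (\<integral>\<^sup>+y. \<rho> y * indicator (vis \<omega>) y * indicator ?B y \<partial>lborel)"
      by (subst nn_integral_restrict_space) auto
    also have "\<dots> = (\<integral>\<^sup>+y. \<rho> y * indicator (vis \<omega>) y \<partial>lborel)"
      using vis_subset[of \<omega>] by (intro nn_integral_cong) (force simp: indicator_def)
    finally show ?thesis .
  qed
  have "(\<lambda>p. indicator {p \<in> space (M \<Otimes>\<^sub>M borel). snd p \<in> vis (fst p)} p :: ennreal) \<in> borel_measurable (M \<Otimes>\<^sub>M lborel)"
    using vis_joint_sets by simp
  then have ind: "(\<lambda>(\<omega>, y). indicator (vis \<omega>) y :: ennreal) \<in> borel_measurable (M \<Otimes>\<^sub>M lborel)"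
    by (rule measurable_cong[THEN iffD1, rotated]) (auto simp: indicator_def space_pair_measure)
  have meas: "(\<lambda>(\<omega>, y). \<rho> y * indicator (vis \<omega>) y) \<in> borel_measurable (M \<Otimes>\<^sub>M lborel)"
    unfolding split_beta' by (rule borel_measurable_times_ennreal[OF _ ind[unfolded split_beta']]) measurable
  have "expected_visible_volume M \<eta> = (\<integral>\<^sup>+\<omega>. \<integral>\<^sup>+y. \<rho> y * indicator (vis \<omega>) y \<partial>lborel \<partial>M)"
    unfolding expected_visible_volume_def vis_def[symmetric] by (intro nn_integral_cong vol)
  also have "\<dots> = (\<integral>\<^sup>+y. \<integral>\<^sup>+\<omega>. \<rho> y * indicator (vis \<omega>) y \<partial>M \<partial>lborel)"
    by (rule P.Fubini'[symmetric, OF meas])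
  also have "\<dots> = (\<integral>\<^sup>+y. \<rho> y * ennreal (dist_var y powr (c / 2)) * indicator ?B y \<partial>lborel)"
  proof (rule nn_integral_cong_AE)
    have "AE y in lborel. y \<noteq> (0::'a)" by (rule AE_lborel_singleton)
    then show "AE y in lborel. (\<integral>\<^sup>+\<omega>. \<rho> y * indicator (vis \<omega>) y \<partial>M) = \<rho> y * ennreal (dist_var y powr (c / 2)) * indicator ?B y"
    proof eventually_elim
      case (elim y)
      show ?case
      proof (cases "norm y < 1")
        case True
        have eq: "{\<omega> \<in> space M. y \<in> vis \<omega>} = void (hyp_meets lam (closed_segment 0 y))"
          using vis_iff[of _ y] True by (auto simp: void_def)
        have ev: "{\<omega> \<in> space M. y \<in> vis \<omega>} \<in> events" unfolding eq using True by (rule void_segment_event)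
        have "(\<integral>\<^sup>+\<omega>. \<rho> y * indicator (vis \<omega>) y \<partial>M) = (\<integral>\<^sup>+\<omega>. \<rho> y * indicator {\<omega> \<in> space M. y \<in> vis \<omega>} \<omega> \<partial>M)"
          by (intro nn_integral_cong) (auto simp: indicator_def)
        also have "\<dots> = \<rho> y * emeasure M {\<omega> \<in> space M. y \<in> vis \<omega>}" using ev by (rule nn_integral_cmult_indicator)
        also have "\<dots> = \<rho> y * ennreal (dist_var y powr (c / 2))"
          using prob_vis[OF True elim] by (simp add: emeasure_eq_measure c_def)
        finally show ?thesis using True by simp
      next
        case False
        then have "y \<notin> vis \<omega>" for \<omega> using vis_subset[of \<omega>] by auto
        then show ?thesis using False by simp
      qed
    qed
  qed
  also have "\<dots> = (\<integral>\<^sup>+y. \<rho> y * ennreal (dist_var y powr (c / 2)) \<partial>restrict_space lborel ?B)"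
    by (subst nn_integral_restrict_space) auto
  \<comment> \<open>From here on the integrand depends on \<open>y\<close> through
    \<open>dist_var y\<close> only, since the norm is recovered as
    \<open>(1 - sqrt z) / (1 + sqrt z)\<close>; so the measure can be pushed forward to the
    line.\<close>
  also have "\<dots> = (\<integral>\<^sup>+y. (\<lambda>z. ennreal ((2 / (1 - ((1 - sqrt z) / (1 + sqrt z))\<^sup>2)) ^ d * z powr (c / 2))) (dist_var y) \<partial>restrict_space lborel ?B)"
  proof (rule nn_integral_cong)
    fix y :: 'a assume "y \<in> space (restrict_space lborel ?B)"
    then have y: "norm y < 1" by (simp add: space_restrict_space)
    then have s: "sqrt (dist_var y) = (1 - norm y) / (1 + norm y)" by (simp add: dist_var_def add_pos_nonneg)
    have p: "1 + norm y > 0" by (simp add: add_pos_nonneg)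
    have "(1 - sqrt (dist_var y)) / (1 + sqrt (dist_var y)) = norm y"
      unfolding s using p by (simp add: divide_simps)
    then show "\<rho> y * ennreal (dist_var y powr (c / 2)) =
       ennreal ((2 / (1 - ((1 - sqrt (dist_var y)) / (1 + sqrt (dist_var y)))\<^sup>2)) ^ d * dist_var y powr (c / 2))"
      by (simp add: \<rho>_def ennreal_mult'')
  qed
  also have "\<dots> = (\<integral>\<^sup>+z. ennreal ((2 / (1 - ((1 - sqrt z) / (1 + sqrt z))\<^sup>2)) ^ d * z powr (c / 2)) \<partial>distr (restrict_space lborel ?B) borel dist_var)"
    by (rule nn_integral_distr[symmetric]) (auto intro!: measurable_restrict_space1)
  also have "\<dots> = (\<integral>\<^sup>+z. indicator {0<..<1} z * ennreal (dist_var_density d z) *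
      ennreal ((2 / (1 - ((1 - sqrt z) / (1 + sqrt z))\<^sup>2)) ^ d * z powr (c / 2)) \<partial>lborel)"
    unfolding distr_dist_var[OF d_eq] dist_var_density_def by (rule nn_integral_density) measurable
  also have "\<dots> = (\<integral>\<^sup>+z. ennreal (unit_ball_vol (real d) * real d / 2 ^ d) *
     (indicator {0<..<1} z * ennreal (z powr ((c - real d + 1) / 2 - 1) * (1 - z) powr (real d - 1))) \<partial>lborel)"
  proof (rule nn_integral_cong)
    fix z :: real
    show "indicator {0<..<1} z * ennreal (dist_var_density d z) * ennreal ((2 / (1 - ((1 - sqrt z) / (1 + sqrt z))\<^sup>2)) ^ d * z powr (c / 2))
      = ennreal (unit_ball_vol (real d) * real d / 2 ^ d) *
     (indicator {0<..<1} z * ennreal (z powr ((c - real d + 1) / 2 - 1) * (1 - z) powr (real d - 1)))"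
    proof (cases "z \<in> {0<..<1}")
      case True
      then have "sqrt z < 1" "0 < sqrt z" by auto
      then have "dist_var_density d z \<ge> 0" by (simp add: dist_var_density_def)
      then show ?thesis
        using True hyp_volume_integrand[of d z c] dim by (simp add: ennreal_mult'[symmetric])
    qed simp
  qed
  also have "\<dots> = ennreal (unit_ball_vol (real d) * real d / 2 ^ d) *
    (\<integral>\<^sup>+z. indicator {0<..<1} z * ennreal (z powr ((c - real d + 1) / 2 - 1) * (1 - z) powr (real d - 1)) \<partial>lborel)"
    by (rule nn_integral_cmult) measurable
  finally show ?thesis by (simp add: c_def)
qed

text \<open>The first parameter \<open>(\<gamma> * \<kappa> - real d + 1) / 2\<close> of the Beta
  integral is nonpositive exactly up to the critical intensity.\<close>

lemma expected_volume_infinite: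
  assumes "\<gamma> \<le> gamma_crit d"
  shows "expected_visible_volume M \<eta> = \<infinity>"
proof -
  have "\<gamma> * \<kappa> \<le> real d - 1"
    using mult_right_mono[OF assms less_imp_le[OF kappa_pos]] gamma_crit_cap_const[OF dim] by simp
  then have "(\<integral>\<^sup>+z. indicator {0<..<1} z * ennreal (z powr ((\<gamma> * \<kappa> - real d + 1) / 2 - 1) * (1 - z) powr (real d - 1)) \<partial>lborel) = \<infinity>"
    using dim by (intro nn_integral_Beta_infinite) auto
  moreover have "ennreal (unit_ball_vol (real d) * real d / 2 ^ d) \<noteq> 0"
    using dim unit_ball_vol_pos[of "real d"] by (simp add: ennreal_eq_0_iff not_le del: unit_ball_vol_pos)
  ultimately show ?thesis unfolding expected_volume_Beta_integral by (simp add: ennreal_mult_top)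
qed

lemma expected_volume_finite:
  assumes "\<gamma> > gamma_crit d"
  shows "expected_visible_volume M \<eta> = ennreal (pi powr ((real d - 1) / 2) * Gamma ((real d + 1) / 2) *
    (Gamma ((gamma_star d \<gamma> - real d + 1) / 2) / Gamma ((gamma_star d \<gamma> + real d + 1) / 2)))"
proof -
  define c where "c = \<gamma> * \<kappa>"
  define a where "a = (c - real d + 1) / 2"
  have cs: "gamma_star d \<gamma> = c" using dim by (simp add: gamma_star_eq c_def)
  have "c > real d - 1"
    using mult_strict_right_mono[OF assms kappa_pos] gamma_crit_cap_const[OF dim] by (simp add: c_def)
  then have a: "a > 0" by (simp add: a_def)
  have ad: "a + real d = (c + real d + 1) / 2" by (simp add: a_def field_simps)
  let ?V = "unit_ball_vol (real d)"
  have "expected_visible_volume M \<eta> = ennreal (?V * real d / 2 ^ d) * ennreal (Beta a (real d))"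
    unfolding expected_volume_Beta_integral c_def[symmetric] a_def[symmetric]
    using nn_integral_Beta[OF a, of "real d"] dim by simp
  also have "\<dots> = ennreal (?V * real d / 2 ^ d * Beta a (real d))"
    using dim by (intro ennreal_mult'[symmetric]) simp
  also have "?V * real d / 2 ^ d * Beta a (real d) = pi powr ((real d - 1) / 2) * Gamma ((real d + 1) / 2) * (Gamma a / Gamma (a + real d))"
  proof -
    \<comment> \<open>Duplication at d/2 merges \<open>Gamma (real d)\<close> from the Beta function
      with the Gamma factor in the volume of the unit ball.\<close>
    have dup: "Gamma (real d / 2) * Gamma (real d / 2 + 1/2) = exp ((1 - 2 * (real d / 2)) * ln 2) * sqrt pi * Gamma (2 * (real d / 2))"
      using dim by (intro Gamma_legendre_duplication_real) auto
    have G1: "Gamma (real d / 2 + 1) = real d / 2 * Gamma (real d / 2)"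
      using dim by (intro Gamma_plus1) (auto simp: nonpos_Ints_def)
    have e: "exp ((1 - real d) * ln 2) = 2 / 2 ^ d"
    proof -
      have "exp ((1 - real d) * ln 2) = (2::real) powr (1 - real d)" by (simp add: powr_def)
      then show ?thesis by (simp add: powr_diff powr_realpow)
    qed
    have pp: "pi powr (real d / 2) = pi powr ((real d - 1) / 2) * sqrt pi"
      by (simp add: powr_half_sqrt[symmetric] powr_add[symmetric] field_simps)
    define g where "g = Gamma (real d / 2)"
    define h where "h = Gamma ((real d + 1) / 2)"
    define G where "G = Gamma (real d)"
    define p where "p = pi powr ((real d - 1) / 2)"
    have pos: "g > 0" "h > 0" "G > 0" using dim by (simp_all add: g_def h_def G_def)
    have "real d / 2 + 1/2 = (real d + 1) / 2" by (simp add: field_simps)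
    with dup have gh: "g * h = 2 / 2 ^ d * sqrt pi * G" by (simp add: g_def h_def G_def e)
    have "?V * real d / 2 ^ d * G = (p * sqrt pi / (real d / 2 * g)) * real d / 2 ^ d * G"
      by (simp only: unit_ball_vol_def pp G1 p_def g_def)
    also have "\<dots> = p * (2 / 2 ^ d * sqrt pi * G) / g" using dim pos by (simp add: mult_ac)
    also have "\<dots> = p * h" unfolding gh[symmetric] using pos by simp
    finally have "?V * real d / 2 ^ d * G = p * h" .
    then have "?V * real d / 2 ^ d * G * (Gamma a / Gamma (a + real d)) = p * h * (Gamma a / Gamma (a + real d))"
      by simp
    then show ?thesis by (simp add: Beta_def p_def h_def G_def mult_ac)
  qed
  finally show ?thesis unfolding ad unfolding a_def cs .
qed

end

section \<open>The subcritical regime\<close>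

lemma norm_diff_unit:
  fixes u v :: "'a::real_inner"
  assumes "norm u = 1" "norm v = 1"
  shows "(norm (u - v))\<^sup>2 = 2 - 2 * (u \<bullet> v)"
  using assms by (simp add: power2_norm_eq_inner inner_diff inner_commute norm_eq_1)

text \<open>The squared chord is \<open>2 - 2 * c\<close>. Since
  \<open>(1 - c) * (amp lam s)\<^sup>2 \<le> 1\<close> and \<open>exp s / 2 \<le> amp lam s\<close>,
  it is at most 8 exp (-2 s), and 3 is a round bound for the root of 8.\<close>

lemma ray_hits_near:
  fixes v :: "'a::euclidean_space"
  assumes lam: "0 \<le> lam" "lam \<le> 1" and v: "norm v = 1" and hit: "(s, u) \<in> ray_hits lam \<tau> v"
  shows "norm (u - v) \<le> 3 * exp (- s)"
proof -
  note b = ray_hits_bounds[OF lam v hit]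
  define c where "c = u \<bullet> v"
  have A: "exp s / 2 \<le> amp lam s" using amp_bounds(3)[OF lam, of s] b by simp
  then have "(exp s / 2)\<^sup>2 \<le> (amp lam s)\<^sup>2" by (intro power_mono) auto
  moreover have c1: "c \<le> 1" using norm_cauchy_schwarz[of u v] b v by (simp add: c_def)
  moreover have "0 < c" using b by (simp add: c_def)
  ultimately have "(1 - c) * (exp s / 2)\<^sup>2 \<le> (1 - c\<^sup>2) * (amp lam s)\<^sup>2"
    by (intro mult_mono) (auto simp: power2_eq_square mult_left_le_one_le mult_le_one)
  also have "\<dots> \<le> 1" using b by (simp add: c_def)
  finally have "(1 - c) * (exp s)\<^sup>2 \<le> 4" by (simp add: power_divide)
  moreover have "(norm (u - v) * exp s)\<^sup>2 = 2 * ((1 - c) * (exp s)\<^sup>2)"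
    unfolding power_mult_distrib norm_diff_unit[OF b(3) v] c_def by (simp add: left_diff_distrib)
  ultimately have "(norm (u - v) * exp s)\<^sup>2 \<le> 3\<^sup>2" by simp
  then have "norm (u - v) * exp s \<le> 3" by (rule power2_le_imp_le) simp
  then show ?thesis by (simp add: exp_minus field_simps)
qed

lemma sphere_cap_eq:
  fixes v :: "'a::euclidean_space"
  assumes "norm v = 1" "0 \<le> \<rho>"
  shows "{u \<in> sphere 0 1. norm (u - v) \<le> \<rho>} = {u \<in> sphere 0 1. 1 - \<rho>\<^sup>2 / 2 \<le> u \<bullet> v}"
proof -
  have "norm (u - v) \<le> \<rho> \<longleftrightarrow> 1 - \<rho>\<^sup>2 / 2 \<le> u \<bullet> v" if "norm u = 1" for u
  proof -
    have "norm (u - v) \<le> \<rho> \<longleftrightarrow> (norm (u - v))\<^sup>2 \<le> \<rho>\<^sup>2" using assms by (simp add: power2_le_iff_abs_le)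
    then show ?thesis using norm_diff_unit[OF that assms(1)] by auto
  qed
  then show ?thesis by auto
qed

lemma sets_sphere_cap: "{u \<in> sphere 0 1. norm (u - v) \<le> \<rho>} \<in> sets (sphere_measure :: 'a::euclidean_space measure)"
proof -
  have "{u::'a. norm (u - v) \<le> \<rho>} \<in> sets borel" by measurable
  then have "{u::'a. norm (u - v) \<le> \<rho>} \<inter> sphere 0 1 \<in> sets (restrict_space borel (sphere 0 1))"
    by (auto simp: sets_restrict_space)
  then show ?thesis unfolding sets_sphere_measure by (simp add: Int_def conj_commute)
qed

text \<open>For radii below 1 the cosine exceeds 1/2, which costs a factor 2 in
  \<open>cap_measure_le\<close>; for larger radii the total mass is bound enough.\<close>

lemma emeasure_sphere_cap_le:
  assumes d: "DIM('a::euclidean_space) \<ge> 2"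
  obtains C where "C > 0" "\<And>(v::'a) \<rho>. norm v = 1 \<Longrightarrow> 0 < \<rho> \<Longrightarrow> emeasure sphere_measure {u \<in> sphere 0 1. norm (u - v) \<le> \<rho>} \<le> ennreal (C * \<rho> ^ (DIM('a) - 1))"
proof -
  interpret finite_measure "sphere_measure :: 'a measure" by (rule finite_measure_sphere_measure)
  define n where "n = DIM('a) - 1"
  define K where "K = cap_const DIM('a)"
  define m where "m = measure (sphere_measure :: 'a measure) (space sphere_measure)"
  define C where "C = 2 * K + m"
  have K: "K > 0" using d by (simp add: K_def cap_const_pos)
  have m: "m \<ge> 0" by (simp add: m_def)
  have le: "emeasure sphere_measure {u \<in> sphere 0 1. norm (u - v) \<le> \<rho>} \<le> ennreal (C * \<rho> ^ n)"
    if v: "norm v = 1" and \<rho>: "0 < \<rho>" for v :: 'a and \<rho>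
  proof (cases "\<rho> < 1")
    case True
    define c where "c = 1 - \<rho>\<^sup>2 / 2"
    have "\<rho>\<^sup>2 < 1" using True \<rho> by (simp add: abs_square_less_1)
    then have c: "1/2 < c" "c < 1" using \<rho> by (simp_all add: c_def)
    have "1 - c\<^sup>2 = \<rho>\<^sup>2 - (\<rho>\<^sup>2 / 2)\<^sup>2" by (simp add: c_def power2_eq_square algebra_simps)
    then have s: "sqrt (1 - c\<^sup>2) \<le> \<rho>" using \<rho> by (intro real_le_lsqrt) auto
    have s0: "0 \<le> sqrt (1 - c\<^sup>2)" using c by (simp add: abs_square_le_1)
    have "cap_measure DIM('a) c \<le> K * sqrt (1 - c\<^sup>2) ^ n / c"
      using cap_measure_le[OF d, of c] c by (simp add: K_def n_def)
    also have "\<dots> \<le> K * \<rho> ^ n / (1/2)"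
      using c K s s0 \<rho> by (intro frac_le mult_left_mono power_mono mult_nonneg_nonneg) auto
    also have "\<dots> \<le> C * \<rho> ^ n" using m \<rho> by (simp add: C_def distrib_right)
    finally have "cap_measure DIM('a) c \<le> C * \<rho> ^ n" .
    moreover have "{u \<in> sphere 0 1. norm (u - v) \<le> \<rho>} = {u \<in> sphere 0 1. c \<le> u \<bullet> v}"
      using sphere_cap_eq[OF v, of \<rho>] \<rho> by (simp add: c_def)
    ultimately show ?thesis using emeasure_sphere_measure_cap[OF v, of c] c by (simp add: ennreal_leI)
  next
    case False
    have "emeasure sphere_measure {u \<in> sphere 0 1. norm (u - v) \<le> \<rho>} \<le> emeasure (sphere_measure :: 'a measure) (space sphere_measure)"
      by (intro emeasure_space)
    also have "\<dots> = ennreal m" by (simp add: m_def emeasure_eq_measure)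
    also have "\<dots> \<le> ennreal (C * \<rho> ^ n)"
    proof (intro ennreal_leI)
      have "m * 1 \<le> C * \<rho> ^ n" using False K m by (intro mult_mono one_le_power) (auto simp: C_def)
      then show "m \<le> C * \<rho> ^ n" by simp
    qed
    finally show ?thesis .
  qed
  show ?thesis using K m le by (intro that[of C]) (auto simp: C_def n_def)
qed

text \<open>Two shadows of diameter O(exp (-s)) that share a hyperplane force \<open>s\<close> to be
  at most ln (6 / |v - v'|). In a layer at large \<open>s\<close> the density times the cap measure
  is at most \<kappa> / g, with the cosine g close to 1. The slack between \<kappa> and
  \<open>q\<close> absorbs g, and the bounded range of small \<open>s\<close> goes into
  \<open>C\<close>. Below the critical intensity there is room for this slack.\<close>

lemma ray_hits_common_le:
  assumes d: "DIM('a::euclidean_space) \<ge> 2" and lam: "0 \<le> lam" "lam \<le> 1" and q: "cap_const DIM('a) < q"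
  obtains C where "C \<ge> 0" "\<And>(v::'a) v' \<tau>. norm v = 1 \<Longrightarrow> norm v' = 1 \<Longrightarrow> v \<noteq> v' \<Longrightarrow> 0 \<le> \<tau> \<Longrightarrow>
    emeasure (hyp_par lam) (ray_hits lam \<tau> v \<inter> ray_hits lam \<tau> v') \<le> ennreal (C + q * ln (6 / norm (v - v')))"
proof -
  interpret finite_measure "sphere_measure :: 'a measure" by (rule finite_measure_sphere_measure)
  define n where "n = DIM('a) - 1"
  define K where "K = cap_const DIM('a)"
  have K: "0 < K" using d by (simp add: K_def cap_const_pos)
  define \<delta> where "\<delta> = K / q"
  have \<delta>: "0 < \<delta>" "\<delta> < 1" using K q by (simp_all add: \<delta>_def K_def)
  then have \<delta>2: "\<delta>\<^sup>2 < 1" by (simp add: abs_square_less_1)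
  \<comment> \<open>Beyond \<open>s0\<close> one has
    \<open>amp lam s \<ge> 1 / sqrt (1 - \<delta>\<^sup>2)\<close>. Then the cosine of the widest
    shadow is at least \<delta>, and \<open>K / \<delta> = q\<close>.\<close>
  define s0 where "s0 = max 0 (ln (2 / sqrt (1 - \<delta>\<^sup>2)))"
  define m where "m = measure (sphere_measure :: 'a measure) (space sphere_measure)"
  have m: "m \<ge> 0" by (simp add: m_def)
  define C where "C = exp s0 ^ n * m * s0"
  have s0: "s0 \<ge> 0" by (simp add: s0_def)
  have C: "C \<ge> 0" using s0 m by (simp add: C_def)
  have le: "emeasure (hyp_par lam) (ray_hits lam \<tau> v \<inter> ray_hits lam \<tau> v') \<le> ennreal (C + q * ln (6 / norm (v - v')))"
    if v: "norm v = 1" "norm v' = 1" "v \<noteq> v'" and tau: "0 \<le> \<tau>" for v v' :: 'a and \<tau>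
  proof -
    let ?X = "ray_hits lam \<tau> v \<inter> ray_hits lam \<tau> v'"
    define L where "L = ln (6 / norm (v - v'))"
    have nv: "0 < norm (v - v')" "norm (v - v') \<le> 2" using v norm_triangle_ineq4[of v v'] by auto
    have L0: "L \<ge> 0" unfolding L_def using nv by (intro ln_ge_zero) (simp add: field_simps)
    have sL: "s \<le> L" if "(s, u) \<in> ?X" for s u
    proof -
      have "norm (v - v') \<le> norm (u - v) + norm (u - v')"
        using norm_triangle_ineq4[of "u - v'" "u - v"] by simp
      also have "\<dots> \<le> 6 * exp (- s)"
        using ray_hits_near[OF lam v(1), of s u \<tau>] ray_hits_near[OF lam v(2), of s u \<tau>] that by simp
      finally have "exp s \<le> 6 / norm (v - v')" using nv by (simp add: exp_minus field_simps)
      then show ?thesis unfolding L_def using nv by (simp add: ln_ge_iff)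
    qed
    have sX: "?X \<in> sets (hyp_par lam)" using v tau by (intro sets.Int sets_ray_hits lam)
    have "emeasure (hyp_par lam) ?X = (\<integral>\<^sup>+s. indicator {0<..} s * (ennreal (amp lam s ^ n) *
        emeasure sphere_measure {u \<in> sphere 0 1. (s, u) \<in> ?X}) \<partial>lborel)"
      unfolding n_def by (rule emeasure_hyp_par[OF sX])
    also have "\<dots> \<le> (\<integral>\<^sup>+s. ennreal (exp s0 ^ n * m) * indicator {0..s0} s + ennreal q * indicator {0..L} s \<partial>lborel)"
    proof (rule nn_integral_mono)
      fix s :: real
      let ?sec = "{u \<in> sphere 0 1. (s, u) \<in> ?X}"
      show "indicator {0<..} s * (ennreal (amp lam s ^ n) * emeasure sphere_measure ?sec)
        \<le> ennreal (exp s0 ^ n * m) * indicator {0..s0} s + ennreal q * indicator {0..L} s"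
      proof (cases "0 < s \<and> s \<le> L")
        case False
        then consider "s \<le> 0" | "?sec = {}" using sL by force
        then show ?thesis
        proof cases
          case 2
          show ?thesis by (simp only: 2 emeasure_empty mult_zero_right zero_le)
        qed simp
      next
        case True
        then have s: "0 < s" "s \<le> L" by auto
        have A: "1 \<le> amp lam s" "amp lam s \<le> exp s" "exp s / 2 \<le> amp lam s" using amp_bounds[OF lam, of s] s by auto
        show ?thesis
        proof (cases "s \<le> s0")
          case True
          have "ennreal (amp lam s ^ n) * emeasure sphere_measure ?sec \<le> ennreal (exp s0 ^ n) * ennreal m"
          proof (intro mult_mono ennreal_leI power_mono)
            show "amp lam s \<le> exp s0" using A(2) True by (meson exp_le_cancel_iff order_trans)
            show "emeasure sphere_measure ?sec \<le> ennreal m"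
              unfolding m_def emeasure_eq_measure[symmetric] by (rule emeasure_space)
          qed (use A in auto)
          also have "\<dots> = ennreal (exp s0 ^ n * m)" using m by (simp add: ennreal_mult')
          finally have "ennreal (amp lam s ^ n) * emeasure sphere_measure ?sec \<le> ennreal (exp s0 ^ n * m) + ennreal q * indicator {0..L} s"
            by (rule order_trans[OF _ add_increasing2[OF zero_le order_refl]])
          then show ?thesis using True s by simp
        next
          case False
          define g where "g = sqrt (1 - 1 / (amp lam s)\<^sup>2)"
          have "2 / sqrt (1 - \<delta>\<^sup>2) \<le> exp s"
          proof -
            have "ln (2 / sqrt (1 - \<delta>\<^sup>2)) \<le> s" using False by (simp add: s0_def)
            then have "exp (ln (2 / sqrt (1 - \<delta>\<^sup>2))) \<le> exp s" by simp
            then show ?thesis using \<delta>2 by simp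
          qed
          then have "1 / sqrt (1 - \<delta>\<^sup>2) \<le> amp lam s" using A(3) by simp
          then have "(1 / sqrt (1 - \<delta>\<^sup>2))\<^sup>2 \<le> (amp lam s)\<^sup>2" using \<delta>2 by (intro power_mono) auto
          then have "1 / (1 - \<delta>\<^sup>2) \<le> (amp lam s)\<^sup>2" using \<delta>2 by (simp add: power_divide)
          then have "1 / (amp lam s)\<^sup>2 \<le> 1 - \<delta>\<^sup>2" using \<delta>2 A(1) by (simp add: field_simps)
          then have "\<delta> \<le> g" unfolding g_def by (intro real_le_rsqrt) simp
          have A2: "0 < 1 / (amp lam s)\<^sup>2" "1 / (amp lam s)\<^sup>2 \<le> 1" using A(1) by (auto simp: divide_le_eq_1)
          have g: "0 < g" using \<delta> \<open>\<delta> \<le> g\<close> by linarith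
          have g1: "g < 1" unfolding g_def using A2(1) by (simp only: real_sqrt_lt_1_iff)
          note g = g g1
          have "?sec \<subseteq> {u \<in> sphere 0 1. g \<le> u \<bullet> v}"
          proof (intro subsetI CollectI conjI)
            fix u assume "u \<in> ?sec"
            then have h: "u \<in> sphere 0 1" "(s, u) \<in> ray_hits lam \<tau> v" by auto
            note b = ray_hits_bounds[OF lam v(1) h(2)]
            show "u \<in> sphere 0 1" by fact
            have "1 - (u \<bullet> v)\<^sup>2 \<le> 1 / (amp lam s)\<^sup>2" using b(5) A(1) by (simp add: pos_le_divide_eq)
            then show "g \<le> u \<bullet> v" unfolding g_def using b(4) by (intro real_le_lsqrt) auto
          qed
          moreover have "{u \<in> sphere 0 1. g \<le> u \<bullet> v} \<in> sets (sphere_measure :: 'a measure)"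
          proof -
            have "{u. g \<le> u \<bullet> v} \<in> sets borel" by measurable
            then have "{u. g \<le> u \<bullet> v} \<inter> sphere 0 1 \<in> sets (restrict_space borel (sphere 0 1))"
              by (auto simp: sets_restrict_space)
            then show ?thesis unfolding sets_sphere_measure by (simp add: Int_def conj_commute)
          qed
          ultimately have "emeasure sphere_measure ?sec \<le> emeasure sphere_measure {u \<in> sphere 0 1. g \<le> u \<bullet> v}"
            by (rule emeasure_mono)
          also have "\<dots> = ennreal (cap_measure DIM('a) g)" by (rule emeasure_sphere_measure_cap[OF v(1) g])
          also have "cap_measure DIM('a) g \<le> K * sqrt (1 - g\<^sup>2) ^ n / g"
            using cap_measure_le[OF d, of g] g by (simp add: K_def n_def)
          also have "sqrt (1 - g\<^sup>2) = 1 / amp lam s"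
            using A2 A(1) by (simp add: g_def real_sqrt_divide)
          finally have "ennreal (amp lam s ^ n) * emeasure sphere_measure ?sec \<le> ennreal (amp lam s ^ n) * ennreal (K * (1 / amp lam s) ^ n / g)"
            by (simp add: mult_left_mono ennreal_leI)
          also have "\<dots> = ennreal (amp lam s ^ n * (K * (1 / amp lam s) ^ n / g))"
            using A by (intro ennreal_mult'[symmetric]) auto
          also have "amp lam s ^ n * (K * (1 / amp lam s) ^ n / g) = K / g" using A by (simp add: power_divide)
          also have "ennreal (K / g) \<le> ennreal q"
          proof (intro ennreal_leI)
            have "K / g \<le> K / \<delta>" using K \<delta> \<open>\<delta> \<le> g\<close> by (intro divide_left_mono) auto
            then show "K / g \<le> q" using K q by (simp add: \<delta>_def)
          qed
          finally have "ennreal (amp lam s ^ n) * emeasure sphere_measure ?sec \<le> ennreal (exp s0 ^ n * m) * indicator {0..s0} s + ennreal q"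
            by (rule order_trans[OF _ add_increasing[OF zero_le order_refl]])
          then show ?thesis using s by simp
        qed
      qed
    qed
    also have "\<dots> = ennreal (exp s0 ^ n * m) * ennreal s0 + ennreal q * ennreal L"
      using s0 L0 by (subst nn_integral_add) (auto simp: nn_integral_cmult_indicator)
    also have "\<dots> = ennreal (C + q * L)"
      using s0 L0 m K q by (simp add: C_def K_def ennreal_mult'' ennreal_plus)
    finally show ?thesis by (simp add: L_def)
  qed
  show ?thesis using C le by (rule that)
qed

lemma dyadic_bracket:
  fixes x :: real
  assumes "0 < x" "x \<le> 2"
  obtains k :: nat where "(1/2) ^ k < x" "x \<le> 2 * (1/2) ^ k"
proof -
  define k where "k = (LEAST k. (1/2) ^ k < x)"
  have ex: "\<exists>k. (1/2) ^ k < x" using assms real_arch_pow_inv[of x "1/2"] by auto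
  then have k: "(1/2) ^ k < x" unfolding k_def by (rule LeastI_ex)
  have "x \<le> 2 * (1/2) ^ k"
  proof (cases k)
    case (Suc j)
    then have "\<not> (1/2) ^ j < x" using not_less_Least[of j "\<lambda>k. (1/2) ^ k < x"] by (simp add: k_def)
    then show ?thesis using Suc by simp
  qed (use assms in simp)
  then show ?thesis using k that by blast
qed


text \<open>A form suited to summation over dyadic caps. It includes \<open>v = v'\<close>, where
  the logarithm is infinite: there \<open>k\<close> is taken so large that all hyperplanes hit up to
  \<tau> are accounted for, so \<open>k\<close> may depend on \<tau>.\<close>

lemma ray_hits_common_dyadic:
  assumes d: "DIM('a::euclidean_space) \<ge> 2" and lam: "0 \<le> lam" "lam \<le> 1" and q: "cap_const DIM('a) < q"
  obtains C where "C \<ge> 0" "\<And>(v::'a) v' \<tau>. norm v = 1 \<Longrightarrow> norm v' = 1 \<Longrightarrow> 0 \<le> \<tau> \<Longrightarrow>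
    \<exists>k::nat. norm (v - v') \<le> 2 * (1/2) ^ k \<and>
      measure (hyp_par lam) (ray_hits lam \<tau> v \<inter> ray_hits lam \<tau> v') \<le> C + q * (real k * ln 2)"
proof -
  obtain C where C: "C \<ge> 0" and le: "\<And>(v::'a) v' \<tau>. norm v = 1 \<Longrightarrow> norm v' = 1 \<Longrightarrow> v \<noteq> v' \<Longrightarrow> 0 \<le> \<tau> \<Longrightarrow>
    emeasure (hyp_par lam) (ray_hits lam \<tau> v \<inter> ray_hits lam \<tau> v') \<le> ennreal (C + q * ln (6 / norm (v - v')))"
    using ray_hits_common_le[OF d lam q] by metis
  define K where "K = cap_const DIM('a)"
  have K: "0 < K" "K < q" using d q by (simp_all add: K_def cap_const_pos)
  have "\<exists>k::nat. norm (v - v') \<le> 2 * (1/2) ^ k \<and>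
      measure (hyp_par lam) (ray_hits lam \<tau> v \<inter> ray_hits lam \<tau> v') \<le> (C + q * ln 6) + q * (real k * ln 2)"
    if v: "norm v = 1" "norm v' = 1" and tau: "0 \<le> \<tau>" for v v' :: 'a and \<tau>
  proof (cases "v = v'")
    case True
    obtain k :: nat where "\<tau> / ln 2 \<le> real k" using real_arch_simple by blast
    then have k: "\<tau> \<le> real k * ln 2" by (simp add: field_simps)
    have "measure (hyp_par lam) (ray_hits lam \<tau> v) = K * \<tau>"
      using emeasure_ray_hits[OF d lam v(1) tau] K tau by (simp add: measure_def K_def)
    also have "\<dots> \<le> q * (real k * ln 2)" using k K tau by (intro mult_mono) auto
    also have "\<dots> \<le> (C + q * ln 6) + q * (real k * ln 2)" using C K by simp
    finally show ?thesis using True by (intro exI[of _ k]) simp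
  next
    case False
    then have nv: "0 < norm (v - v')" "norm (v - v') \<le> 2" using v norm_triangle_ineq4[of v v'] by auto
    then obtain k :: nat where k: "(1/2) ^ k < norm (v - v')" "norm (v - v') \<le> 2 * (1/2) ^ k" by (rule dyadic_bracket)
    have "ln (6 / norm (v - v')) \<le> ln (6 * 2 ^ k)"
      using k nv by (intro ln_mono) (auto simp: field_simps power_one_over)
    also have "\<dots> = ln 6 + real k * ln 2" by (simp add: ln_mult ln_realpow)
    finally have l: "ln (6 / norm (v - v')) \<le> ln 6 + real k * ln 2" .
    have "emeasure (hyp_par lam) (ray_hits lam \<tau> v \<inter> ray_hits lam \<tau> v') \<le> ennreal (C + q * ln (6 / norm (v - v')))"
      by (rule le[OF v False tau])
    also have "\<dots> \<le> ennreal ((C + q * ln 6) + q * (real k * ln 2))"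
    proof (intro ennreal_leI)
      have "q * ln (6 / norm (v - v')) \<le> q * (ln 6 + real k * ln 2)" using l K by (intro mult_left_mono) auto
      then show "C + q * ln (6 / norm (v - v')) \<le> (C + q * ln 6) + q * (real k * ln 2)"
        by (simp add: distrib_left)
    qed
    finally have "measure (hyp_par lam) (ray_hits lam \<tau> v \<inter> ray_hits lam \<tau> v') \<le> (C + q * ln 6) + q * (real k * ln 2)"
      unfolding measure_def using C K by (intro enn2real_leI) auto
    then show ?thesis using k by blast
  qed
  then show ?thesis using C K by (intro that[of "C + q * ln 6"]) auto
qed

section \<open>Moments of the measure of visible directions\<close>

context hyperplane_process begin

lemma void_Un: "void (A \<union> B) = void A \<inter> void B"
  by (auto simp: void_def)

lemma ray_hits_finite:
  fixes v :: 'a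
  assumes "norm v = 1" "0 \<le> \<tau>"
  shows "emeasure (hyp_par lam) (ray_hits lam \<tau> v) = ennreal (\<kappa> * \<tau>)"
  unfolding d_eq using assms dim by (intro emeasure_ray_hits lam) (simp_all add: d_eq)

text \<open>Inclusion-exclusion for the union of the two hit sets: the correlation of two directions
  comes from the common hyperplanes alone.\<close>

lemma prob_void_two_rays:
  assumes v: "norm v = 1" "norm v' = 1" and tau: "0 \<le> \<tau>"
  shows "prob (void (ray_hits lam \<tau> v) \<inter> void (ray_hits lam \<tau> v')) =
    exp (- 2 * \<gamma> * \<kappa> * \<tau>) * exp (\<gamma> * measure (hyp_par lam) (ray_hits lam \<tau> v \<inter> ray_hits lam \<tau> v'))"
proof -
  let ?A = "ray_hits lam \<tau> v" and ?B = "ray_hits lam \<tau> v'" and ?\<mu> = "hyp_par lam :: (real \<times> 'a) measure"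
  have s: "?A \<in> sets ?\<mu>" "?B \<in> sets ?\<mu>" using v tau by (auto intro!: sets_ray_hits lam)
  have e: "emeasure ?\<mu> ?A = ennreal (\<kappa> * \<tau>)" "emeasure ?\<mu> ?B = ennreal (\<kappa> * \<tau>)"
    using v tau by (auto intro!: ray_hits_finite)
  have m: "measure ?\<mu> ?A = \<kappa> * \<tau>" "measure ?\<mu> ?B = \<kappa> * \<tau>"
    using e kappa_pos tau by (simp_all add: measure_def)
  have f: "?A \<in> fmeasurable ?\<mu>" "?B \<in> fmeasurable ?\<mu>" using s e by (auto intro!: fmeasurableI)
  have mU: "measure ?\<mu> (?A \<union> ?B) = 2 * (\<kappa> * \<tau>) - measure ?\<mu> (?A \<inter> ?B)"
    using measure_Un3[OF f] m by simp
  have "prob (void (?A \<union> ?B)) = exp (- \<gamma> * measure ?\<mu> (?A \<union> ?B))"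
    using fmeasurable.Un[OF f] s by (intro prob_void) (auto simp: fmeasurable_def)
  also have "- \<gamma> * measure ?\<mu> (?A \<union> ?B) = - 2 * \<gamma> * \<kappa> * \<tau> + \<gamma> * measure ?\<mu> (?A \<inter> ?B)"
    unfolding mU by (simp add: algebra_simps)
  finally show ?thesis by (simp only: void_Un exp_add)
qed

text \<open>The amount of visible directions rather than their existence: it is measurable and its
  moments are computable by Fubini's theorem.\<close>

definition visible_sphere :: "nat \<Rightarrow> 'w \<Rightarrow> ennreal" where
  "visible_sphere n \<omega> = (\<integral>\<^sup>+v. indicator (vis \<omega>) (tanh (real n / 2) *\<^sub>R v) \<partial>sphere_measure)"

lemma vis_scaled_measurable:
  "(\<lambda>(\<omega>, v). indicator (vis \<omega>) (c *\<^sub>R v) :: ennreal) \<in> borel_measurable (M \<Otimes>\<^sub>M (sphere_measure :: 'a measure))"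
proof -
  have "(\<lambda>x. x) \<in> measurable (sphere_measure :: 'a measure) borel"
    unfolding measurable_cong_sets[OF sets_sphere_measure refl] by (intro measurable_restrict_space1) simp
  then have "(\<lambda>v. c *\<^sub>R v) \<in> measurable (sphere_measure :: 'a measure) borel" by simp
  then have sm: "(\<lambda>p. c *\<^sub>R snd p) \<in> measurable (M \<Otimes>\<^sub>M (sphere_measure :: 'a measure)) borel"
    by (rule measurable_compose[OF measurable_snd])
  have "(\<lambda>p. (fst p, c *\<^sub>R snd p)) \<in> measurable (M \<Otimes>\<^sub>M (sphere_measure :: 'a measure)) (M \<Otimes>\<^sub>M borel)"
    by (rule measurable_Pair[OF measurable_fst sm])
  moreover have "(\<lambda>p. indicator {p \<in> space (M \<Otimes>\<^sub>M borel). snd p \<in> vis (fst p)} p :: ennreal) \<in> borel_measurable (M \<Otimes>\<^sub>M borel)"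
    using vis_joint_sets by simp
  ultimately have "(\<lambda>p. indicator {p \<in> space (M \<Otimes>\<^sub>M borel). snd p \<in> vis (fst p)} (fst p, c *\<^sub>R snd p) :: ennreal)
      \<in> borel_measurable (M \<Otimes>\<^sub>M (sphere_measure :: 'a measure))"
    by (rule measurable_compose)
  then show ?thesis
    by (rule measurable_cong[THEN iffD1, rotated]) (auto simp: indicator_def space_pair_measure)
qed

lemma visible_sphere_measurable: "visible_sphere n \<in> borel_measurable M"
proof -
  interpret S: finite_measure "sphere_measure :: 'a measure" by (rule finite_measure_sphere_measure)
  show ?thesis
    unfolding visible_sphere_def[abs_def] by (rule S.borel_measurable_nn_integral) (rule vis_scaled_measurable)
qed

lemma nn_integral_visible_sphere:
  "(\<integral>\<^sup>+\<omega>. visible_sphere n \<omega> \<partial>M) = ennreal (exp (- \<gamma> * \<kappa> * real n)) * emeasure sphere_measure (space (sphere_measure :: 'a measure))"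
proof -
  interpret S: finite_measure "sphere_measure :: 'a measure" by (rule finite_measure_sphere_measure)
  interpret P: pair_sigma_finite M "sphere_measure :: 'a measure" ..
  have "(\<integral>\<^sup>+\<omega>. visible_sphere n \<omega> \<partial>M) = (\<integral>\<^sup>+v. \<integral>\<^sup>+\<omega>. indicator (vis \<omega>) (tanh (real n / 2) *\<^sub>R v) \<partial>M \<partial>sphere_measure)"
    unfolding visible_sphere_def by (rule P.Fubini'[symmetric]) (rule vis_scaled_measurable)
  also have "\<dots> = (\<integral>\<^sup>+v. ennreal (exp (- \<gamma> * \<kappa> * real n)) \<partial>(sphere_measure :: 'a measure))"
  proof (rule nn_integral_cong)
    fix v :: 'a assume "v \<in> space sphere_measure"
    then have v: "norm v = 1" by (simp add: space_sphere_measure)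
    have "(\<integral>\<^sup>+\<omega>. indicator (vis \<omega>) (tanh (real n / 2) *\<^sub>R v) \<partial>M) = (\<integral>\<^sup>+\<omega>. indicator (void (ray_hits lam (real n) v)) \<omega> \<partial>M)"
      using vis_ray_iff[OF _ v, of _ "real n"] by (intro nn_integral_cong) (simp add: indicator_def)
    also have "\<dots> = emeasure M (void (ray_hits lam (real n) v))"
      using v by (intro nn_integral_indicator void_event sets_ray_hits lam) auto
    finally show "(\<integral>\<^sup>+\<omega>. indicator (vis \<omega>) (tanh (real n / 2) *\<^sub>R v) \<partial>M) = ennreal (exp (- \<gamma> * \<kappa> * real n))"
      using prob_void_ray_hits[OF v, of "real n"] by (simp add: emeasure_eq_measure)
  qed
  also have "\<dots> = ennreal (exp (- \<gamma> * \<kappa> * real n)) * emeasure sphere_measure (space (sphere_measure :: 'a measure))"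
    by simp
  finally show ?thesis .
qed

lemma nn_integral_visible_sphere_sq:
  "(\<integral>\<^sup>+\<omega>. (visible_sphere n \<omega>)\<^sup>2 \<partial>M) = (\<integral>\<^sup>+v. \<integral>\<^sup>+v'.
     emeasure M (void (ray_hits lam (real n) v) \<inter> void (ray_hits lam (real n) v')) \<partial>sphere_measure \<partial>(sphere_measure :: 'a measure))"
proof -
  let ?S = "sphere_measure :: 'a measure"
  let ?f = "\<lambda>\<omega> v. indicator (vis \<omega>) (tanh (real n / 2) *\<^sub>R v) :: ennreal"
  interpret S: finite_measure ?S by (rule finite_measure_sphere_measure)
  interpret P: pair_sigma_finite M ?S ..
  note f = vis_scaled_measurable[of "tanh (real n / 2)", unfolded split_beta']
  have fw: "?f \<omega> \<in> borel_measurable ?S" if "\<omega> \<in> space M" for \<omega>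
    using measurable_Pair2[OF f that] by simp
  have fv: "(\<lambda>\<omega>. ?f \<omega> v) \<in> borel_measurable M" if "v \<in> space ?S" for v
    using measurable_Pair1[OF f that] by simp
  have "(\<integral>\<^sup>+\<omega>. (visible_sphere n \<omega>)\<^sup>2 \<partial>M) = (\<integral>\<^sup>+\<omega>. \<integral>\<^sup>+v. ?f \<omega> v * visible_sphere n \<omega> \<partial>?S \<partial>M)"
    by (intro nn_integral_cong) (simp add: nn_integral_multc fw visible_sphere_def power2_eq_square)
  also have "\<dots> = (\<integral>\<^sup>+v. \<integral>\<^sup>+\<omega>. ?f \<omega> v * visible_sphere n \<omega> \<partial>M \<partial>?S)"
    by (rule P.Fubini'[symmetric], unfold split_beta', rule borel_measurable_times_ennreal[OF f])
      (rule measurable_compose[OF measurable_fst visible_sphere_measurable])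
  also have "\<dots> = (\<integral>\<^sup>+v. \<integral>\<^sup>+v'. emeasure M (void (ray_hits lam (real n) v) \<inter> void (ray_hits lam (real n) v')) \<partial>?S \<partial>?S)"
  proof (rule nn_integral_cong)
    fix v :: 'a assume vS: "v \<in> space ?S"
    then have v: "norm v = 1" by (simp add: space_sphere_measure)
    have "(\<integral>\<^sup>+\<omega>. ?f \<omega> v * visible_sphere n \<omega> \<partial>M) = (\<integral>\<^sup>+\<omega>. \<integral>\<^sup>+v'. ?f \<omega> v * ?f \<omega> v' \<partial>?S \<partial>M)"
      by (intro nn_integral_cong) (simp add: nn_integral_cmult fw visible_sphere_def)
    also have "\<dots> = (\<integral>\<^sup>+v'. \<integral>\<^sup>+\<omega>. ?f \<omega> v * ?f \<omega> v' \<partial>M \<partial>?S)"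
      by (rule P.Fubini'[symmetric], unfold split_beta', rule borel_measurable_times_ennreal[OF _ f])
        (rule measurable_compose[OF measurable_fst fv[OF vS]])
    also have "\<dots> = (\<integral>\<^sup>+v'. emeasure M (void (ray_hits lam (real n) v) \<inter> void (ray_hits lam (real n) v')) \<partial>?S)"
    proof (rule nn_integral_cong)
      fix v' :: 'a assume "v' \<in> space ?S"
      then have v': "norm v' = 1" by (simp add: space_sphere_measure)
      have "(\<integral>\<^sup>+\<omega>. ?f \<omega> v * ?f \<omega> v' \<partial>M) = (\<integral>\<^sup>+\<omega>. indicator (void (ray_hits lam (real n) v) \<inter> void (ray_hits lam (real n) v')) \<omega> \<partial>M)"
        using vis_ray_iff[OF _ v, of _ "real n"] vis_ray_iff[OF _ v', of _ "real n"]
        by (intro nn_integral_cong) (simp add: indicator_def)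
      also have "\<dots> = emeasure M (void (ray_hits lam (real n) v) \<inter> void (ray_hits lam (real n) v'))"
        using v v' by (intro nn_integral_indicator sets.Int void_event sets_ray_hits lam) auto
      finally show "(\<integral>\<^sup>+\<omega>. ?f \<omega> v * ?f \<omega> v' \<partial>M) = emeasure M (void (ray_hits lam (real n) v) \<inter> void (ray_hits lam (real n) v'))" .
    qed
    finally show "(\<integral>\<^sup>+\<omega>. ?f \<omega> v * visible_sphere n \<omega> \<partial>M) =
       (\<integral>\<^sup>+v'. emeasure M (void (ray_hits lam (real n) v) \<inter> void (ray_hits lam (real n) v')) \<partial>?S)" .
  qed
  finally show ?thesis .
qed

end

context hyperplane_process begin

lemma sphere_measure_pos: "0 < emeasure (sphere_measure :: 'a measure) (space sphere_measure)"
proof -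
  obtain b :: 'a where b: "b \<in> Basis" using nonempty_Basis by blast
  have "0 < cap_const DIM('a) * sqrt (1 - (1/2)\<^sup>2) ^ (DIM('a) - 1)"
    using kappa_pos by (simp add: d_eq power2_eq_square)
  also have "\<dots> \<le> cap_measure DIM('a) (1/2)" using dim by (intro cap_measure_ge) (auto simp: d_eq)
  finally have "0 < ennreal (cap_measure DIM('a) (1/2))" by simp
  also have "\<dots> = emeasure sphere_measure {u \<in> sphere 0 1. 1/2 \<le> u \<bullet> b}"
    using b by (intro emeasure_sphere_measure_cap[symmetric]) auto
  also have "\<dots> \<le> emeasure (sphere_measure :: 'a measure) (space sphere_measure)" by (rule emeasure_space)
  finally show ?thesis .
qed

text \<open>In the k-th dyadic cap around \<open>v\<close> the correlation factor is of order
  2^(\<gamma>qk), while the cap has measure of order 2^(-(d-1)k). The resulting geometric series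
  converges because \<gamma>q < d - 1, and this is where subcriticality enters.\<close>

lemma second_moment_bound:
  assumes sub: "\<gamma> * \<kappa> < real d - 1"
  obtains C where "C > 0" "\<And>n. (\<integral>\<^sup>+\<omega>. (visible_sphere n \<omega>)\<^sup>2 \<partial>M) \<le>
     ennreal (exp (- 2 * \<gamma> * \<kappa> * real n)) * ennreal C * emeasure sphere_measure (space (sphere_measure :: 'a measure))"
proof -
  let ?S = "sphere_measure :: 'a measure"
  define p where "p = d - 1"
  have p: "real p = real d - 1" using dim by (simp add: p_def)
  \<comment> \<open>The midpoint between \<kappa> and (d - 1)/\<gamma>: above \<kappa>, as
    \<open>ray_hits_common_dyadic\<close> demands, and still within the range of
    convergence.\<close>
  define q where "q = (\<kappa> + (real d - 1) / \<gamma>) / 2"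
  have q: "\<kappa> < q" "\<gamma> * q < real p"
  proof -
    have "\<kappa> < (real d - 1) / \<gamma>" using sub gamma by (simp add: pos_less_divide_eq mult.commute)
    then show "\<kappa> < q" by (simp add: q_def)
    have "\<gamma> * q = (\<gamma> * \<kappa> + (real d - 1)) / 2" using gamma by (simp add: q_def distrib_left)
    then show "\<gamma> * q < real p" using sub by (simp add: p)
  qed
  have q0: "0 < q" using q kappa_pos by simp
  obtain C1 where C1: "C1 \<ge> 0" "\<And>(v::'a) v' \<tau>. norm v = 1 \<Longrightarrow> norm v' = 1 \<Longrightarrow> 0 \<le> \<tau> \<Longrightarrow>
    \<exists>k::nat. norm (v - v') \<le> 2 * (1/2) ^ k \<and>
      measure (hyp_par lam) (ray_hits lam \<tau> v \<inter> ray_hits lam \<tau> v') \<le> C1 + q * (real k * ln 2)"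
    using ray_hits_common_dyadic[where 'a='a, of lam q] dim lam q by (auto simp: d_eq)
  obtain C2 where C2: "C2 > 0" "\<And>(v::'a) \<rho>. norm v = 1 \<Longrightarrow> 0 < \<rho> \<Longrightarrow>
     emeasure sphere_measure {u \<in> sphere 0 1. norm (u - v) \<le> \<rho>} \<le> ennreal (C2 * \<rho> ^ p)"
    using emeasure_sphere_cap_le[where 'a='a] dim by (auto simp: d_eq p_def)
  define a where "a = (2::real) powr (\<gamma> * q)"
  define \<rho> where "\<rho> = a / 2 ^ p"
  have a: "a > 0" by (simp add: a_def)
  have "a < 2 powr real p" unfolding a_def using q by (intro powr_less_mono) auto
  then have \<rho>: "0 \<le> \<rho>" "\<rho> < 1" using a by (simp_all add: \<rho>_def powr_realpow)
  define D where "D = exp (\<gamma> * C1) * (C2 * 2 ^ p * (1 / (1 - \<rho>)))"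
  have D: "D > 0" using C2 \<rho> by (simp add: D_def)
  have "(\<integral>\<^sup>+\<omega>. (visible_sphere n \<omega>)\<^sup>2 \<partial>M) \<le> ennreal (exp (- 2 * \<gamma> * \<kappa> * real n)) * ennreal D * emeasure ?S (space ?S)" for n
  proof -
    let ?B = "\<lambda>v k. {u \<in> sphere 0 1. norm (u - v) \<le> 2 * (1/2) ^ k} :: 'a set"
    let ?e = "exp (- 2 * \<gamma> * \<kappa> * real n)"
    \<comment> \<open>The index \<open>k\<close> depends on the pair of directions in no controlled
      way. Summing over all caps that contain \<open>v'\<close> avoids a measurable choice of
      it.\<close>
    have pt: "emeasure M (void (ray_hits lam (real n) v) \<inter> void (ray_hits lam (real n) v'))
      \<le> ennreal (?e * exp (\<gamma> * C1)) * (\<Sum>k. ennreal (a ^ k) * indicator (?B v k) v')"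
      if v: "norm v = 1" "norm v' = 1" for v v' :: 'a
    proof -
      obtain k :: nat where k: "norm (v - v') \<le> 2 * (1/2) ^ k"
        "measure (hyp_par lam) (ray_hits lam (real n) v \<inter> ray_hits lam (real n) v') \<le> C1 + q * (real k * ln 2)"
        using C1(2)[OF v, of "real n"] by auto
      have "emeasure M (void (ray_hits lam (real n) v) \<inter> void (ray_hits lam (real n) v'))
        = ennreal (?e * exp (\<gamma> * measure (hyp_par lam) (ray_hits lam (real n) v \<inter> ray_hits lam (real n) v')))"
        using prob_void_two_rays[OF v, of "real n"] by (simp add: emeasure_eq_measure)
      also have "\<dots> \<le> ennreal (?e * exp (\<gamma> * (C1 + q * (real k * ln 2))))"
        using k(2) gamma by (intro ennreal_leI mult_left_mono) auto
      also have "exp (\<gamma> * (C1 + q * (real k * ln 2))) = exp (\<gamma> * C1) * a ^ k"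
        by (simp add: a_def powr_def exp_of_nat_mult[symmetric] exp_add[symmetric] algebra_simps)
      also have "ennreal (?e * (exp (\<gamma> * C1) * a ^ k)) = ennreal (?e * exp (\<gamma> * C1)) * (ennreal (a ^ k) * indicator (?B v k) v')"
        using v k(1) a by (simp add: ennreal_mult'[symmetric] norm_minus_commute mult.assoc)
      also have "ennreal (a ^ k) * indicator (?B v k) v' \<le> (\<Sum>k. ennreal (a ^ k) * indicator (?B v k) v')"
      proof -
        have "f k \<le> (\<Sum>k. f k)" for f :: "nat \<Rightarrow> ennreal"
          using sum_le_suminf[of f "{k}"] by simp
        then show ?thesis .
      qed
      finally show ?thesis by (simp add: mult_left_mono)
    qed
    have inner: "(\<integral>\<^sup>+v'. emeasure M (void (ray_hits lam (real n) v) \<inter> void (ray_hits lam (real n) v')) \<partial>?S) \<le> ennreal ?e * ennreal D"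
      if v: "norm v = 1" for v
    proof -
      have "(\<integral>\<^sup>+v'. emeasure M (void (ray_hits lam (real n) v) \<inter> void (ray_hits lam (real n) v')) \<partial>?S)
        \<le> (\<integral>\<^sup>+v'. ennreal (?e * exp (\<gamma> * C1)) * (\<Sum>k. ennreal (a ^ k) * indicator (?B v k) v') \<partial>?S)"
        using v by (intro nn_integral_mono pt) (auto simp: space_sphere_measure)
      also have "\<dots> = ennreal (?e * exp (\<gamma> * C1)) * (\<Sum>k. \<integral>\<^sup>+v'. ennreal (a ^ k) * indicator (?B v k) v' \<partial>?S)"
      proof -
        have [measurable]: "?B v k \<in> sets ?S" for k by (rule sets_sphere_cap)
        have "(\<lambda>v'. ennreal (a ^ k) * indicator (?B v k) v') \<in> borel_measurable ?S" for k by measurable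
        then show ?thesis
          by (subst nn_integral_cmult[OF borel_measurable_suminf_order]) (simp_all only: nn_integral_suminf)
      qed
      also have "\<dots> \<le> ennreal (?e * exp (\<gamma> * C1)) * (\<Sum>k. ennreal (C2 * 2 ^ p * \<rho> ^ k))"
      proof (intro mult_left_mono suminf_le)
        fix k
        have "(\<integral>\<^sup>+v'. ennreal (a ^ k) * indicator (?B v k) v' \<partial>?S) = ennreal (a ^ k) * emeasure ?S (?B v k)"
          by (rule nn_integral_cmult_indicator[OF sets_sphere_cap])
        also have "\<dots> \<le> ennreal (a ^ k) * ennreal (C2 * (2 * (1/2) ^ k) ^ p)"
          using v by (intro mult_left_mono C2) auto
        also have "\<dots> = ennreal (a ^ k * (C2 * (2 * (1/2) ^ k) ^ p))" using a by (intro ennreal_mult'[symmetric]) simp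
        also have "a ^ k * (C2 * (2 * (1/2) ^ k) ^ p) = C2 * 2 ^ p * \<rho> ^ k"
          by (simp add: \<rho>_def power_mult_distrib power_divide power_mult[symmetric] mult.commute)
        finally show "(\<integral>\<^sup>+v'. ennreal (a ^ k) * indicator (?B v k) v' \<partial>?S) \<le> ennreal (C2 * 2 ^ p * \<rho> ^ k)" .
      qed auto
      also have "(\<Sum>k. ennreal (C2 * 2 ^ p * \<rho> ^ k)) = ennreal (C2 * 2 ^ p * (1 / (1 - \<rho>)))"
        using C2 \<rho> by (intro suminf_ennreal_eq sums_mult geometric_sums) auto
      also have "ennreal (?e * exp (\<gamma> * C1)) * ennreal (C2 * 2 ^ p * (1 / (1 - \<rho>))) = ennreal ?e * ennreal D"
        using C2 \<rho> by (simp add: D_def ennreal_mult'[symmetric] mult.assoc)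
      finally show ?thesis .
    qed
    have "(\<integral>\<^sup>+\<omega>. (visible_sphere n \<omega>)\<^sup>2 \<partial>M) \<le> (\<integral>\<^sup>+v. ennreal ?e * ennreal D \<partial>?S)"
      unfolding nn_integral_visible_sphere_sq by (intro nn_integral_mono inner) (auto simp: space_sphere_measure)
    then show ?thesis by simp
  qed
  with D show ?thesis by (rule that)
qed

text \<open>Cauchy-Schwarz for \<open>visible_sphere n\<close> times the indicator of its
  positivity: the probability is at least the squared first moment over the second. The exponential
  factors cancel, and the bound is uniform in \<open>n\<close>.\<close>

lemma prob_visible_sphere_pos:
  assumes sub: "\<gamma> * \<kappa> < real d - 1"
  obtains p where "p > 0" "\<And>n. p \<le> prob {\<omega> \<in> space M. 0 < visible_sphere n \<omega>}"
proof -
  let ?S = "sphere_measure :: 'a measure"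
  interpret S: finite_measure ?S by (rule finite_measure_sphere_measure)
  define m where "m = measure ?S (space ?S)"
  have mS: "emeasure ?S (space ?S) = ennreal m" by (simp add: m_def S.emeasure_eq_measure)
  have m: "m > 0" using sphere_measure_pos unfolding mS by simp
  obtain C where C: "C > 0" "\<And>n. (\<integral>\<^sup>+\<omega>. (visible_sphere n \<omega>)\<^sup>2 \<partial>M) \<le>
     ennreal (exp (- 2 * \<gamma> * \<kappa> * real n)) * ennreal C * emeasure sphere_measure (space ?S)"
    using second_moment_bound[OF sub] by blast
  have "m / C \<le> prob {\<omega> \<in> space M. 0 < visible_sphere n \<omega>}" for n
  proof -
    let ?F = "{\<omega> \<in> space M. 0 < visible_sphere n \<omega>}"
    define e where "e = exp (- \<gamma> * \<kappa> * real n)"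
    have e: "e > 0" by (simp add: e_def)
    have e2: "exp (- 2 * \<gamma> * \<kappa> * real n) = e\<^sup>2" by (simp add: e_def power2_eq_square exp_add[symmetric])
    note [measurable] = visible_sphere_measurable[of n]
    have F[measurable]: "?F \<in> events" by measurable
    have "(\<integral>\<^sup>+\<omega>. visible_sphere n \<omega> \<partial>M) = (\<integral>\<^sup>+\<omega>. visible_sphere n \<omega> * indicator ?F \<omega> \<partial>M)"
      by (intro nn_integral_cong) (auto simp: indicator_def)
    then have "(ennreal (e * m))\<^sup>2 = (\<integral>\<^sup>+\<omega>. visible_sphere n \<omega> * indicator ?F \<omega> \<partial>M)\<^sup>2"
      unfolding nn_integral_visible_sphere mS using e by (simp add: e_def ennreal_mult')
    also have "\<dots> \<le> (\<integral>\<^sup>+\<omega>. (visible_sphere n \<omega>)\<^sup>2 \<partial>M) * (\<integral>\<^sup>+\<omega>. (indicator ?F \<omega>)\<^sup>2 \<partial>M)"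
      by (rule Cauchy_Schwarz_nn_integral) measurable
    also have "(\<integral>\<^sup>+\<omega>. (indicator ?F \<omega>)\<^sup>2 \<partial>M) = (\<integral>\<^sup>+\<omega>. indicator ?F \<omega> \<partial>M)"
      by (intro nn_integral_cong) (auto simp: indicator_def)
    also have "\<dots> = ennreal (prob ?F)" using F by (simp add: emeasure_eq_measure)
    also have "(\<integral>\<^sup>+\<omega>. (visible_sphere n \<omega>)\<^sup>2 \<partial>M) * ennreal (prob ?F) \<le> ennreal (e\<^sup>2) * ennreal C * ennreal m * ennreal (prob ?F)"
      using C(2)[of n] unfolding e2 mS by (rule mult_right_mono) simp
    also have "\<dots> = ennreal (e\<^sup>2 * C * m * prob ?F)" using C m by (simp add: ennreal_mult'[symmetric] ennreal_mult''[symmetric])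
    finally have "(e * m)\<^sup>2 \<le> e\<^sup>2 * C * m * prob ?F"
      using C m e by (simp add: ennreal_power)
    then have "(e\<^sup>2 * m) * m \<le> (e\<^sup>2 * m) * (C * prob ?F)" by (simp add: power2_eq_square mult_ac)
    then have "m \<le> C * prob ?F" using e m by (simp add: mult_le_cancel_left_pos)
    then show ?thesis using C by (simp add: divide_le_eq mult.commute)
  qed
  then show ?thesis using m C by (intro that[of "m / C"]) auto
qed

text \<open>Because the region is star-shaped, the positivity events decrease in \<open>n\<close>.
  The uniform bound therefore passes to their intersection, where visible points exist at every
  distance.\<close>

lemma prob_unbounded_pos:
  assumes "\<gamma> < gamma_crit d"
  shows "prob {\<omega> \<in> space M. \<not> hyp_bounded (vis \<omega>)} > 0"
proof -
  have sub: "\<gamma> * \<kappa> < real d - 1"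
    using mult_strict_right_mono[OF assms kappa_pos] gamma_crit_cap_const[OF dim] by simp
  obtain p where p: "p > 0" "\<And>n. p \<le> prob {\<omega> \<in> space M. 0 < visible_sphere n \<omega>}"
    using prob_visible_sphere_pos[OF sub] by blast
  let ?F = "\<lambda>n. {\<omega> \<in> space M. 0 < visible_sphere n \<omega>}"
  have F: "?F n \<in> events" for n
    using visible_sphere_measurable[of n] by measurable
  have "visible_sphere (Suc n) \<omega> \<le> visible_sphere n \<omega>" for n \<omega>
    unfolding visible_sphere_def
  proof (intro nn_integral_mono)
    fix v :: 'a
    have t: "0 \<le> tanh (real n / 2)" "tanh (real n / 2) \<le> tanh (real (Suc n) / 2)" "0 < tanh (real (Suc n) / 2)" by simp_all
    have "tanh (real n / 2) *\<^sub>R v \<in> vis \<omega>" if "tanh (real (Suc n) / 2) *\<^sub>R v \<in> vis \<omega>"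
    proof -
      have "(tanh (real n / 2) / tanh (real (Suc n) / 2)) *\<^sub>R (tanh (real (Suc n) / 2) *\<^sub>R v) \<in> vis \<omega>"
        using t by (intro vis_star[OF that]) (auto simp: divide_le_eq_1)
      then show ?thesis using t by simp
    qed
    then show "indicator (vis \<omega>) (tanh (real (Suc n) / 2) *\<^sub>R v) \<le> (indicator (vis \<omega>) (tanh (real n / 2) *\<^sub>R v) :: ennreal)"
      by (simp add: indicator_def)
  qed
  then have dec: "decseq ?F" by (intro decseq_SucI) (auto intro: less_le_trans)
  have "(\<lambda>n. prob (?F n)) \<longlonglongrightarrow> prob (\<Inter>n. ?F n)"
    using F dec by (intro finite_Lim_measure_decseq) auto
  then have "p \<le> prob (\<Inter>n. ?F n)" using p(2) by (intro LIMSEQ_le_const) auto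
  also have "\<dots> \<le> prob {\<omega> \<in> space M. \<not> hyp_bounded (vis \<omega>)}"
  proof (rule finite_measure_mono)
    have "{\<omega> \<in> space M. \<not> hyp_bounded (vis \<omega>)} = space M - {\<omega> \<in> space M. hyp_bounded (vis \<omega>)}" by auto
    then show "{\<omega> \<in> space M. \<not> hyp_bounded (vis \<omega>)} \<in> events" using bounded_event by auto
    show "(\<Inter>n. ?F n) \<subseteq> {\<omega> \<in> space M. \<not> hyp_bounded (vis \<omega>)}"
    proof
      fix \<omega> assume w: "\<omega> \<in> (\<Inter>n. ?F n)"
      have "\<not> vis \<omega> \<subseteq> cball 0 (tanh (real n / 2))" for n
      proof
        assume sub: "vis \<omega> \<subseteq> cball 0 (tanh (real n / 2))"
        have "visible_sphere (Suc n) \<omega> = (\<integral>\<^sup>+v. 0 \<partial>(sphere_measure :: 'a measure))"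
          unfolding visible_sphere_def
        proof (intro nn_integral_cong)
          fix v :: 'a assume "v \<in> space sphere_measure"
          then have "norm v = 1" by (simp add: space_sphere_measure)
          then have "norm (tanh (real (Suc n) / 2) *\<^sub>R v) = tanh (real (Suc n) / 2)" by simp
          moreover have "tanh (real n / 2) < tanh (real (Suc n) / 2)" by simp
          ultimately have "tanh (real (Suc n) / 2) *\<^sub>R v \<notin> vis \<omega>" using sub by fastforce
          then show "indicator (vis \<omega>) (tanh (real (Suc n) / 2) *\<^sub>R v) = (0::ennreal)" by simp
        qed
        moreover have "0 < visible_sphere (Suc n) \<omega>" using w by blast
        ultimately show False by simp
      qed
      then show "\<omega> \<in> {\<omega> \<in> space M. \<not> hyp_bounded (vis \<omega>)}"
        using w hyp_bounded_iff[OF vis_subset, of \<omega>] by auto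
    qed
  qed
  finally show ?thesis using p by simp
qed

end

section \<open>The supercritical regime\<close>

text \<open>Hyperplanes that block, within distance \<open>m\<close>, all directions at distance at most \<open>exp (- m)\<close> from \<open>v\<close>. The chordal
  radius of the shadow of a hyperplane is about \<open>1 / amp lam s\<close>; of the margin \<open>5 exp (s - m)\<close>, one part
  is for that distance, the rest for the bound on the distance travelled.\<close>

definition margin_hits :: "real \<Rightarrow> real \<Rightarrow> 'a::euclidean_space \<Rightarrow> (real \<times> 'a) set" where
  "margin_hits lam m v = {(s, u). 0 < s \<and> s \<le> m - 2 \<and> norm u = 1 \<and> norm (u - v) \<le> (1 - 5 * exp (s - m)) / amp lam s}"

text \<open>Together with the cutoff \<open>s \<le> m - 2\<close> in \<open>margin_hits\<close> this
  keeps \<open>1 - 5 * exp (s - m)\<close> positive.\<close>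

lemma exp_minus_2: "5 * exp (- 2 :: real) < 1"
proof -
  have "(5/2::real) \<le> exp 1" using exp_lower_Taylor_quadratic[of "1::real"] by simp
  then have "(5/2::real)\<^sup>2 \<le> (exp 1)\<^sup>2" by (intro power_mono) auto
  also have "(exp 1)\<^sup>2 = exp (2::real)" by (simp add: power2_eq_square exp_add[symmetric])
  finally have "5 < exp (2::real)" by (simp add: power2_eq_square)
  then show ?thesis by (simp add: exp_minus field_simps)
qed

lemma sets_margin_hits:
  fixes v :: "'a::euclidean_space"
  shows "margin_hits lam m v \<in> sets (hyp_par lam)"
proof -
  have "{p \<in> space (borel \<Otimes>\<^sub>M borel :: (real \<times> 'a) measure). fst p \<le> m - 2 \<and> norm (snd p - v) \<le> (1 - 5 * exp (fst p - m)) / amp lam (fst p)} \<in> sets (borel \<Otimes>\<^sub>M borel)"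
    by measurable
  from this[unfolded borel_prod]
  have "{p :: real \<times> 'a. fst p \<le> m - 2 \<and> norm (snd p - v) \<le> (1 - 5 * exp (fst p - m)) / amp lam (fst p)} \<in> sets borel"
    by simp
  from sets_hyp_parI[OF this, of lam] show ?thesis
    by (rule back_subst[where P="\<lambda>X. X \<in> _"]) (auto simp: margin_hits_def)
qed

text \<open>Because \<open>amp lam s \<le> exp s\<close>, a displacement of \<open>exp (- m)\<close>
  is at most \<open>exp (s - m) / amp lam s\<close>: it spends one of the five units of
  margin.\<close>

lemma margin_hits_shift:
  assumes lam: "0 \<le> lam" "lam \<le> 1" and hit: "(s, u) \<in> margin_hits lam m v" and near: "norm (v - v') \<le> exp (- m)"
  shows "norm (u - v') \<le> (1 - 4 * exp (s - m)) / amp lam s"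
proof -
  have s: "0 < s" "norm (u - v) \<le> (1 - 5 * exp (s - m)) / amp lam s" using hit by (auto simp: margin_hits_def)
  have A: "1 \<le> amp lam s" "amp lam s \<le> exp s" using amp_bounds[OF lam, of s] s by auto
  have "exp (- m) * amp lam s \<le> exp (- m) * exp s" using A by (intro mult_left_mono) auto
  then have "exp (- m) \<le> exp (s - m) / amp lam s" using A by (simp add: exp_add[symmetric] pos_le_divide_eq)
  moreover have "norm (u - v') \<le> norm (u - v) + norm (v - v')" using norm_triangle_ineq[of "u - v" "v - v'"] by simp
  ultimately have "norm (u - v') \<le> (1 - 5 * exp (s - m)) / amp lam s + exp (s - m) / amp lam s"
    using s near by linarith
  also have "\<dots> = (1 - 4 * exp (s - m)) / amp lam s" by (simp add: add_divide_distrib[symmetric])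
  finally show ?thesis .
qed

text \<open>The four units left form the \<open>x\<close> that \<open>ray_hitsI\<close> asks for:
  \<open>(1 - x)\<^sup>2 \<le> 1 - x\<^sup>2\<close> on the unit interval, and
  \<open>exp s / sinh \<tau> \<le> x\<close> because
  \<open>sinh \<tau> \<ge> exp \<tau> / 4\<close>.\<close>

lemma margin_hits_subset_ray_hits:
  fixes v v' :: "'a::euclidean_space"
  assumes lam: "0 \<le> lam" "lam \<le> 1" and v': "norm v' = 1" and near: "norm (v - v') \<le> exp (- m)" and mt: "m \<le> \<tau>"
  shows "margin_hits lam m v \<subseteq> ray_hits lam \<tau> v'"
proof clarify
  fix s u assume hit: "(s, u) \<in> margin_hits lam m v"
  then have s: "0 < s" "s \<le> m - 2" "norm u = 1" by (auto simp: margin_hits_def)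
  have A: "1 \<le> amp lam s" using amp_bounds[OF lam, of s] s by auto
  define x where "x = 4 * exp (s - m)"
  have e: "exp (s - m) \<le> exp (- 2)" using s by simp
  have x: "0 \<le> x" "x \<le> 1" unfolding x_def using exp_minus_2 e exp_gt_zero[of "s - m"] by linarith+
  have n: "norm (u - v') \<le> (1 - x) / amp lam s" using margin_hits_shift[OF lam hit near] by (simp add: x_def)
  define c where "c = u \<bullet> v'"
  have nc: "(norm (u - v'))\<^sup>2 = 2 - 2 * c" using norm_diff_unit[OF s(3) v'] by (simp add: c_def)
  have "(1 - x) / amp lam s \<le> 1" using A x by (simp add: divide_le_eq_1)
  then have "norm (u - v') \<le> 1" using n by linarith
  then have "(norm (u - v'))\<^sup>2 \<le> 1" by (simp add: power_le_one)
  then have c0: "0 < c" using nc by simp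
  \<comment> \<open>This is the comparison of the squared sine \<open>1 - c\<^sup>2\<close> with the
    squared chord \<open>2 - 2 * c\<close>.\<close>
  have "0 \<le> (1 - c) * (1 - c)" by simp
  then have "1 - c\<^sup>2 \<le> (norm (u - v'))\<^sup>2" unfolding nc by (simp add: power2_eq_square algebra_simps)
  then have "(1 - c\<^sup>2) * (amp lam s)\<^sup>2 \<le> (norm (u - v'))\<^sup>2 * (amp lam s)\<^sup>2" by (rule mult_right_mono) simp
  also have "\<dots> = (norm (u - v') * amp lam s)\<^sup>2" by (simp add: power_mult_distrib)
  also have "\<dots> \<le> (1 - x)\<^sup>2"
    using n A by (intro power_mono) (auto simp: pos_le_divide_eq)
  also have "\<dots> \<le> 1 - x\<^sup>2"
    using mult_right_mono[OF x(2) x(1)] by (simp add: power2_eq_square algebra_simps)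
  also have "\<dots> \<le> 1 - (exp s / sinh \<tau>)\<^sup>2"
  proof -
    have t2: "2 \<le> \<tau>" using s mt by simp
    have "exp \<tau> / 4 \<le> sinh \<tau>"
    proof -
      have "exp (- \<tau>) \<le> 1" using t2 by simp
      moreover have "2 \<le> exp \<tau>" using exp_ge_add_one_self[of \<tau>] t2 by linarith
      moreover have "sinh \<tau> = (exp \<tau> - exp (- \<tau>)) / 2" by (simp add: sinh_field_def)
      moreover have "e / 4 \<le> (e - f) / 2" if "f \<le> 1" "2 \<le> e" for e f :: real
        using that by (simp add: field_simps)
      ultimately show ?thesis by metis
    qed
    then have "exp s / sinh \<tau> \<le> exp s / (exp \<tau> / 4)" using t2 by (intro divide_left_mono mult_pos_pos) auto
    also have "\<dots> = 4 * exp (s - \<tau>)" by (simp add: exp_diff)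
    also have "\<dots> \<le> x" using mt by (simp add: x_def)
    finally have "(exp s / sinh \<tau>)\<^sup>2 \<le> x\<^sup>2" using t2 by (intro power_mono) auto
    then show ?thesis by simp
  qed
  finally show "(s, u) \<in> ray_hits lam \<tau> v'"
    using s c0 mt by (intro ray_hitsI[OF lam]) (auto simp: c_def)
qed

text \<open>Raising the scale by 1 shrinks the required margin by a factor e, which more than
  restores the unit spent on the shift. In the critical case this yields hyperplanes common to two
  grid points.\<close>

lemma margin_hits_subset:
  fixes v v' :: "'a::euclidean_space"
  assumes lam: "0 \<le> lam" "lam \<le> 1" and near: "norm (v - v') \<le> exp (- m)" and mn: "m + 1 \<le> n"
  shows "margin_hits lam m v \<subseteq> margin_hits lam n v'"
proof clarify
  fix s u assume hit: "(s, u) \<in> margin_hits lam m v"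
  then have s: "0 < s" "s \<le> m - 2" "norm u = 1" by (auto simp: margin_hits_def)
  have A: "1 \<le> amp lam s" using amp_bounds[OF lam, of s] s by auto
  have "norm (u - v') \<le> (1 - 4 * exp (s - m)) / amp lam s" by (rule margin_hits_shift[OF lam hit near])
  also have "\<dots> \<le> (1 - 5 * exp (s - n)) / amp lam s"
  proof (intro divide_right_mono)
    have "2 * exp (s - n) \<le> exp 1 * exp (s - n)" using exp_ge_add_one_self[of 1] by (intro mult_right_mono) auto
    also have "\<dots> = exp (s - n + 1)" by (simp add: exp_add)
    also have "\<dots> \<le> exp (s - m)" using mn by simp
    finally have "5 * exp (s - n) \<le> 4 * exp (s - m)" using exp_gt_zero[of "s - n"] by linarith
    then show "1 - 4 * exp (s - m) \<le> 1 - 5 * exp (s - n)" by simp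
  qed (use A in simp)
  finally show "(s, u) \<in> margin_hits lam n v'" using s mn by (simp add: margin_hits_def)
qed

text \<open>A cap of chordal radius \<rho> has squared sine exactly
  \<open>\<rho>\<^sup>2 * (1 - \<rho>\<^sup>2 / 4)\<close>. The square root is avoided by squaring
  the second factor, which is at most 1.\<close>

lemma emeasure_sphere_cap_ge:
  fixes v :: "'a::euclidean_space"
  assumes d: "DIM('a) \<ge> 2" and v: "norm v = 1" and \<rho>: "0 < \<rho>" "\<rho> \<le> 1"
  shows "ennreal (cap_const DIM('a) * (\<rho> * (1 - \<rho>\<^sup>2 / 4)) ^ (DIM('a) - 1)) \<le> emeasure sphere_measure {u \<in> sphere 0 1. norm (u - v) \<le> \<rho>}"
proof -
  define c where "c = 1 - \<rho>\<^sup>2 / 2"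
  have r2: "\<rho>\<^sup>2 \<le> 1" "\<rho>\<^sup>2 > 0" using \<rho> by (simp_all add: abs_square_le_1)
  then have c: "0 < c" "c < 1" by (simp_all add: c_def)
  have y: "0 \<le> 1 - \<rho>\<^sup>2 / 4" "1 - \<rho>\<^sup>2 / 4 \<le> 1" using r2 by simp_all
  have "(1 - \<rho>\<^sup>2 / 4)\<^sup>2 \<le> 1 - \<rho>\<^sup>2 / 4"
    unfolding power2_eq_square[of "1 - \<rho>\<^sup>2 / 4"] using mult_left_mono[OF y(2) y(1)] by simp
  then have "(\<rho> * (1 - \<rho>\<^sup>2 / 4))\<^sup>2 \<le> \<rho>\<^sup>2 * (1 - \<rho>\<^sup>2 / 4)" unfolding power_mult_distrib by (intro mult_left_mono) auto
  also have "\<dots> = 1 - c\<^sup>2" by (simp add: c_def power2_eq_square algebra_simps)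
  finally have "\<rho> * (1 - \<rho>\<^sup>2 / 4) \<le> sqrt (1 - c\<^sup>2)" by (rule real_le_rsqrt)
  then have "cap_const DIM('a) * (\<rho> * (1 - \<rho>\<^sup>2 / 4)) ^ (DIM('a) - 1) \<le> cap_const DIM('a) * sqrt (1 - c\<^sup>2) ^ (DIM('a) - 1)"
    using y \<rho> cap_const_pos[of "DIM('a)"] d by (intro mult_left_mono power_mono) auto
  also have "\<dots> \<le> cap_measure DIM('a) c" using c by (intro cap_measure_ge d) auto
  finally have "ennreal (cap_const DIM('a) * (\<rho> * (1 - \<rho>\<^sup>2 / 4)) ^ (DIM('a) - 1)) \<le> ennreal (cap_measure DIM('a) c)"
    by (rule ennreal_leI)
  also have "\<dots> = emeasure sphere_measure {u \<in> sphere 0 1. c \<le> u \<bullet> v}"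
    by (rule emeasure_sphere_measure_cap[OF v c, symmetric])
  also have "{u \<in> sphere 0 1. c \<le> u \<bullet> v} = {u \<in> sphere 0 1. norm (u - v) \<le> \<rho>}"
    unfolding c_def using \<rho> by (intro sphere_cap_eq[OF v, symmetric]) simp
  finally show ?thesis .
qed

text \<open>Per unit of \<open>s\<close> the measure falls short of \<kappa> by at most \<kappa>(d -
  1) times the margin 5 exp (s - m) plus the curvature term exp (-2 s). The integrals of both stay
  bounded as \<open>m\<close> grows, and 6 is a generous bound; the 2 is the omitted range of
  \<open>s\<close> above m - 2.\<close>

lemma margin_hits_measure_ge:
  fixes v :: "'a::euclidean_space"
  assumes d: "DIM('a) \<ge> 2" and lam: "0 \<le> lam" "lam \<le> 1" and v: "norm v = 1"
  shows "emeasure (hyp_par lam) (margin_hits lam m v) \<noteq> \<infinity>"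
    and "cap_const DIM('a) * (m - 2 - 6 * real (DIM('a) - 1)) \<le> measure (hyp_par lam) (margin_hits lam m v)"
proof -
  let ?W = "margin_hits lam m v" and ?\<mu> = "hyp_par lam :: (real \<times> 'a) measure"
  define K where "K = cap_const DIM('a)"
  define n where "n = DIM('a) - 1"
  have K: "K > 0" using d by (simp add: K_def cap_const_pos)
  show fin: "emeasure ?\<mu> ?W \<noteq> \<infinity>"
  proof -
    have "emeasure ?\<mu> ?W \<le> emeasure ?\<mu> (ray_hits lam (max 0 m) v)"
      using v by (intro emeasure_mono margin_hits_subset_ray_hits sets_ray_hits lam) auto
    then show ?thesis using emeasure_ray_hits[OF d lam v, of "max 0 m"] by (auto simp: top_unique)
  qed
  show "cap_const DIM('a) * (m - 2 - 6 * real (DIM('a) - 1)) \<le> measure (hyp_par lam) (margin_hits lam m v)"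
  proof (cases "m \<le> 2")
    case True
    then have "K * (m - 2 - 6 * real n) \<le> 0" using K by (intro mult_nonneg_nonpos) auto
    then show ?thesis unfolding K_def n_def using measure_nonneg order_trans by blast
  next
    case False
    define f where "f s = K * real n * (5 * exp (s - m) + exp (- 2 * s))" for s
    have f0: "f s \<ge> 0" for s using K by (simp add: f_def)
    have [measurable]: "f \<in> borel_measurable borel" unfolding f_def[abs_def] by measurable
    \<comment> \<open>The shortfall \<open>f\<close> is added on the right and not subtracted on the
      left, since the integrals take values in \<open>ennreal\<close>.\<close>
    have pt: "indicator {0<..<m - 2} s * ennreal K \<le>
       indicator {0<..} s * (ennreal (amp lam s ^ n) * emeasure sphere_measure {u \<in> sphere 0 1. (s, u) \<in> ?W})
       + indicator {0<..<m - 2} s * ennreal (f s)" for s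
    proof (cases "0 < s \<and> s < m - 2")
      case True
      then have s: "0 < s" "s < m - 2" by auto
      have A: "1 \<le> amp lam s" "exp s / 2 \<le> amp lam s" using amp_bounds[OF lam, of s] s by auto
      define x where "x = 5 * exp (s - m)"
      have e: "exp (s - m) \<le> exp (- 2)" using s by simp
      have x: "0 < x" "x < 1" unfolding x_def using exp_minus_2 e exp_gt_zero[of "s - m"] by linarith+
      define \<rho> where "\<rho> = (1 - x) / amp lam s"
      have \<rho>: "0 < \<rho>" "\<rho> \<le> 1" "\<rho> \<le> 1 / amp lam s"
        using A x by (simp_all add: \<rho>_def divide_le_eq_1 divide_right_mono)
      define t where "t = amp lam s * (\<rho> * (1 - \<rho>\<^sup>2 / 4))"
      have tx: "t = (1 - x) * (1 - \<rho>\<^sup>2 / 4)" using A by (simp add: t_def \<rho>_def)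
      have "\<rho>\<^sup>2 \<le> (1 / amp lam s)\<^sup>2" using \<rho> by (intro power_mono) auto
      also have "\<dots> \<le> (2 * exp (- s))\<^sup>2"
      proof (intro power_mono)
        show "1 / amp lam s \<le> 2 * exp (- s)" using A by (simp add: exp_minus field_simps)
      qed (use A in simp)
      also have "\<dots> = 4 * exp (- 2 * s)" by (simp add: power_mult_distrib power2_eq_square exp_add[symmetric])
      finally have r4: "\<rho>\<^sup>2 / 4 \<le> exp (- 2 * s)" by simp
      have "0 \<le> x * (\<rho>\<^sup>2 / 4)" using x by simp
      then have "1 - x - exp (- 2 * s) \<le> t" using r4 unfolding tx by (simp add: algebra_simps)
      then have t1: "- (x + exp (- 2 * s)) \<le> t - 1" by simp
      have "\<rho>\<^sup>2 \<le> 1" using \<rho> by (simp add: abs_square_le_1)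
      then have t0: "0 \<le> t" using x unfolding tx by simp
      \<comment> \<open>Bernoulli's inequality converts the relative loss of radius into
        \<open>n\<close> times that loss of cap measure.\<close>
      have "1 - real n * (x + exp (- 2 * s)) \<le> 1 + real n * (t - 1)"
        using mult_left_mono[OF t1, of "real n"] by (simp only: mult_minus_right) linarith
      also have "\<dots> \<le> (1 + (t - 1)) ^ n" using t0 by (intro Bernoulli_inequality) simp
      finally have "1 \<le> t ^ n + real n * (x + exp (- 2 * s))" by simp
      then have "K * 1 \<le> K * (t ^ n + real n * (x + exp (- 2 * s)))" using K by (intro mult_left_mono) auto
      also have "\<dots> = amp lam s ^ n * (K * (\<rho> * (1 - \<rho>\<^sup>2 / 4)) ^ n) + f s"
        by (simp add: t_def f_def x_def power_mult_distrib distrib_left mult_ac)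
      finally have "ennreal K \<le> ennreal (amp lam s ^ n * (K * (\<rho> * (1 - \<rho>\<^sup>2 / 4)) ^ n) + f s)" by (simp add: ennreal_leI)
      also have "\<dots> = ennreal (amp lam s ^ n) * ennreal (K * (\<rho> * (1 - \<rho>\<^sup>2 / 4)) ^ n) + ennreal (f s)"
        using A K \<rho> \<open>\<rho>\<^sup>2 \<le> 1\<close> f0 by (subst ennreal_plus) (auto simp: ennreal_mult' intro!: mult_nonneg_nonneg zero_le_power)
      also have "\<dots> \<le> ennreal (amp lam s ^ n) * emeasure sphere_measure {u \<in> sphere 0 1. (s, u) \<in> ?W} + ennreal (f s)"
      proof (intro add_right_mono mult_left_mono)
        have "{u \<in> sphere 0 1. (s, u) \<in> ?W} = {u \<in> sphere 0 1. norm (u - v) \<le> \<rho>}"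
          using s by (auto simp: margin_hits_def \<rho>_def x_def)
        then show "ennreal (K * (\<rho> * (1 - \<rho>\<^sup>2 / 4)) ^ n) \<le> emeasure sphere_measure {u \<in> sphere 0 1. (s, u) \<in> ?W}"
          using emeasure_sphere_cap_ge[OF d v \<rho>(1,2)] by (simp only: K_def n_def)
      qed simp
      finally show ?thesis using s by (simp only: indicator_simps greaterThanLessThan_iff greaterThan_iff) simp
    qed simp
    have sec: "(\<lambda>s. indicator {0<..} s * (ennreal (amp lam s ^ n) * emeasure sphere_measure {u \<in> sphere 0 1. (s, u) \<in> ?W})) \<in> borel_measurable lborel"
    proof -
      interpret finite_measure "sphere_measure :: 'a measure" by (rule finite_measure_sphere_measure)
      have "?W \<in> sets (restrict_space lborel {0<..} \<Otimes>\<^sub>M (sphere_measure :: 'a measure))"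
        using sets_margin_hits[of lam m v] by (simp add: hyp_par_def)
      from measurable_emeasure_Pair[OF this]
      have "(\<lambda>s. emeasure sphere_measure (Pair s -` ?W)) \<in> borel_measurable (restrict_space lborel {0<..})" .
      moreover have "Pair s -` ?W = {u \<in> sphere 0 1. (s, u) \<in> ?W}" for s by (auto simp: margin_hits_def)
      ultimately have "(\<lambda>s. emeasure sphere_measure {u \<in> sphere 0 1. (s, u) \<in> ?W}) \<in> borel_measurable (restrict_space lborel {0<..})"
        by (simp only:)
      moreover have "{0<..} \<inter> space lborel \<in> sets (lborel :: real measure)" by simp
      ultimately have "(\<lambda>s. emeasure sphere_measure {u \<in> sphere 0 1. (s, u) \<in> ?W} * indicator {0<..} s) \<in> borel_measurable lborel"
        by (simp only: borel_measurable_restrict_space_iff_ennreal)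
      from borel_measurable_times_ennreal[OF _ this, of "\<lambda>s. ennreal (amp lam s ^ n)"]
      have "(\<lambda>s. ennreal (amp lam s ^ n) * (emeasure sphere_measure {u \<in> sphere 0 1. (s, u) \<in> ?W} * indicator {0<..} s)) \<in> borel_measurable lborel"
        by simp
      then show ?thesis by (simp only: mult_ac)
    qed
    have "ennreal (K * (m - 2)) = (\<integral>\<^sup>+s. indicator {0<..<m - 2} s * ennreal K \<partial>lborel)"
      using False K by (simp add: mult.commute[of "indicator _ _"] nn_integral_cmult_indicator ennreal_mult'')
    also have "\<dots> \<le> (\<integral>\<^sup>+s. indicator {0<..} s * (ennreal (amp lam s ^ n) * emeasure sphere_measure {u \<in> sphere 0 1. (s, u) \<in> ?W})
       + indicator {0<..<m - 2} s * ennreal (f s) \<partial>lborel)"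
      by (rule nn_integral_mono) (rule pt)
    also have "\<dots> = emeasure ?\<mu> ?W + (\<integral>\<^sup>+s. indicator {0<..<m - 2} s * ennreal (f s) \<partial>lborel)"
      unfolding emeasure_hyp_par[OF sets_margin_hits] n_def[symmetric] by (rule nn_integral_add[OF sec]) measurable
    also have "(\<integral>\<^sup>+s. indicator {0<..<m - 2} s * ennreal (f s) \<partial>lborel)
       = ennreal (K * real n * (5 * exp (m - 2 - m) - exp (- 2 * (m - 2)) / 2) - K * real n * (5 * exp (0 - m) - exp (- 2 * 0) / 2))"
      using False by (intro nn_integral_FTC_Ioo continuous_intros f0)
        (auto simp: f_def intro!: derivative_eq_intros)
    also have "\<dots> \<le> ennreal (K * (6 * real n))"
    proof (intro ennreal_leI)
      have "(5 * exp (m - 2 - m) - exp (- 2 * (m - 2)) / 2) - (5 * exp (0 - m) - exp (- 2 * 0) / 2) \<le> 6"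
      proof -
        have "exp (m - 2 - m) = exp (- 2 :: real)" "exp (- 2 * 0 :: real) = 1" by simp_all
        then show ?thesis
          using exp_minus_2 exp_gt_zero[of "- 2 * (m - 2)"] exp_gt_zero[of "0 - m"] by linarith
      qed
      then have "K * real n * ((5 * exp (m - 2 - m) - exp (- 2 * (m - 2)) / 2) - (5 * exp (0 - m) - exp (- 2 * 0) / 2)) \<le> K * real n * 6"
        using K by (intro mult_left_mono) auto
      then show "K * real n * (5 * exp (m - 2 - m) - exp (- 2 * (m - 2)) / 2) - K * real n * (5 * exp (0 - m) - exp (- 2 * 0) / 2) \<le> K * (6 * real n)"
        by (simp add: right_diff_distrib mult_ac)
    qed
    finally have "ennreal (K * (m - 2)) \<le> emeasure ?\<mu> ?W + ennreal (K * (6 * real n))" by (simp add: add_left_mono)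
    also have "\<dots> = ennreal (measure ?\<mu> ?W + K * (6 * real n))"
      using fin K by (simp add: emeasure_eq_ennreal_measure)
    finally have "K * (m - 2) \<le> measure ?\<mu> ?W + K * (6 * real n)"
      using K by (simp add: ennreal_le_iff ennreal_plus[symmetric] del: ennreal_plus)
    then have "K * (m - 2 - 6 * real n) \<le> measure ?\<mu> ?W" by (simp add: right_diff_distrib)
    then show ?thesis by (simp only: K_def n_def)
  qed
qed

text \<open>A \<rho>-separated set of maximal size is a net, as otherwise a point could be added.
  Its size is bounded by packing: the caps of radius \<rho> / 3 about its points are disjoint, and
  each has measure at least of order \<rho>^(d - 1).\<close>

lemma finite_sphere_net:
  assumes d: "DIM('a::euclidean_space) \<ge> 2"
  shows "\<exists>C>0. \<forall>\<rho>. 0 < \<rho> \<longrightarrow> \<rho> \<le> 1 \<longrightarrow> (\<exists>N::'a set. finite N \<and> N \<subseteq> sphere 0 1 \<and>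
     (\<forall>v\<in>sphere 0 1. \<exists>w\<in>N. norm (w - v) \<le> \<rho>) \<and> real (card N) * \<rho> ^ (DIM('a) - 1) \<le> C)"
proof -
  let ?S = "sphere_measure :: 'a measure"
  interpret finite_measure ?S by (rule finite_measure_sphere_measure)
  define n where "n = DIM('a) - 1"
  define K where "K = cap_const DIM('a)"
  have K: "K > 0" using d by (simp add: K_def cap_const_pos)
  define m where "m = measure ?S (space ?S)"
  define C where "C = (m + 1) * 6 ^ n / K"
  have m: "m \<ge> 0" by (simp add: m_def)
  have C: "C > 0" using K m by (simp add: C_def)
  have "\<exists>N::'a set. finite N \<and> N \<subseteq> sphere 0 1 \<and> (\<forall>v\<in>sphere 0 1. \<exists>w\<in>N. norm (w - v) \<le> \<rho>) \<and> real (card N) * \<rho> ^ n \<le> C"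
    if \<rho>: "0 < \<rho>" "\<rho> \<le> 1" for \<rho>
  proof -
    define sep where "sep N \<longleftrightarrow> finite N \<and> N \<subseteq> sphere (0::'a) 1 \<and> (\<forall>v\<in>N. \<forall>w\<in>N. v \<noteq> w \<longrightarrow> \<rho> < norm (v - w))" for N
    let ?c = "\<lambda>w. {u \<in> sphere 0 1. norm (u - w) \<le> \<rho> / 3} :: 'a set"
    have bound: "real (card N) * \<rho> ^ n \<le> C" if N: "sep N" for N
    proof -
      have disj: "disjoint_family_on ?c N"
      proof (unfold disjoint_family_on_def, intro ballI impI equals0I)
        fix v w u assume vw: "v \<in> N" "w \<in> N" "v \<noteq> w" and "u \<in> ?c v \<inter> ?c w"
        then have "norm (u - v) \<le> \<rho> / 3" "norm (u - w) \<le> \<rho> / 3" by auto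
        moreover have "norm (v - w) \<le> norm (u - v) + norm (u - w)"
          using norm_triangle_ineq4[of "u - w" "u - v"] by simp
        moreover have "\<rho> < norm (v - w)" using N vw by (auto simp: sep_def)
        ultimately show False using \<rho> by simp
      qed
      have each: "K * (\<rho> / 6) ^ n \<le> measure ?S (?c w)" if "w \<in> N" for w
      proof -
        have w: "norm w = 1" using N that by (auto simp: sep_def)
        have "(\<rho> / 3)\<^sup>2 \<le> 1" using \<rho> by (intro power_le_one) auto
        then have "(\<rho> / 3) * (1/2) \<le> (\<rho> / 3) * (1 - (\<rho> / 3)\<^sup>2 / 4)" using \<rho> by (intro mult_left_mono) auto
        then have "(\<rho> / 6) ^ n \<le> (\<rho> / 3 * (1 - (\<rho> / 3)\<^sup>2 / 4)) ^ n" using \<rho> by (intro power_mono) auto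
        then have "K * (\<rho> / 6) ^ n \<le> K * (\<rho> / 3 * (1 - (\<rho> / 3)\<^sup>2 / 4)) ^ n" using K by (intro mult_left_mono) auto
        then have "ennreal (K * (\<rho> / 6) ^ n) \<le> ennreal (K * (\<rho> / 3 * (1 - (\<rho> / 3)\<^sup>2 / 4)) ^ n)" by (rule ennreal_leI)
        also have "\<dots> \<le> emeasure ?S (?c w)"
          unfolding K_def n_def using \<rho> by (intro emeasure_sphere_cap_ge d w) auto
        finally show ?thesis by (simp only: emeasure_eq_measure ennreal_le_iff measure_nonneg)
      qed
      have "real (card N) * (K * (\<rho> / 6) ^ n) \<le> (\<Sum>w\<in>N. measure ?S (?c w))"
        using each by (intro sum_bounded_below) auto
      also have "\<dots> = measure ?S (\<Union>w\<in>N. ?c w)"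
        using N disj sets_sphere_cap by (intro finite_measure_finite_Union[symmetric]) (auto simp only: sep_def image_subset_iff)
      also have "\<dots> \<le> m" unfolding m_def by (rule bounded_measure)
      finally have le: "real (card N) * (K * (\<rho> / 6) ^ n) \<le> m" .
      have "real (card N) * \<rho> ^ n = real (card N) * (K * (\<rho> / 6) ^ n) * (6 ^ n / K)"
        using K by (simp add: power_divide)
      also have "\<dots> \<le> (m + 1) * (6 ^ n / K)" using le K by (intro mult_right_mono) auto
      finally show ?thesis by (simp add: C_def)
    qed
    have bdd: "card N \<le> nat \<lfloor>C / \<rho> ^ n\<rfloor>" if "sep N" for N
    proof -
      have "real (card N) \<le> C / \<rho> ^ n" using bound[OF that] \<rho> by (simp add: pos_le_divide_eq)
      then show ?thesis by (simp add: le_nat_floor)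
    qed
    define k where "k = Max (card ` {N. sep N})"
    have fin: "finite (card ` {N. sep N})"
      by (rule finite_subset[of _ "{.. nat \<lfloor>C / \<rho> ^ n\<rfloor>}"]) (auto simp: bdd)
    have "sep {}" by (simp add: sep_def)
    then have "k \<in> card ` {N. sep N}" unfolding k_def using fin by (intro Max_in) auto
    then obtain N where N: "sep N" "card N = k" by auto
    have "\<exists>w\<in>N. norm (w - v) \<le> \<rho>" if v: "v \<in> sphere 0 1" for v
    proof (rule ccontr)
      assume *: "\<not> (\<exists>w\<in>N. norm (w - v) \<le> \<rho>)"
      then have "v \<notin> N" using \<rho> by force
      moreover have "sep (insert v N)"
        using N(1) * v by (auto simp: sep_def not_le norm_minus_commute)
      then have "card (insert v N) \<le> k" unfolding k_def using fin by (intro Max_ge) auto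
      moreover have "finite N" using N by (simp add: sep_def)
      ultimately show False using N by simp
    qed
    then show ?thesis using N bound[OF N(1)] by (auto simp: sep_def)
  qed
  then show ?thesis unfolding n_def[symmetric] by (intro exI[of _ C] conjI C) simp
qed

section \<open>Union bounds over blocked caps\<close>

context hyperplane_process begin

text \<open>An existence statement over uncountably many directions; \<open>AE_boundedI\<close>
  therefore bounds it through measurable supersets.\<close>

definition reaches :: "real \<Rightarrow> 'w \<Rightarrow> bool" where
  "reaches \<tau> \<omega> \<longleftrightarrow> (\<exists>v\<in>sphere 0 1. tanh (\<tau> / 2) *\<^sub>R v \<in> vis \<omega>)"

lemma unbounded_reaches:
  assumes "\<omega> \<in> space M" "\<not> hyp_bounded (vis \<omega>)"
  shows "reaches (real n) \<omega>"
proof -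
  have "\<not> vis \<omega> \<subseteq> cball 0 (tanh (real n / 2))" using assms hyp_bounded_iff[OF vis_subset] by blast
  then obtain y where "y \<in> vis \<omega>" "y \<notin> cball 0 (tanh (real n / 2))" by blast
  then have y: "y \<in> vis \<omega>" "tanh (real n / 2) < norm y" by simp_all
  have t: "0 \<le> tanh (real n / 2)" by simp
  have y0: "norm y > 0" using y t by linarith
  have "(tanh (real n / 2) / norm y) *\<^sub>R y \<in> vis \<omega>"
    using y y0 t by (intro vis_star) (auto simp: divide_le_eq_1)
  then have "tanh (real n / 2) *\<^sub>R sgn y \<in> vis \<omega>"
    unfolding sgn_div_norm scaleR_scaleR divide_real_def .
  then show ?thesis using y0 by (auto simp: reaches_def norm_sgn intro!: bexI[of _ "sgn y"])
qed

lemma margin_event: "void (margin_hits lam m v) \<in> events"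
  by (intro void_event sets_margin_hits)

lemma prob_margin_le:
  fixes v :: 'a
  assumes v: "norm v = 1"
  shows "prob (void (margin_hits lam m v)) \<le> exp (\<gamma> * \<kappa> * (2 + 6 * real (d - 1))) * exp (- \<gamma> * \<kappa> * m)"
proof -
  have le: "\<kappa> * (m - 2 - 6 * real (d - 1)) \<le> measure (hyp_par lam) (margin_hits lam m v)"
    unfolding d_eq using dim by (intro margin_hits_measure_ge lam v) (simp add: d_eq)
  have "emeasure (hyp_par lam) (margin_hits lam m v) \<noteq> \<infinity>"
    using dim by (intro margin_hits_measure_ge lam v) (simp add: d_eq)
  then have "prob (void (margin_hits lam m v)) = exp (- \<gamma> * measure (hyp_par lam) (margin_hits lam m v))"
    by (intro prob_void sets_margin_hits) (simp add: less_top)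
  also have "\<dots> \<le> exp (- \<gamma> * (\<kappa> * (m - 2 - 6 * real (d - 1))))" using le gamma by simp
  also have "\<dots> = exp (\<gamma> * \<kappa> * (2 + 6 * real (d - 1))) * exp (- \<gamma> * \<kappa> * m)"
    by (simp add: exp_add[symmetric] algebra_simps)
  finally show ?thesis .
qed

text \<open>This replaces all directions near \<open>x\<close> by a single void event.\<close>

lemma reaches_margin:
  assumes w: "\<omega> \<in> space M" and v: "norm v = 1" "tanh (\<tau> / 2) *\<^sub>R v \<in> vis \<omega>" and tau: "0 \<le> \<tau>"
    and near: "norm (x - v) \<le> exp (- \<tau>)"
  shows "\<omega> \<in> void (margin_hits lam \<tau> x)"
proof -
  have "\<omega> \<in> void (ray_hits lam \<tau> v)" using vis_ray_iff[OF w v(1) tau] v by simp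
  moreover have "margin_hits lam \<tau> x \<subseteq> ray_hits lam \<tau> v"
    by (rule margin_hits_subset_ray_hits[OF lam v(1) near order_refl])
  ultimately show ?thesis by (auto simp: void_def)
qed

lemma AE_boundedI:
  assumes "\<And>\<epsilon>. \<epsilon> > 0 \<Longrightarrow> \<exists>n. \<exists>A\<in>events. {\<omega> \<in> space M. reaches (real n) \<omega>} \<subseteq> A \<and> prob A \<le> \<epsilon>"
  shows "AE \<omega> in M. hyp_bounded (vis \<omega>)"
proof -
  let ?U = "{\<omega> \<in> space M. \<not> hyp_bounded (vis \<omega>)}"
  have "?U = space M - {\<omega> \<in> space M. hyp_bounded (vis \<omega>)}" by auto
  then have U: "?U \<in> events" using bounded_event by auto
  have "prob ?U \<le> \<epsilon>" if \<epsilon>: "\<epsilon> > 0" for \<epsilon>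
  proof -
    obtain n A where A: "A \<in> events" "{\<omega> \<in> space M. reaches (real n) \<omega>} \<subseteq> A" "prob A \<le> \<epsilon>"
      using assms[OF \<epsilon>] by blast
    have "?U \<subseteq> A" using A unbounded_reaches by auto
    then show ?thesis using A finite_measure_mono[OF _ A(1), of ?U] by simp
  qed
  then have "prob ?U \<le> 0" by (rule field_le_epsilon[of _ 0, simplified])
  then have "prob ?U = 0" using measure_nonneg[of M ?U] by linarith
  then have "?U \<in> null_sets M" using U by (auto simp: emeasure_eq_measure)
  then show ?thesis by (rule AE_I'[where N="?U"]) auto
qed

lemma AE_bounded_supercritical:
  assumes "\<gamma> > gamma_crit d"
  shows "AE \<omega> in M. hyp_bounded (vis \<omega>)"
proof (rule AE_boundedI)
  fix \<epsilon> :: real assume \<epsilon>: "\<epsilon> > 0"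
  define p where "p = d - 1"
  have "\<gamma> * \<kappa> > real d - 1"
    using mult_strict_right_mono[OF assms kappa_pos] gamma_crit_cap_const[OF dim] by simp
  then have sup: "\<gamma> * \<kappa> - real p > 0" using dim by (simp add: p_def)
  obtain C where C: "C > 0" "\<forall>\<rho>. 0 < \<rho> \<longrightarrow> \<rho> \<le> 1 \<longrightarrow> (\<exists>N::'a set. finite N \<and> N \<subseteq> sphere 0 1 \<and>
     (\<forall>v\<in>sphere 0 1. \<exists>w\<in>N. norm (w - v) \<le> \<rho>) \<and> real (card N) * \<rho> ^ p \<le> C)"
    using finite_sphere_net[where 'a='a, OF dim[unfolded d_eq], folded d_eq, folded p_def] by (elim exE conjE)
  define E where "E = exp (\<gamma> * \<kappa> * (2 + 6 * real (d - 1)))"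
  have E: "E > 0" by (simp add: E_def)
  have "((\<lambda>n. C * E * exp (- (\<gamma> * \<kappa> - real p)) ^ n) \<longlongrightarrow> C * E * 0) sequentially"
    using sup by (intro tendsto_mult tendsto_const LIMSEQ_realpow_zero) auto
  then have "\<forall>\<^sub>F n in sequentially. C * E * exp (- (\<gamma> * \<kappa> - real p)) ^ n < \<epsilon>"
    using \<epsilon> by (intro order_tendstoD(2)) auto
  then obtain n where n: "C * E * exp (- (\<gamma> * \<kappa> - real p)) ^ n < \<epsilon>"
    using eventually_happens by force
  obtain N :: "'a set" where N: "finite N" "N \<subseteq> sphere 0 1" "\<forall>v\<in>sphere 0 1. \<exists>w\<in>N. norm (w - v) \<le> exp (- real n)"
    "real (card N) * exp (- real n) ^ p \<le> C"
    using C(2)[rule_format, of "exp (- real n)"] by auto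
  let ?A = "\<Union>w\<in>N. void (margin_hits lam (real n) w)"
  have "?A \<in> events" using N margin_event by (intro sets.finite_UN) auto
  moreover have "{\<omega> \<in> space M. reaches (real n) \<omega>} \<subseteq> ?A"
  proof
    fix \<omega> assume "\<omega> \<in> {\<omega> \<in> space M. reaches (real n) \<omega>}"
    then obtain v where v: "\<omega> \<in> space M" "norm v = 1" "tanh (real n / 2) *\<^sub>R v \<in> vis \<omega>" by (auto simp: reaches_def)
    from v(2) have "v \<in> sphere 0 1" by simp
    then obtain w where "w \<in> N" "norm (w - v) \<le> exp (- real n)" using N(3) by blast
    then show "\<omega> \<in> ?A" using reaches_margin[OF v] by auto
  qed
  moreover have "prob ?A \<le> \<epsilon>"
  proof -
    have "prob ?A \<le> (\<Sum>w\<in>N. prob (void (margin_hits lam (real n) w)))"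
      using N margin_event by (intro finite_measure_subadditive_finite) auto
    also have "\<dots> \<le> (\<Sum>w\<in>N. E * exp (- \<gamma> * \<kappa> * real n))"
      unfolding E_def using N by (intro sum_mono prob_margin_le) auto
    also have "\<dots> = (real (card N) * exp (- real n) ^ p) * (E * exp (- (\<gamma> * \<kappa> - real p)) ^ n)"
    proof -
      have "exp (- real n) ^ p * exp (- (\<gamma> * \<kappa> - real p)) ^ n = exp (- \<gamma> * \<kappa> * real n)"
        by (simp add: exp_of_nat_mult[symmetric] exp_add[symmetric] algebra_simps)
      then show ?thesis by (simp add: mult_ac)
    qed
    also have "\<dots> \<le> C * (E * exp (- (\<gamma> * \<kappa> - real p)) ^ n)"
      using N(4) E by (intro mult_right_mono) auto
    finally show ?thesis using n by (simp add: mult.assoc)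
  qed
  ultimately show "\<exists>n. \<exists>A\<in>events. {\<omega> \<in> space M. reaches (real n) \<omega>} \<subseteq> A \<and> prob A \<le> \<epsilon>" by blast
qed

end

section \<open>The critical case in dimension two\<close>

definition circle_point :: "'a::euclidean_space \<Rightarrow> 'a \<Rightarrow> real \<Rightarrow> 'a" where
  "circle_point e f \<phi> = cos \<phi> *\<^sub>R e + sin \<phi> *\<^sub>R f"

locale orthonormal_pair =
  fixes e f :: "'a::euclidean_space"
  assumes ef: "norm e = 1" "norm f = 1" "e \<bullet> f = 0"
begin

abbreviation "c \<equiv> circle_point e f"

lemma inner_circle_point: "c a \<bullet> c b = cos (a - b)"
  using ef by (simp add: circle_point_def inner_add_left inner_add_right inner_commute norm_eq_1 cos_diff)

lemma norm_circle_point: "norm (c a) = 1"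
  using inner_circle_point[of a a] by (simp add: norm_eq_1)

lemma norm_circle_point_diff: "norm (c a - c b) \<le> \<bar>a - b\<bar>"
proof -
  have "(norm (c a - c b))\<^sup>2 = 2 - 2 * cos (a - b)"
    using norm_diff_unit[OF norm_circle_point norm_circle_point] by (simp add: inner_circle_point)
  also have "cos (a - b) = cos (2 * ((a - b) / 2))" by (simp only: mult_2 field_sum_of_halves)
  also have "\<dots> = 1 - 2 * (sin ((a - b) / 2))\<^sup>2" by (rule cos_double_sin)
  also have "2 - 2 * (1 - 2 * (sin ((a - b) / 2))\<^sup>2) = 4 * \<bar>sin ((a - b) / 2)\<bar>\<^sup>2" by simp
  also have "\<dots> \<le> 4 * \<bar>(a - b) / 2\<bar>\<^sup>2"
    by (intro mult_left_mono power_mono abs_sin_x_le_abs_x) auto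
  also have "\<dots> = \<bar>a - b\<bar>\<^sup>2" by (simp add: power_divide)
  finally show ?thesis by (rule power2_le_imp_le) simp
qed

text \<open>A cap meets the circle in an arc. Indeed \<open>c b\<close> is a positive combination of
  \<open>c a\<close> and \<open>c b'\<close> with coefficients of sum at least 1, by subadditivity
  of the sine; so the condition \<open>t \<le> u \<bullet> c x\<close> is inherited, as
  \<open>t\<close> is positive for r \<le> 1. An arc shorter than pi keeps all sines
  positive.\<close>

lemma circle_point_between:
  assumes u: "norm u = 1" and r: "0 \<le> r" "r \<le> 1" and ab: "a < b" "b < b'" "b' - a < pi"
    and near: "norm (u - c a) \<le> r" "norm (u - c b') \<le> r"
  shows "norm (u - c b) \<le> r"
proof -
  define t where "t = 1 - r\<^sup>2 / 2"
  have "r\<^sup>2 \<le> 1" using r by (simp add: power_le_one)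
  then have t: "t > 0" by (simp add: t_def)
  have iff: "norm (u - c x) \<le> r \<longleftrightarrow> t \<le> u \<bullet> c x" for x
    using sphere_cap_eq[OF norm_circle_point r(1), of x] u by (auto simp: t_def)
  have s: "sin (b' - b) > 0" "sin (b - a) > 0" "sin (b' - a) > 0" using ab by (auto intro!: sin_gt_zero)
  have le: "sin (b' - a) \<le> sin (b' - b) + sin (b - a)"
  proof -
    have "sin (b' - a) = sin ((b' - b) + (b - a))" by simp
    also have "\<dots> = sin (b' - b) * cos (b - a) + cos (b' - b) * sin (b - a)" by (rule sin_add)
    also have "\<dots> \<le> sin (b' - b) * 1 + 1 * sin (b - a)"
      using s by (intro add_mono mult_left_mono mult_right_mono) auto
    finally show ?thesis by simp
  qed
  have eq: "sin (b' - a) *\<^sub>R c b = sin (b' - b) *\<^sub>R c a + sin (b - a) *\<^sub>R c b'"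
  proof -
    have 1: "sin (b' - a) * cos b = sin (b' - b) * cos a + sin (b - a) * cos b'"
      and 2: "sin (b' - a) * sin b = sin (b' - b) * sin a + sin (b - a) * sin b'"
      by (simp_all add: sin_diff algebra_simps)
    have "sin (b' - a) *\<^sub>R c b = (sin (b' - a) * cos b) *\<^sub>R e + (sin (b' - a) * sin b) *\<^sub>R f"
      by (simp add: circle_point_def scaleR_add_right)
    then show ?thesis unfolding 1 2 by (simp add: circle_point_def scaleR_add_right scaleR_add_left)
  qed
  have "t * sin (b' - a) \<le> t * (sin (b' - b) + sin (b - a))" using le t by (intro mult_left_mono) auto
  also have "\<dots> \<le> sin (b' - b) * (u \<bullet> c a) + sin (b - a) * (u \<bullet> c b')"
    using near s unfolding iff distrib_left by (intro add_mono) (simp_all add: mult.commute mult_left_mono)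
  also have "\<dots> = u \<bullet> (sin (b' - a) *\<^sub>R c b)" unfolding eq by (simp add: inner_add_right)
  also have "\<dots> = (u \<bullet> c b) * sin (b' - a)" by simp
  finally have "t \<le> u \<bullet> c b" using s by (simp add: mult_le_cancel_right)
  then show ?thesis by (simp add: iff)
qed

end

section \<open>Independence and the first uncovered grid point\<close>

context hyperplane_process begin

lemma prob_void_fmeasurable:
  "A \<in> fmeasurable (hyp_par lam) \<Longrightarrow> prob (void A) = exp (- \<gamma> * measure (hyp_par lam) A)"
  by (intro prob_void) (auto simp: fmeasurable_def)

lemma void_event_fmeasurable: "A \<in> fmeasurable (hyp_par lam) \<Longrightarrow> void A \<in> events"
  by (intro void_event) (auto simp: fmeasurable_def)

text \<open>By inclusion-exclusion, void probabilities alone give the independence of what the process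
  does on disjoint sets.\<close>

lemma void_hit_indep:
  assumes "finite I" and B: "B \<in> fmeasurable (hyp_par lam)" and D: "D \<in> fmeasurable (hyp_par lam)"
    and C: "\<And>i. i \<in> I \<Longrightarrow> C i \<in> fmeasurable (hyp_par lam)"
    and disj: "B \<inter> D = {}" "\<And>i. i \<in> I \<Longrightarrow> C i \<inter> D = {}"
  shows "prob (void (B \<union> D) - (\<Union>i\<in>I. void (C i))) = prob (void B - (\<Union>i\<in>I. void (C i))) * exp (- \<gamma> * measure (hyp_par lam) D)"
  using assms
proof (induction I arbitrary: B rule: finite_induct)
  case empty
  have "measure (hyp_par lam) (B \<union> D) = measure (hyp_par lam) B + measure (hyp_par lam) D"
    using empty by (intro measure_Un_AE) auto
  moreover have "B \<union> D \<in> fmeasurable (hyp_par lam)" using empty by (intro fmeasurable.Un)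
  ultimately show ?case using empty by (simp add: prob_void_fmeasurable exp_add[symmetric] algebra_simps)
next
  case (insert i I)
  let ?U = "\<Union>i\<in>I. void (C i)"
  \<comment> \<open>Removing one more void event replaces \<open>X\<close> by
    \<open>C i \<union> X\<close> in a difference of two probabilities; this is why \<open>B\<close>
    is arbitrary in the induction.\<close>
  have step: "prob (void X - (\<Union>i\<in>insert i I. void (C i))) = prob (void X - ?U) - prob (void (C i \<union> X) - ?U)"
    if X: "X \<in> fmeasurable (hyp_par lam)" for X
  proof -
    have "void X - (\<Union>i\<in>insert i I. void (C i)) = (void X - ?U) - (void (C i \<union> X) - ?U)"
      by (auto simp: void_Un)
    also have "prob \<dots> = prob (void X - ?U) - prob (void (C i \<union> X) - ?U)"
      using insert X by (intro finite_measure_Diff sets.Diff sets.finite_UN void_event_fmeasurable fmeasurable.Un)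
        (auto simp: void_Un)
    finally show ?thesis .
  qed
  have un: "C i \<union> (B \<union> D) = (C i \<union> B) \<union> D" by auto
  have "prob (void (B \<union> D) - (\<Union>i\<in>insert i I. void (C i)))
      = prob (void (B \<union> D) - ?U) - prob (void ((C i \<union> B) \<union> D) - ?U)"
    using step[of "B \<union> D"] insert.prems unfolding un by (simp add: fmeasurable.Un)
  also have "prob (void (B \<union> D) - ?U) = prob (void B - ?U) * exp (- \<gamma> * measure (hyp_par lam) D)"
    using insert.prems by (intro insert.IH) auto
  also have "prob (void ((C i \<union> B) \<union> D) - ?U) = prob (void (C i \<union> B) - ?U) * exp (- \<gamma> * measure (hyp_par lam) D)"
    using insert.prems by (intro insert.IH fmeasurable.Un) auto
  finally show ?case
    using step[of B] insert.prems by (simp add: left_diff_distrib)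
qed

lemma margin_fmeasurable: "norm v = 1 \<Longrightarrow> margin_hits lam m (v::'a) \<in> fmeasurable (hyp_par lam)"
  using margin_hits_measure_ge(1)[OF _ lam, of v m] dim
  by (intro fmeasurableI sets_margin_hits) (simp_all add: d_eq less_top)

text \<open>The hyperplanes blocking both \<open>x j\<close> and \<open>x (j + l)\<close> have
  measure at least \<kappa>(n - ln l - 8), so those blocking only the second have at most
  \<kappa>(ln l + 8), and \<gamma>\<kappa> = 1 gives a void probability of order 1 / l. First points
  are sought among the first L indices but uncovered ones counted up to 2 L, so that every j has L
  successors. The loss 8 = 2 + 6 of \<open>margin_hits_measure_ge\<close> enters twice, hence exp
  16.\<close>

lemma first_uncovered_bound:
  fixes x :: "nat \<Rightarrow> 'a" and L n :: nat
  assumes two: "d = 2" and crit: "\<gamma> * \<kappa> = 1"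
    and x: "\<And>i. norm (x i) = 1" "\<And>i j. norm (x i - x j) \<le> \<bar>real i - real j\<bar> * exp (- real n)"
    and between: "\<And>i j k. i < j \<Longrightarrow> j < k \<Longrightarrow> k < 2 * L \<Longrightarrow>
       margin_hits lam (real n) (x i) \<inter> margin_hits lam (real n) (x k) \<subseteq> margin_hits lam (real n) (x j)"
    and L: "exp (real n) \<le> real L" "real L \<le> 2 * exp (real n)" and n: "2 \<le> n"
  shows "prob (\<Union>i<L. void (margin_hits lam (real n) (x i))) * (real n - 3/2) \<le> 4 * exp 16"
proof -
  let ?\<mu> = "hyp_par lam :: (real \<times> 'a) measure"
  define C where "C i = margin_hits lam (real n) (x i)" for i
  have Cm: "C i \<in> fmeasurable ?\<mu>" for i unfolding C_def using x by (intro margin_fmeasurable)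
  have Ce: "void (C i) \<in> events" for i by (rule void_event_fmeasurable[OF Cm])
  define F where "F = disjointed (\<lambda>i. void (C i))"
  have F_eq: "F j = void (C j) - (\<Union>i<j. void (C i))" for j
    by (simp add: F_def disjointed_def atLeast0LessThan)
  have Fe: "F j \<in> events" for j unfolding F_eq using Ce by (intro sets.Diff sets.finite_UN) auto
  have disj: "disjoint_family F" unfolding F_def by (rule disjoint_family_disjointed)
  have FU: "(\<Union>j<L. F j) = (\<Union>j<L. void (C j))"
    using finite_UN_disjointed_eq[of "\<lambda>i. void (C i)" L] by (simp add: F_def atLeast0LessThan)
  have pk: "prob (void (C k)) \<le> exp 8 * exp (- real n)" for k
    using prob_margin_le[OF x(1)[of k], of "real n"] crit two by (simp add: C_def)
  \<comment> \<open>\<open>F j\<close> says that \<open>x j\<close> is the first uncovered point. A hyperplane covering \<open>x (j + l)\<close> but not \<open>x j\<close>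
    covers no earlier point, hence does not influence \<open>F j\<close>.\<close>
  have ratio: "prob (F j \<inter> void (C (j + l))) \<ge> prob (F j) * (exp (- 8) / real l)"
    if j: "j < L" and l: "3 \<le> l" "l \<le> L" for j l
  proof -
    let ?k = "j + l"
    \<comment> \<open>At this scale the bound l exp (-n) on the distance of the two points equals
      exp (-m), so \<open>margin_hits_subset\<close> applies to both of them.\<close>
    define m where "m = real n - ln (real l)"
    \<comment> \<open>The restriction l \<ge> 3 gives ln l \<ge> 1, the gap between scales that
      \<open>margin_hits_subset\<close> requires.\<close>
    have "exp 1 \<le> real l" using e_less_272 l by linarith
    then have l1: "1 \<le> ln (real l)" using l by (simp add: ln_ge_iff)
    have em: "exp (- m) = real l * exp (- real n)" using l by (simp add: m_def exp_diff exp_minus field_simps)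
    have "margin_hits lam m (x j) \<subseteq> C j \<inter> C ?k"
      unfolding C_def using x(2)[of j j] x(2)[of j ?k] l1 em
      by (intro Int_greatest margin_hits_subset lam) (auto simp: m_def)
    then have "measure ?\<mu> (margin_hits lam m (x j)) \<le> measure ?\<mu> (C j \<inter> C ?k)"
      using Cm margin_fmeasurable[OF x(1)] by (intro measure_mono_fmeasurable fmeasurable_Int_fmeasurable) (auto simp: fmeasurable_def)
    moreover have "\<kappa> * (m - 8) \<le> measure ?\<mu> (margin_hits lam m (x j))"
      using margin_hits_measure_ge(2)[OF _ lam x(1)[of j], of m] two d_eq by simp
    ultimately have inter: "\<kappa> * (m - 8) \<le> measure ?\<mu> (C j \<inter> C ?k)" by simp
    have "measure ?\<mu> (C ?k) \<le> measure ?\<mu> (ray_hits lam (real n) (x ?k))"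
      unfolding C_def using x(1) ray_hits_finite[of "x ?k" "real n"]
      by (intro measure_mono_fmeasurable margin_hits_subset_ray_hits lam fmeasurableI sets_ray_hits sets_margin_hits) auto
    also have "\<dots> = \<kappa> * real n"
      using ray_hits_finite[OF x(1)[of ?k], of "real n"] kappa_pos by (simp add: measure_def)
    finally have up: "measure ?\<mu> (C ?k) \<le> \<kappa> * real n" .
    have "measure ?\<mu> (C ?k - C j) = measure ?\<mu> (C ?k) - measure ?\<mu> (C ?k \<inter> C j)"
    proof -
      have "measure ?\<mu> ((C ?k - C j) \<union> (C ?k \<inter> C j)) = measure ?\<mu> (C ?k - C j) + measure ?\<mu> (C ?k \<inter> C j)"
        using Cm by (intro measure_Un_AE fmeasurable_Diff fmeasurable_Int_fmeasurable) (auto simp: fmeasurable_def)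
      moreover have "(C ?k - C j) \<union> (C ?k \<inter> C j) = C ?k" by auto
      ultimately show ?thesis by simp
    qed
    then have "measure ?\<mu> (C ?k - C j) \<le> \<kappa> * (ln (real l) + 8)"
      using up inter by (simp add: Int_commute m_def algebra_simps)
    then have "\<gamma> * measure ?\<mu> (C ?k - C j) \<le> \<gamma> * (\<kappa> * (ln (real l) + 8))"
      using gamma by (intro mult_left_mono) auto
    also have "\<dots> = ln (real l) + 8" using crit by (simp add: mult.assoc[symmetric])
    finally have le: "- (ln (real l) + 8) \<le> - \<gamma> * measure ?\<mu> (C ?k - C j)" by simp
    have "exp (- 8) / real l = exp (- (ln (real l) + 8))"
      using l by (simp add: exp_diff exp_minus field_simps)
    also have "\<dots> \<le> exp (- \<gamma> * measure ?\<mu> (C ?k - C j))" using le by simp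
    finally have "prob (F j) * (exp (- 8) / real l) \<le> prob (F j) * exp (- \<gamma> * measure ?\<mu> (C ?k - C j))"
      by (intro mult_left_mono) auto
    also have "\<dots> = prob (void (C j \<union> (C ?k - C j)) - (\<Union>i<j. void (C i)))"
    proof -
      have "C i \<inter> (C ?k - C j) = {}" if "i \<in> {..<j}" for i
        using between[of i j ?k] that j l unfolding C_def by fastforce
      then show ?thesis unfolding F_eq
        using Cm by (intro void_hit_indep[symmetric] fmeasurable_Diff) auto
    qed
    also have "void (C j \<union> (C ?k - C j)) - (\<Union>i<j. void (C i)) = F j \<inter> void (C ?k)"
      unfolding F_eq by (auto simp: void_def)
    finally show ?thesis .
  qed
  define G where "G = (\<Union>j<L. void (C j))"
  define h where "h = (\<Sum>l\<in>{3..L}. 1 / real l)"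
  have PG: "prob G = (\<Sum>j<L. prob (F j))"
    unfolding G_def FU[symmetric] using Fe disj
    by (intro finite_measure_finite_Union) (auto intro: disjoint_family_on_mono)
  have "prob G * (exp (- 8) * h) = (\<Sum>j<L. \<Sum>l\<in>{3..L}. prob (F j) * (exp (- 8) / real l))"
    unfolding PG sum_distrib_right by (intro sum.cong refl) (simp add: h_def sum_distrib_left)
  also have "\<dots> \<le> (\<Sum>j<L. \<Sum>l\<in>{3..L}. prob (F j \<inter> void (C (j + l))))"
    by (intro sum_mono ratio) auto
  \<comment> \<open>Indexing by k = j + l lets the sums be exchanged. For fixed \<open>k\<close> the
    events \<open>F j\<close> are disjoint, so the inner sum is at most one void
    probability.\<close>
  also have "\<dots> \<le> (\<Sum>j<L. \<Sum>k<2 * L. prob (F j \<inter> void (C k)))"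
  proof (rule sum_mono)
    fix j assume j: "j \<in> {..<L}"
    have "(\<Sum>l\<in>{3..L}. prob (F j \<inter> void (C (j + l)))) = (\<Sum>k\<in>(+) j ` {3..L}. prob (F j \<inter> void (C k)))"
      by (subst sum.reindex) (auto simp: inj_on_def)
    also have "\<dots> \<le> (\<Sum>k<2 * L. prob (F j \<inter> void (C k)))"
      using j by (intro sum_mono2) auto
    finally show "(\<Sum>l\<in>{3..L}. prob (F j \<inter> void (C (j + l)))) \<le> (\<Sum>k<2 * L. prob (F j \<inter> void (C k)))" .
  qed
  also have "\<dots> = (\<Sum>k<2 * L. \<Sum>j<L. prob (F j \<inter> void (C k)))" by (rule sum.swap)
  also have "\<dots> \<le> (\<Sum>k<2 * L. exp 8 * exp (- real n))"
  proof (rule sum_mono)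
    fix k
    have "(\<Sum>j<L. prob (F j \<inter> void (C k))) = prob (\<Union>j<L. F j \<inter> void (C k))"
    proof (rule finite_measure_finite_Union[symmetric])
      show "disjoint_family_on (\<lambda>j. F j \<inter> void (C k)) {..<L}"
      proof (unfold disjoint_family_on_def, intro ballI impI)
        fix i j :: nat assume "i \<noteq> j"
        then have "F i \<inter> F j = {}" using disjoint_family_onD[OF disj] by simp
        then show "(F i \<inter> void (C k)) \<inter> (F j \<inter> void (C k)) = {}" by auto
      qed
    qed (use Fe Ce in auto)
    also have "\<dots> \<le> prob (void (C k))" using Ce by (intro finite_measure_mono) auto
    also have "\<dots> \<le> exp 8 * exp (- real n)" by (rule pk)
    finally show "(\<Sum>j<L. prob (F j \<inter> void (C k))) \<le> exp 8 * exp (- real n)" .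
  qed
  also have "\<dots> = 2 * real L * (exp 8 * exp (- real n))" by simp
  also have "\<dots> \<le> 2 * (2 * exp (real n)) * (exp 8 * exp (- real n))" using L by (intro mult_right_mono) auto
  also have "\<dots> = 4 * exp 8" by (simp add: exp_minus)
  finally have main: "prob G * (exp (- 8) * h) \<le> 4 * exp 8" .
  \<comment> \<open>The harmonic number \<open>harm L\<close> is at least ln (L + 1) \<ge> n; the
    two omitted terms 1 and 1/2 account for 3/2.\<close>
  have h: "real n - 3/2 \<le> h"
  proof -
    have L3: "3 \<le> L"
    proof -
      have "3 \<le> exp (real n)" using exp_ge_add_one_self[of "real n"] n by linarith
      then show ?thesis using L by linarith
    qed
    have "real n \<le> ln (real L)" using L L3 by (simp add: ln_ge_iff)
    also have "\<dots> \<le> ln (real L + 1)" using L3 by simp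
    also have "\<dots> \<le> harm L" by (rule ln_le_harm)
    also have "harm L = (\<Sum>l\<in>{1..2} \<union> {3..L}. 1 / real l)"
      unfolding harm_def using L3 by (intro sum.cong) (auto simp: inverse_eq_divide)
    also have "\<dots> = (\<Sum>l\<in>{1..2}. 1 / real l) + h" unfolding h_def by (intro sum.union_disjoint) auto
    also have "{1..2} = {1, 2::nat}" by auto
    finally have "real n \<le> (\<Sum>l\<in>{1, 2::nat}. 1 / real l) + h" .
    then show ?thesis by simp
  qed
  have "prob G * (real n - 3/2) \<le> prob G * h" using h by (intro mult_left_mono) auto
  also have "\<dots> = exp 8 * (prob G * (exp (- 8) * h))" by (simp add: exp_minus)
  also have "\<dots> \<le> exp 8 * (4 * exp 8)" using main by (intro mult_left_mono) auto
  also have "\<dots> = 4 * exp 16" by (simp add: exp_add[symmetric])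
  finally show ?thesis by (simp add: G_def C_def)
qed

text \<open>Seven unit arcs cover the circle, as 2 pi < 7. Each grid covers one arc and is continued
  to about twice that length for \<open>first_uncovered_bound\<close>. The whole circle cannot be
  treated at once, because \<open>circle_point_between\<close> is confined to arcs shorter than
  pi.\<close>

lemma AE_bounded_critical:
  assumes two: "d = 2" and crit: "\<gamma> = gamma_crit d"
  shows "AE \<omega> in M. hyp_bounded (vis \<omega>)"
proof (rule AE_boundedI)
  fix \<epsilon> :: real assume \<epsilon>: "\<epsilon> > 0"
  have gk: "\<gamma> * \<kappa> = 1" using gamma_crit_cap_const[OF dim] two crit by simp
  have "card (Basis :: 'a set) = 2" using two d_eq by simp
  then obtain e f :: 'a where basis: "Basis = {e, f}" "e \<noteq> f" by (auto simp: card_2_iff)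
  then have "e \<in> Basis" "f \<in> Basis" by auto
  then interpret orthonormal_pair e f
    using basis by unfold_locales (auto simp: inner_Basis)
  have param: "\<exists>\<phi>\<ge>0. \<phi> < 2 * pi \<and> v = c \<phi>" if "norm v = 1" for v :: 'a
  proof -
    have vv: "v = (v \<bullet> e) *\<^sub>R e + (v \<bullet> f) *\<^sub>R f"
    proof -
      have "v = (\<Sum>b\<in>{e, f}. (v \<bullet> b) *\<^sub>R b)" unfolding basis(1)[symmetric] by (rule euclidean_representation[symmetric])
      then show ?thesis using basis(2) by simp
    qed
    have "(norm v)\<^sup>2 = (v \<bullet> e)\<^sup>2 + (v \<bullet> f)\<^sup>2"
      unfolding power2_norm_eq_inner euclidean_inner[of v v] basis(1) using basis(2) by (simp add: power2_eq_square)
    then have "(v \<bullet> e)\<^sup>2 + (v \<bullet> f)\<^sup>2 = 1" using that by simp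
    then obtain t where "0 \<le> t" "t < 2 * pi" "v \<bullet> e = cos t" "v \<bullet> f = sin t" by (rule sincos_total_2pi)
    then show ?thesis using vv by (intro exI[of _ t]) (auto simp: circle_point_def)
  qed
  \<comment> \<open>The factor 28 is 7 * 4: seven arcs, each allowed \<epsilon> / 7 against the
    bound 4 exp 16.\<close>
  obtain n :: nat where n: "2 + 28 * exp 16 / \<epsilon> \<le> real n" using real_arch_simple by blast
  have n2: "2 \<le> n" "28 * exp 16 / \<epsilon> \<le> real n - 3/2"
  proof -
    have "0 < 28 * exp 16 / \<epsilon>" using \<epsilon> by simp
    then show "2 \<le> n" "28 * exp 16 / \<epsilon> \<le> real n - 3/2" using n by linarith+
  qed
  define \<delta> where "\<delta> = exp (- real n)"
  have e3: "3 \<le> exp (real n)" using exp_ge_add_one_self[of "real n"] n2 by linarith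
  have \<delta>: "0 < \<delta>" "\<delta> \<le> 1/3" "exp (real n) * \<delta> = 1" using e3 by (simp_all add: \<delta>_def exp_minus divide_simps)
  define L where "L = nat \<lceil>exp (real n)\<rceil>"
  have L: "exp (real n) \<le> real L" "real L \<le> exp (real n) + 1"
    using exp_gt_zero[of "real n"] by (auto simp: L_def)
  have L2: "real L \<le> 2 * exp (real n)" using L e3 by linarith
  define x where "x a i = c (real a + real i * \<delta>)" for a i :: nat
  let ?C = "\<lambda>a i. margin_hits lam (real n) (x a i)"
  let ?A = "\<Union>a\<in>{..<7}. \<Union>i<L. void (?C a i)"
  have Ae: "?A \<in> events" using margin_event by (intro sets.finite_UN) auto
  have each: "prob (\<Union>i<L. void (?C a i)) \<le> \<epsilon> / 7" for a
  proof -
    have "prob (\<Union>i<L. void (?C a i)) * (real n - 3/2) \<le> 4 * exp 16"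
    proof (rule first_uncovered_bound[OF two gk _ _ _ L(1) L2 n2(1)])
      show "norm (x a i) = 1" for i by (simp add: x_def norm_circle_point)
      show "norm (x a i - x a j) \<le> \<bar>real i - real j\<bar> * exp (- real n)" for i j
      proof -
        have "norm (x a i - x a j) \<le> \<bar>(real a + real i * \<delta>) - (real a + real j * \<delta>)\<bar>"
          unfolding x_def by (rule norm_circle_point_diff)
        also have "\<dots> = \<bar>(real i - real j) * \<delta>\<bar>" by (simp add: left_diff_distrib)
        finally show ?thesis using \<delta>(1) by (simp add: abs_mult \<delta>_def)
      qed
      show "?C a i \<inter> ?C a k \<subseteq> ?C a j" if "i < j" "j < k" "k < 2 * L" for i j k
      proof clarify
        fix s u assume h: "(s, u) \<in> ?C a i" "(s, u) \<in> ?C a k"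
        then have s: "0 < s" "s \<le> real n - 2" "norm u = 1" by (auto simp: margin_hits_def)
        have A: "1 \<le> amp lam s" using amp_bounds[OF lam, of s] s by simp
        have "exp (s - real n) \<le> exp (- 2)" using s by simp
        then have "0 \<le> 1 - 5 * exp (s - real n)" "1 - 5 * exp (s - real n) \<le> 1"
          using exp_minus_2 exp_gt_zero[of "s - real n"] by linarith+
        then have r: "0 \<le> (1 - 5 * exp (s - real n)) / amp lam s" "(1 - 5 * exp (s - real n)) / amp lam s \<le> 1"
          using A exp_gt_zero[of "s - real n"] by (simp, simp only: divide_le_eq_1, linarith)
        \<comment> \<open>The continued grid has length at most 2 + 2 \<delta>, and \<delta> \<le>
          1/3 keeps this below 3.\<close>
        have "real k * \<delta> - real i * \<delta> < pi"
        proof -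
          have "real k * \<delta> \<le> (2 * real L) * \<delta>" using that \<delta>(1) by (intro mult_right_mono) auto
          also have "\<dots> \<le> (2 * (exp (real n) + 1)) * \<delta>" using L(2) \<delta>(1) by (intro mult_right_mono) auto
          also have "\<dots> = 2 + 2 * \<delta>" using \<delta>(3) by (simp add: algebra_simps)
          finally have "real k * \<delta> \<le> 2 + 2 * \<delta>" .
          moreover have "0 \<le> real i * \<delta>" using \<delta>(1) by simp
          ultimately show ?thesis using \<delta>(2) pi_gt3 by linarith
        qed
        then have d3: "(real a + real k * \<delta>) - (real a + real i * \<delta>) < pi" by linarith
        have d12: "real a + real i * \<delta> < real a + real j * \<delta>" "real a + real j * \<delta> < real a + real k * \<delta>"
          using that \<delta>(1) by simp_all
        have "norm (u - x a i) \<le> (1 - 5 * exp (s - real n)) / amp lam s" "norm (u - x a k) \<le> (1 - 5 * exp (s - real n)) / amp lam s"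
          using h by (simp_all only: margin_hits_def mem_Collect_eq prod.case)
        then have "norm (u - x a j) \<le> (1 - 5 * exp (s - real n)) / amp lam s"
          unfolding x_def by (rule circle_point_between[OF s(3) r d12 d3])
        then show "(s, u) \<in> ?C a j" using s by (simp add: margin_hits_def)
      qed
    qed
    moreover have "4 * exp 16 \<le> \<epsilon> / 7 * (real n - 3/2)"
      using n2(2) \<epsilon> by (simp add: pos_divide_le_eq mult.commute)
    ultimately have "prob (\<Union>i<L. void (?C a i)) * (real n - 3/2) \<le> \<epsilon> / 7 * (real n - 3/2)" by linarith
    moreover have "0 < real n - 3/2" using n2(1) by linarith
    ultimately show ?thesis by (simp add: mult_le_cancel_right)
  qed
  have "prob ?A \<le> (\<Sum>a\<in>{..<7}. prob (\<Union>i<L. void (?C a i)))"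
    using margin_event by (intro finite_measure_subadditive_finite) (auto intro!: sets.finite_UN)
  also have "\<dots> \<le> (\<Sum>a\<in>{..<7::nat}. \<epsilon> / 7)" by (intro sum_mono each)
  also have "\<dots> = \<epsilon>" by simp
  finally have "prob ?A \<le> \<epsilon>" .
  moreover have "{\<omega> \<in> space M. reaches (real n) \<omega>} \<subseteq> ?A"
  proof
    fix \<omega> assume "\<omega> \<in> {\<omega> \<in> space M. reaches (real n) \<omega>}"
    then obtain v where v: "\<omega> \<in> space M" "norm v = 1" "tanh (real n / 2) *\<^sub>R v \<in> vis \<omega>" by (auto simp: reaches_def)
    obtain \<phi> where \<phi>: "0 \<le> \<phi>" "\<phi> < 2 * pi" "v = c \<phi>" using param[OF v(2)] by blast
    define a where "a = nat \<lfloor>\<phi>\<rfloor>"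
    have a: "real a \<le> \<phi>" "\<phi> < real a + 1" using \<phi> by (simp_all add: a_def)
    have "2 * pi < 7" using pi_approx by simp
    then have "real a < 7" using a \<phi> by linarith
    then have a7: "a < 7" by simp
    define i where "i = nat \<lfloor>(\<phi> - real a) / \<delta>\<rfloor>"
    have q0: "0 \<le> (\<phi> - real a) / \<delta>" using a \<delta> by simp
    then have i: "real i \<le> (\<phi> - real a) / \<delta>" "(\<phi> - real a) / \<delta> < real i + 1"
      unfolding i_def by (simp_all add: of_nat_nat)
    have i1: "real i * \<delta> \<le> \<phi> - real a" "\<phi> - real a < (real i + 1) * \<delta>"
      using i \<delta>(1) by (simp_all add: pos_le_divide_eq pos_divide_less_eq)
    have "real i * \<delta> < exp (real n) * \<delta>" using i1 a \<delta>(3) by linarith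
    then have "real i < exp (real n)" using \<delta>(1) by simp
    then have iL: "i < L" using L(1) by linarith
    have "norm (x a i - v) \<le> \<bar>(real a + real i * \<delta>) - \<phi>\<bar>"
      unfolding x_def \<phi>(3) by (rule norm_circle_point_diff)
    also have "\<dots> \<le> exp (- real n)" using i1 unfolding \<delta>_def[symmetric] by (simp add: distrib_right)
    finally have "\<omega> \<in> void (?C a i)" by (intro reaches_margin[OF v]) auto
    then show "\<omega> \<in> ?A" using a7 iL by blast
  qed
  ultimately show "\<exists>n. \<exists>A\<in>events. {\<omega> \<in> space M. reaches (real n) \<omega>} \<subseteq> A \<and> prob A \<le> \<epsilon>" using Ae by blast
qed

end

lemma hyperplane_process_intro:
  fixes \<eta> :: "'w \<Rightarrow> 'a::euclidean_space set set"
  assumes "d = DIM('a)" "2 \<le> d" "0 < \<gamma>" "0 \<le> lam" "lam \<le> 1" "poisson_hyperplane_process M \<gamma> lam \<eta>"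
  shows "hyperplane_process M \<gamma> lam \<eta> d"
proof -
  have "prob_space M"
    using assms(6) by (simp add: poisson_hyperplane_process_def poisson_process_def)
  then show ?thesis
    using assms by (intro hyperplane_process.intro hyperplane_process_axioms.intro)
qed

theorem theorem1p1:
  fixes M :: "'w measure" and \<eta> :: "'w \<Rightarrow> 'a::euclidean_space set set"
    and \<gamma> lam :: real and d :: nat
  assumes "d = DIM('a)" and "d \<ge> 2" and "\<gamma> > 0" and "0 \<le> lam" and "lam \<le> 1"
    and "poisson_hyperplane_process M \<gamma> lam \<eta>"
  shows
    "(\<gamma> < gamma_crit d \<longrightarrow> \<P>(\<omega> in M. \<not> hyp_bounded (visibility_region (\<eta> \<omega>))) > 0) \<and>
     (\<gamma> > gamma_crit d \<longrightarrow> (AE \<omega> in M. hyp_bounded (visibility_region (\<eta> \<omega>)))) \<and>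
     (d = 2 \<and> \<gamma> = gamma_crit d \<longrightarrow> (AE \<omega> in M. hyp_bounded (visibility_region (\<eta> \<omega>)))) \<and>
     (\<gamma> > gamma_crit d \<longrightarrow>
        (\<forall>(M0 :: 'v measure) (\<eta>0 :: 'v \<Rightarrow> 'a set set). poisson_hyperplane_process M0 \<gamma> 0 \<eta>0 \<longrightarrow>
           expected_visible_volume M \<eta> = expected_visible_volume M0 \<eta>0) \<and>
        expected_visible_volume M \<eta> =
          ennreal (pi powr ((real d - 1) / 2) * Gamma ((real d + 1) / 2) *
            (Gamma ((gamma_star d \<gamma> - real d + 1) / 2) / Gamma ((gamma_star d \<gamma> + real d + 1) / 2)))) \<and>
     (\<gamma> \<le> gamma_crit d \<longrightarrow> expected_visible_volume M \<eta> = \<infinity>)"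
proof -
  interpret H: hyperplane_process M \<gamma> lam \<eta> d
    using assms by (rule hyperplane_process_intro)
  have vol0: "expected_visible_volume M \<eta> = expected_visible_volume M0 \<eta>0"
    if "\<gamma> > gamma_crit d" "poisson_hyperplane_process M0 \<gamma> 0 \<eta>0"
    for M0 :: "'v measure" and \<eta>0 :: "'v \<Rightarrow> 'a set set"
  proof -
    interpret H0: hyperplane_process M0 \<gamma> 0 \<eta>0 d
      using assms that(2) by (intro hyperplane_process_intro) auto
    show ?thesis using H.expected_volume_finite[OF that(1)] H0.expected_volume_finite[OF that(1)] by simp
  qed
  show ?thesis
    using H.prob_unbounded_pos H.AE_bounded_supercritical H.AE_bounded_critical vol0
      H.expected_volume_finite H.expected_volume_infinite
    unfolding H.vis_def by (intro conjI impI allI) auto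
qed

end
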